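(* Let $(M,I,g,\nabla)$ be a simply connected special Kähler manifold of real dimension $n$, let $G$ be the group of affine holomorphic isometries of $(M,I,g,\nabla)$, let $\hat\theta$ be the induced action of $G$ on $(\mathbb{R}^n)^*$, and let $\hat\psi$ be the action of $G\ltimes_{\hat\theta}(\mathbb{R}^n)^*$ on $T^*M\simeq M\times(\mathbb{R}^n)^*$ given by $\hat\psi_{a\ltimes u}(m\times v)=\phi_a(m)\times(\hat\theta_a(v)+u)$, where $\phi$ is the action of $G$ on $M$. Then the hyper-Kähler structure $(I_1,I_2,I_3,g^{\mathrm c})$ on $T^*M$ is invariant under the action $\hat\psi$ of $G\ltimes_{\hat\theta}(\mathbb{R}^n)^*$. In particular, if $(M,I,g,\nabla)$ is a homogeneous special Kähler manifold for the group $G$, then $(T^*M,I_1,I_2,I_3,g^{\mathrm c})$ is a homogeneous hyper-Kähler manifold for the group $G\ltimes_{\hat\theta}(\mathbb{R}^n)^*$.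
   Context: A special Kähler manifold $(M,I,g,\nabla)$ is a Kähler manifold $(M,I,g)$ with Kähler form $\omega$, endowed with a flat torsion-free connection $\nabla$ which is symplectic ($\nabla\omega=0$) and such that $g$ is Hessian with respect to $\nabla$, i.e. in $\nabla$-flat local coordinates it is locally $g=\frac{\partial^2\varphi}{\partial x^i\partial x^j}dx^i dx^j$. An affine holomorphic isometry is a diffeomorphism of $M$ preserving $\nabla$, $I$ and $g$. Structure on $T^*M$: with $\pi:T^*M\to M$ the projection, $\nabla$ gives the splitting of $T(T^*M)$ into horizontal and vertical distributions, $T(T^*M)=T^h(T^*M)\oplus T^v(T^*M)\simeq\pi^*TM\oplus\pi^*T^*M$. In this splitting $$g^{\mathrm c}=\begin{pmatrix} g&0\\0&g^{-1}\end{pmatrix},\quad I_1=\begin{pmatrix} I&0\\0&I^*\end{pmatrix},\quad I_2=\begin{pmatrix}0&-\omega^{-1}\\ \omega&0\end{pmatrix},\quad I_3=I_1I_2,$$ where $\omega$ is regarded as a map $TM\to T^*M$. It is known that $(T^*M,I_1,I_2,I_3,g^{\mathrm c})$ is hyper-Kähler. Actions: since $M$ is simply connected there is a local affine diffeomorphism $\mathrm{dev}:M\to\mathbb{R}^n$ and an affine action $\theta$ of $G$ on $\mathbb{R}^n$ with $\mathrm{dev}\circ\phi_a=\theta_a\circ\mathrm{dev}$. The connection gives trivializations $TM\simeq M\times\mathbb{R}^n$ and $T^*M\simeq M\times(\mathbb{R}^n)^*$ (via $d\,\mathrm{dev}$ and its dual). The $\nabla$-flat form $\omega$ is a constant bilinear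 form on $\mathbb{R}^n$, giving an identification $\mathbb{R}^n\simeq(\mathbb{R}^n)^*$; $\hat\theta$ is the affine action on $(\mathbb{R}^n)^*$ obtained by conjugating $\theta$ with this identification. The group $G\ltimes_{\hat\theta}(\mathbb{R}^n)^*$ is $G\times(\mathbb{R}^n)^*$ with product $(a,u)(b,w)=(ab,\,u+\hat L_a w)$, $\hat L_a$ the linear part of $\hat\theta_a$. A homogeneous special Kähler (resp. hyper-Kähler) manifold for a group is one with a transitive action of the group preserving $I,g,\nabla$ (resp. the metric and the three complex structures). *)

theory Defs
  imports "HOL-Analysis.Analysis" "HOL-Algebra.Group_Action"
begin

section \<open>Smooth maps between normed spaces\<close>

abbreviation Dd :: "('a::real_normed_vector \<Rightarrow> 'b::real_normed_vector) \<Rightarrow> 'a \<Rightarrow> 'a \<Rightarrow> 'b"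
  where "Dd f x \<equiv> frechet_derivative f (at x)"

definition D2 :: "('a::real_normed_vector \<Rightarrow> 'b::real_normed_vector) \<Rightarrow> 'a \<Rightarrow> 'a \<Rightarrow> 'a \<Rightarrow> 'b"
  where "D2 f x u v = Dd (\<lambda>y. Dd f y v) x u"

text \<open>Used on open subsets of finite-dimensional spaces only, where continuity of all iterated
  directional derivatives is the usual notion of \<open>C\<^sup>k\<close>.\<close>

primrec Ck_on :: "nat \<Rightarrow> ('a::real_normed_vector \<Rightarrow> 'b::real_normed_vector) \<Rightarrow> 'a set \<Rightarrow> bool" where
  "Ck_on 0 f S \<longleftrightarrow> continuous_on S f"
| "Ck_on (Suc k) f S \<longleftrightarrow>
     (\<forall>x\<in>S. f differentiable (at x)) \<and> (\<forall>v. Ck_on k (\<lambda>x. Dd f x v) S)"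

definition smooth_on :: "('a::real_normed_vector \<Rightarrow> 'b::real_normed_vector) \<Rightarrow> 'a set \<Rightarrow> bool"
  where "smooth_on f S \<longleftrightarrow> (\<forall>k. Ck_on k f S)"


section \<open>Smooth manifolds\<close>

text \<open>A manifold is a set with an indexed atlas modelled on \<open>'e\<close>: \<open>cmap M i\<close> is the coordinate
  map on \<open>cdom M i\<close>, for \<open>i \<in> charts M\<close>. The atlas need not be maximal, and the topology is
  the one determined by the charts.\<close>

record ('i, 'a, 'e) atlas =
  points :: "'a set"
  charts :: "'i set"
  cdom :: "'i \<Rightarrow> 'a set"
  cmap :: "'i \<Rightarrow> 'a \<Rightarrow> 'e"

definition manifold_topology :: "('i, 'a, 'e::real_normed_vector) atlas \<Rightarrow> 'a topology" where
  "manifold_topology M =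
     topology (\<lambda>U. U \<subseteq> points M \<and> (\<forall>i\<in>charts M. open (cmap M i ` (U \<inter> cdom M i))))"

definition cinv :: "('i, 'a, 'e) atlas \<Rightarrow> 'i \<Rightarrow> 'e \<Rightarrow> 'a" where
  "cinv M i = inv_into (cdom M i) (cmap M i)"

definition smooth_manifold :: "('i, 'a, 'e::real_normed_vector) atlas \<Rightarrow> bool" where
  "smooth_manifold M \<longleftrightarrow>
     points M = (\<Union>i\<in>charts M. cdom M i) \<and>
     (\<forall>i\<in>charts M. inj_on (cmap M i) (cdom M i)) \<and>
     (\<forall>i\<in>charts M. \<forall>j\<in>charts M. open (cmap M i ` (cdom M i \<inter> cdom M j)) \<and>
        smooth_on (cmap M j \<circ> cinv M i) (cmap M i ` (cdom M i \<inter> cdom M j))) \<and>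
     Hausdorff_space (manifold_topology M) \<and>
     second_countable (manifold_topology M)"

definition simply_connected_manifold :: "('i, 'a, 'e::real_normed_vector) atlas \<Rightarrow> bool" where
  "simply_connected_manifold M \<longleftrightarrow>
     points M \<noteq> {} \<and>
     path_connected_space (manifold_topology M) \<and>
     (\<forall>p. pathin (manifold_topology M) p \<and> p 0 = p 1 \<longrightarrow>
        homotopic_with (\<lambda>r. r 0 = r 1) (top_of_set {0..1::real}) (manifold_topology M) p (\<lambda>t. p 0))"

definition local_rep ::
  "('i, 'a, 'e) atlas \<Rightarrow> 'i \<Rightarrow> ('j, 'b, 'f) atlas \<Rightarrow> 'j \<Rightarrow> ('a \<Rightarrow> 'b) \<Rightarrow> 'e \<Rightarrow> 'f" where
  "local_rep M i N j \<phi> = cmap N j \<circ> \<phi> \<circ> cinv M i"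

definition smooth_map ::
  "('i, 'a, 'e::real_normed_vector) atlas \<Rightarrow> ('j, 'b, 'f::real_normed_vector) atlas
     \<Rightarrow> ('a \<Rightarrow> 'b) \<Rightarrow> bool" where
  "smooth_map M N \<phi> \<longleftrightarrow> \<phi> ` points M \<subseteq> points N \<and>
     (\<forall>i\<in>charts M. \<forall>j\<in>charts N.
        open (cmap M i ` {p \<in> cdom M i. \<phi> p \<in> cdom N j}) \<and>
        smooth_on (local_rep M i N j \<phi>) (cmap M i ` {p \<in> cdom M i. \<phi> p \<in> cdom N j}))"

definition diffeomorphism ::
  "('i, 'a, 'e::real_normed_vector) atlas \<Rightarrow> ('j, 'b, 'f::real_normed_vector) atlas
     \<Rightarrow> ('a \<Rightarrow> 'b) \<Rightarrow> bool" where
  "diffeomorphism M N \<phi> \<longleftrightarrow> bij_betw \<phi> (points M) (points N) \<and>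
     smooth_map M N \<phi> \<and> smooth_map N M (inv_into (points M) \<phi>)"


section \<open>Tensor fields and connections in coordinates\<close>

text \<open>Tensor fields are families of components: \<open>T i x\<close> is the component tensor in the chart
  \<open>i\<close> at the coordinate point \<open>x \<in> cmap M i ` cdom M i\<close>. The \<open>maps_\<close> predicates say that
  \<open>\<phi>\<close> carries one family to another; for \<open>\<phi> = id\<close> they are the transformation law that makes
  a family of components a tensor field (or a connection).\<close>

type_synonym ('i, 'e) form2 = "'i \<Rightarrow> 'e \<Rightarrow> 'e \<Rightarrow> 'e \<Rightarrow> real"
type_synonym ('i, 'e) endo = "'i \<Rightarrow> 'e \<Rightarrow> 'e \<Rightarrow> 'e"
type_synonym ('i, 'e) christoffel = "'i \<Rightarrow> 'e \<Rightarrow> 'e \<Rightarrow> 'e \<Rightarrow> 'e"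

definition maps_form2 ::
  "('i, 'a, 'e::real_normed_vector) atlas \<Rightarrow> ('i, 'e) form2 \<Rightarrow>
   ('j, 'b, 'f::real_normed_vector) atlas \<Rightarrow> ('j, 'f) form2 \<Rightarrow> ('a \<Rightarrow> 'b) \<Rightarrow> bool" where
  "maps_form2 M g N h \<phi> \<longleftrightarrow>
     (\<forall>i\<in>charts M. \<forall>j\<in>charts N. \<forall>p\<in>cdom M i. \<phi> p \<in> cdom N j \<longrightarrow>
       (let x = cmap M i p; D = Dd (local_rep M i N j \<phi>) x in
          \<forall>u v. h j (cmap N j (\<phi> p)) (D u) (D v) = g i x u v))"

definition maps_endo ::
  "('i, 'a, 'e::real_normed_vector) atlas \<Rightarrow> ('i, 'e) endo \<Rightarrow>
   ('j, 'b, 'f::real_normed_vector) atlas \<Rightarrow> ('j, 'f) endo \<Rightarrow> ('a \<Rightarrow> 'b) \<Rightarrow> bool" where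
  "maps_endo M A N B \<phi> \<longleftrightarrow>
     (\<forall>i\<in>charts M. \<forall>j\<in>charts N. \<forall>p\<in>cdom M i. \<phi> p \<in> cdom N j \<longrightarrow>
       (let x = cmap M i p; D = Dd (local_rep M i N j \<phi>) x in
          \<forall>u. B j (cmap N j (\<phi> p)) (D u) = D (A i x u)))"

text \<open>A connection is given by its Christoffel symbols: \<open>\<nabla>\<^sub>X Y = DY(X) + C(X, Y)\<close> in a chart.
  \<open>christoffel_related F x C C'\<close> is their classical transformation law at \<open>x\<close> under a map \<open>F\<close>
  of coordinate domains.\<close>

definition christoffel_related ::
  "('e::real_normed_vector \<Rightarrow> 'f::real_normed_vector) \<Rightarrow> 'e \<Rightarrow>
   ('e \<Rightarrow> 'e \<Rightarrow> 'e) \<Rightarrow> ('f \<Rightarrow> 'f \<Rightarrow> 'f) \<Rightarrow> bool" where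
  "christoffel_related F x C C' \<longleftrightarrow>
     (\<forall>u v. C' (Dd F x u) (Dd F x v) + D2 F x u v = Dd F x (C u v))"

definition maps_connection ::
  "('i, 'a, 'e::real_normed_vector) atlas \<Rightarrow> ('i, 'e) christoffel \<Rightarrow>
   ('j, 'b, 'f::real_normed_vector) atlas \<Rightarrow> ('j, 'f) christoffel \<Rightarrow> ('a \<Rightarrow> 'b) \<Rightarrow> bool" where
  "maps_connection M C N C' \<phi> \<longleftrightarrow>
     (\<forall>i\<in>charts M. \<forall>j\<in>charts N. \<forall>p\<in>cdom M i. \<phi> p \<in> cdom N j \<longrightarrow>
        christoffel_related (local_rep M i N j \<phi>) (cmap M i p)
          (C i (cmap M i p)) (C' j (cmap N j (\<phi> p))))"

definition form2_field :: "('i, 'a, 'e::real_normed_vector) atlas \<Rightarrow> ('i, 'e) form2 \<Rightarrow> bool" where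
  "form2_field M g \<longleftrightarrow>
     (\<forall>i\<in>charts M. \<forall>x\<in>cmap M i ` cdom M i. bilinear (g i x)) \<and>
     (\<forall>i\<in>charts M. \<forall>u v. smooth_on (\<lambda>x. g i x u v) (cmap M i ` cdom M i)) \<and>
     maps_form2 M g M g id"

definition endo_field :: "('i, 'a, 'e::real_normed_vector) atlas \<Rightarrow> ('i, 'e) endo \<Rightarrow> bool" where
  "endo_field M A \<longleftrightarrow>
     (\<forall>i\<in>charts M. \<forall>x\<in>cmap M i ` cdom M i. linear (A i x)) \<and>
     (\<forall>i\<in>charts M. \<forall>u. smooth_on (\<lambda>x. A i x u) (cmap M i ` cdom M i)) \<and>
     maps_endo M A M A id"

definition affine_connection ::
  "('i, 'a, 'e::real_normed_vector) atlas \<Rightarrow> ('i, 'e) christoffel \<Rightarrow> bool" where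
  "affine_connection M C \<longleftrightarrow>
     (\<forall>i\<in>charts M. \<forall>x\<in>cmap M i ` cdom M i. bilinear (C i x)) \<and>
     (\<forall>i\<in>charts M. \<forall>u v. smooth_on (\<lambda>x. C i x u v) (cmap M i ` cdom M i)) \<and>
     maps_connection M C M C id"

definition lie_bracket :: "('e::real_normed_vector \<Rightarrow> 'e) \<Rightarrow> ('e \<Rightarrow> 'e) \<Rightarrow> 'e \<Rightarrow> 'e" where
  "lie_bracket X Y x = Dd Y x (X x) - Dd X x (Y x)"

definition cov_deriv ::
  "('e::real_normed_vector \<Rightarrow> 'e \<Rightarrow> 'e \<Rightarrow> 'e) \<Rightarrow> ('e \<Rightarrow> 'e) \<Rightarrow> ('e \<Rightarrow> 'e) \<Rightarrow> 'e \<Rightarrow> 'e" where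
  "cov_deriv C X Y x = Dd Y x (X x) + C x (X x) (Y x)"

text \<open>The tensorial conditions below are evaluated on coordinate (constant) vector fields, whose
  Lie brackets vanish.\<close>

definition torsion_free ::
  "('i, 'a, 'e::real_normed_vector) atlas \<Rightarrow> ('i, 'e) christoffel \<Rightarrow> bool" where
  "torsion_free M C \<longleftrightarrow> (\<forall>i\<in>charts M. \<forall>x\<in>cmap M i ` cdom M i. \<forall>u v.
     cov_deriv (C i) (\<lambda>_. u) (\<lambda>_. v) x = cov_deriv (C i) (\<lambda>_. v) (\<lambda>_. u) x)"

definition flat_connection ::
  "('i, 'a, 'e::real_normed_vector) atlas \<Rightarrow> ('i, 'e) christoffel \<Rightarrow> bool" where
  "flat_connection M C \<longleftrightarrow> (\<forall>i\<in>charts M. \<forall>x\<in>cmap M i ` cdom M i. \<forall>u v w.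
     cov_deriv (C i) (\<lambda>_. u) (cov_deriv (C i) (\<lambda>_. v) (\<lambda>_. w)) x =
     cov_deriv (C i) (\<lambda>_. v) (cov_deriv (C i) (\<lambda>_. u) (\<lambda>_. w)) x)"

definition parallel_form2 ::
  "('i, 'a, 'e::real_normed_vector) atlas \<Rightarrow> ('i, 'e) christoffel \<Rightarrow> ('i, 'e) form2 \<Rightarrow> bool" where
  "parallel_form2 M C \<omega> \<longleftrightarrow> (\<forall>i\<in>charts M. \<forall>x\<in>cmap M i ` cdom M i. \<forall>u v w.
     Dd (\<lambda>y. \<omega> i y v w) x u =
       \<omega> i x (cov_deriv (C i) (\<lambda>_. u) (\<lambda>_. v) x) w + \<omega> i x v (cov_deriv (C i) (\<lambda>_. u) (\<lambda>_. w) x))"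

definition closed_form2 ::
  "('i, 'a, 'e::real_normed_vector) atlas \<Rightarrow> ('i, 'e) form2 \<Rightarrow> bool" where
  "closed_form2 M \<omega> \<longleftrightarrow> (\<forall>i\<in>charts M. \<forall>x\<in>cmap M i ` cdom M i. \<forall>u v w.
     Dd (\<lambda>y. \<omega> i y v w) x u + Dd (\<lambda>y. \<omega> i y w u) x v + Dd (\<lambda>y. \<omega> i y u v) x w = 0)"

definition nijenhuis ::
  "('e::real_normed_vector \<Rightarrow> 'e \<Rightarrow> 'e) \<Rightarrow> ('e \<Rightarrow> 'e) \<Rightarrow> ('e \<Rightarrow> 'e) \<Rightarrow> 'e \<Rightarrow> 'e" where
  "nijenhuis J X Y x =
     lie_bracket (\<lambda>y. J y (X y)) (\<lambda>y. J y (Y y)) x - J x (lie_bracket (\<lambda>y. J y (X y)) Y x)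
       - J x (lie_bracket X (\<lambda>y. J y (Y y)) x) - lie_bracket X Y x"


section \<open>Kaehler, special Kaehler and hyper-Kaehler manifolds\<close>

definition riemannian_metric ::
  "('i, 'a, 'e::real_normed_vector) atlas \<Rightarrow> ('i, 'e) form2 \<Rightarrow> bool" where
  "riemannian_metric M g \<longleftrightarrow> form2_field M g \<and>
     (\<forall>i\<in>charts M. \<forall>x\<in>cmap M i ` cdom M i.
        (\<forall>u v. g i x u v = g i x v u) \<and> (\<forall>u. u \<noteq> 0 \<longrightarrow> g i x u u > 0))"

text \<open>Integrability is vanishing of the Nijenhuis tensor.\<close>

definition complex_structure ::
  "('i, 'a, 'e::real_normed_vector) atlas \<Rightarrow> ('i, 'e) endo \<Rightarrow> bool" where
  "complex_structure M J \<longleftrightarrow> endo_field M J \<and>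
     (\<forall>i\<in>charts M. \<forall>x\<in>cmap M i ` cdom M i.
        (\<forall>u. J i x (J i x u) = - u) \<and>
        (\<forall>u v. nijenhuis (J i) (\<lambda>_. u) (\<lambda>_. v) x = 0))"

text \<open>Convention \<open>\<omega> = g(J\<cdot>, \<cdot>)\<close>, and \<open>\<omega>\<close> as a map \<open>TM \<rightarrow> T\<^sup>*M\<close> is \<open>u \<mapsto> \<omega>(u, \<cdot>)\<close>.\<close>

definition kaehler_form ::
  "('i, 'e) form2 \<Rightarrow> ('i, 'e) endo \<Rightarrow> ('i, 'e) form2" where
  "kaehler_form g J i x u v = g i x (J i x u) v"

definition kaehler_manifold ::
  "('i, 'a, 'e::real_normed_vector) atlas \<Rightarrow> ('i, 'e) endo \<Rightarrow> ('i, 'e) form2 \<Rightarrow> bool" where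
  "kaehler_manifold M J g \<longleftrightarrow> smooth_manifold M \<and> riemannian_metric M g \<and> complex_structure M J \<and>
     (\<forall>i\<in>charts M. \<forall>x\<in>cmap M i ` cdom M i. \<forall>u v. g i x (J i x u) (J i x v) = g i x u v) \<and>
     closed_form2 M (kaehler_form g J)"

text \<open>\<open>(U, x)\<close> is a smooth coordinate system (compatible with the atlas of \<open>M\<close>) in which all
  Christoffel symbols vanish.\<close>

definition flat_coordinates ::
  "('i, 'a, 'e::real_normed_vector) atlas \<Rightarrow> ('i, 'e) christoffel \<Rightarrow> 'a set \<Rightarrow> ('a \<Rightarrow> 'e) \<Rightarrow> bool"
where
  "flat_coordinates M C U x \<longleftrightarrow>
     openin (manifold_topology M) U \<and> inj_on x U \<and>
     (\<forall>i\<in>charts M.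
        open (x ` (U \<inter> cdom M i)) \<and>
        smooth_on (x \<circ> cinv M i) (cmap M i ` (U \<inter> cdom M i)) \<and>
        smooth_on (cmap M i \<circ> inv_into U x) (x ` (U \<inter> cdom M i)) \<and>
        (\<forall>p\<in>U \<inter> cdom M i.
           christoffel_related (x \<circ> cinv M i) (cmap M i p) (C i (cmap M i p)) (\<lambda>_ _. 0)))"

text \<open>Around every point there are flat coordinates \<open>x\<close> and a function \<open>f\<close> of them with
  \<open>g = \<partial>\<^sup>2f/\<partial>x\<^sup>i\<partial>x\<^sup>j dx\<^sup>i dx\<^sup>j\<close>.\<close>

definition hessian_metric ::
  "('i, 'a, 'e::real_normed_vector) atlas \<Rightarrow> ('i, 'e) christoffel \<Rightarrow> ('i, 'e) form2 \<Rightarrow> bool" where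
  "hessian_metric M C g \<longleftrightarrow>
     (\<forall>q\<in>points M. \<exists>U x. \<exists>f :: 'e \<Rightarrow> real. q \<in> U \<and> flat_coordinates M C U x \<and> smooth_on f (x ` U) \<and>
        (\<forall>i\<in>charts M. \<forall>p\<in>U \<inter> cdom M i.
           let D = Dd (x \<circ> cinv M i) (cmap M i p) in
             \<forall>u v. g i (cmap M i p) u v = D2 f (x p) (D u) (D v)))"

definition special_kaehler ::
  "('i, 'a, 'e::real_normed_vector) atlas \<Rightarrow> ('i, 'e) endo \<Rightarrow> ('i, 'e) form2 \<Rightarrow>
   ('i, 'e) christoffel \<Rightarrow> bool" where
  "special_kaehler M J g C \<longleftrightarrow> kaehler_manifold M J g \<and>
     affine_connection M C \<and> flat_connection M C \<and> torsion_free M C \<and>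
     parallel_form2 M C (kaehler_form g J) \<and> hessian_metric M C g"

definition hyperkaehler ::
  "('i, 'a, 'e::real_normed_vector) atlas \<Rightarrow> ('i, 'e) endo \<Rightarrow> ('i, 'e) endo \<Rightarrow> ('i, 'e) endo \<Rightarrow>
   ('i, 'e) form2 \<Rightarrow> bool" where
  "hyperkaehler N J1 J2 J3 g \<longleftrightarrow>
     kaehler_manifold N J1 g \<and> kaehler_manifold N J2 g \<and> kaehler_manifold N J3 g \<and>
     (\<forall>i\<in>charts N. \<forall>x\<in>cmap N i ` cdom N i. \<forall>w.
        J1 i x (J2 i x w) = J3 i x w \<and> J2 i x (J1 i x w) = - J3 i x w)"


section \<open>Isometries and homogeneous manifolds\<close>

definition affine_holomorphic_isometry ::
  "('i, 'a, 'e::real_normed_vector) atlas \<Rightarrow> ('i, 'e) endo \<Rightarrow> ('i, 'e) form2 \<Rightarrow>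
   ('i, 'e) christoffel \<Rightarrow> ('a \<Rightarrow> 'a) \<Rightarrow> bool" where
  "affine_holomorphic_isometry M J g C \<phi> \<longleftrightarrow> diffeomorphism M M \<phi> \<and>
     maps_connection M C M C \<phi> \<and> maps_endo M J M J \<phi> \<and> maps_form2 M g M g \<phi>"

definition isometry_group ::
  "('i, 'a, 'e::real_normed_vector) atlas \<Rightarrow> ('i, 'e) endo \<Rightarrow> ('i, 'e) form2 \<Rightarrow>
   ('i, 'e) christoffel \<Rightarrow> ('a \<Rightarrow> 'a) monoid" where
  "isometry_group M J g C =
     (BijGroup (points M)) \<lparr>carrier := {\<phi> \<in> Bij (points M). affine_holomorphic_isometry M J g C \<phi>}\<rparr>"

definition preserves_hyperkaehler ::
  "('i, 'a, 'e::real_normed_vector) atlas \<Rightarrow> ('i, 'e) endo \<Rightarrow> ('i, 'e) endo \<Rightarrow> ('i, 'e) endo \<Rightarrow>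
   ('i, 'e) form2 \<Rightarrow> ('a \<Rightarrow> 'a) \<Rightarrow> bool" where
  "preserves_hyperkaehler N J1 J2 J3 g \<phi> \<longleftrightarrow> diffeomorphism N N \<phi> \<and>
     maps_endo N J1 N J1 \<phi> \<and> maps_endo N J2 N J2 \<phi> \<and> maps_endo N J3 N J3 \<phi> \<and>
     maps_form2 N g N g \<phi>"

definition homogeneous_special_kaehler ::
  "('i, 'a, 'e::real_normed_vector) atlas \<Rightarrow> ('i, 'e) endo \<Rightarrow> ('i, 'e) form2 \<Rightarrow>
   ('i, 'e) christoffel \<Rightarrow> 'h monoid \<Rightarrow> ('h \<Rightarrow> 'a \<Rightarrow> 'a) \<Rightarrow> bool" where
  "homogeneous_special_kaehler M J g C H \<phi> \<longleftrightarrow> special_kaehler M J g C \<and>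
     transitive_action H (points M) \<phi> \<and>
     (\<forall>h\<in>carrier H. affine_holomorphic_isometry M J g C (\<phi> h))"

definition homogeneous_hyperkaehler ::
  "('i, 'a, 'e::real_normed_vector) atlas \<Rightarrow> ('i, 'e) endo \<Rightarrow> ('i, 'e) endo \<Rightarrow> ('i, 'e) endo \<Rightarrow>
   ('i, 'e) form2 \<Rightarrow> 'h monoid \<Rightarrow> ('h \<Rightarrow> 'a \<Rightarrow> 'a) \<Rightarrow> bool" where
  "homogeneous_hyperkaehler N J1 J2 J3 g H \<psi> \<longleftrightarrow> hyperkaehler N J1 J2 J3 g \<and>
     transitive_action H (points N) \<psi> \<and>
     (\<forall>h\<in>carrier H. preserves_hyperkaehler N J1 J2 J3 g (\<psi> h))"


section \<open>The cotangent bundle and its hyper-Kaehler structure\<close>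

type_synonym 'e dual = "'e \<Rightarrow>\<^sub>L real"

text \<open>A covector at \<open>p\<close> is the family of its components in the charts around \<open>p\<close> (and \<open>0\<close> for
  the other indices, so that the family is unique).\<close>

definition covector ::
  "('i, 'a, 'e::real_normed_vector) atlas \<Rightarrow> 'a \<Rightarrow> ('i \<Rightarrow> 'e dual) \<Rightarrow> bool" where
  "covector M p \<alpha> \<longleftrightarrow>
     (\<forall>i\<in>charts M. \<forall>j\<in>charts M. p \<in> cdom M i \<inter> cdom M j \<longrightarrow>
        (\<forall>u. blinfun_apply (\<alpha> i) u = blinfun_apply (\<alpha> j) (Dd (cmap M j \<circ> cinv M i) (cmap M i p) u))) \<and>
     (\<forall>i. \<not> (i \<in> charts M \<and> p \<in> cdom M i) \<longrightarrow> \<alpha> i = 0)"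

definition cotangent_bundle ::
  "('i, 'a, 'e::real_normed_vector) atlas \<Rightarrow> ('i, 'a \<times> ('i \<Rightarrow> 'e dual), 'e \<times> 'e dual) atlas" where
  "cotangent_bundle M =
     \<lparr>points = {(p, \<alpha>). p \<in> points M \<and> covector M p \<alpha>},
      charts = charts M,
      cdom = (\<lambda>i. {(p, \<alpha>). p \<in> cdom M i \<and> covector M p \<alpha>}),
      cmap = (\<lambda>i (p, \<alpha>). (cmap M i p, \<alpha> i))\<rparr>"

text \<open>The splitting of \<open>T(T\<^sup>*M)\<close> at the point with bundle coordinates \<open>(x, p)\<close>: a tangent vector
  \<open>(u, \<eta>)\<close> has horizontal part \<open>d\<pi>(u, \<eta>) = u\<close> and vertical part the covariant derivative
  \<open>\<eta> - p(C(u, \<cdot>))\<close> of a curve of covectors with velocity \<open>(u, \<eta>)\<close>.\<close>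

definition hv_split ::
  "('e::real_normed_vector \<Rightarrow> 'e \<Rightarrow> 'e \<Rightarrow> 'e) \<Rightarrow> 'e \<times> 'e dual \<Rightarrow> 'e \<times> 'e dual \<Rightarrow> 'e \<times> 'e dual" where
  "hv_split C = (\<lambda>(x, p) (u, \<eta>). (u, \<eta> - Blinfun (\<lambda>v. blinfun_apply p (C x u v))))"

definition hv_join ::
  "('e::real_normed_vector \<Rightarrow> 'e \<Rightarrow> 'e \<Rightarrow> 'e) \<Rightarrow> 'e \<times> 'e dual \<Rightarrow> 'e \<times> 'e dual \<Rightarrow> 'e \<times> 'e dual" where
  "hv_join C = (\<lambda>(x, p) (u, \<beta>). (u, \<beta> + Blinfun (\<lambda>v. blinfun_apply p (C x u v))))"

definition flat_map :: "('e::real_normed_vector \<Rightarrow> 'e \<Rightarrow> real) \<Rightarrow> 'e \<Rightarrow> 'e dual" where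
  "flat_map B u = Blinfun (B u)"

definition sharp_map :: "('e::real_normed_vector \<Rightarrow> 'e \<Rightarrow> real) \<Rightarrow> 'e dual \<Rightarrow> 'e" where
  "sharp_map B = inv_into UNIV (flat_map B)"

definition cot_g ::
  "('i, 'e::real_normed_vector) form2 \<Rightarrow> ('i, 'e) christoffel \<Rightarrow> ('i, 'e \<times> 'e dual) form2" where
  "cot_g g C i \<xi> w w' =
     (let x = fst \<xi>; (u, \<beta>) = hv_split (C i) \<xi> w; (u', \<beta>') = hv_split (C i) \<xi> w'
      in g i x u u' + blinfun_apply \<beta>' (sharp_map (g i x) \<beta>))"

definition cot_I1 ::
  "('i, 'e::real_normed_vector) endo \<Rightarrow> ('i, 'e) christoffel \<Rightarrow> ('i, 'e \<times> 'e dual) endo" where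
  "cot_I1 J C i \<xi> w =
     (let x = fst \<xi>; (u, \<beta>) = hv_split (C i) \<xi> w
      in hv_join (C i) \<xi> (J i x u, Blinfun (\<lambda>v. blinfun_apply \<beta> (J i x v))))"

definition cot_I2 ::
  "('i, 'e::real_normed_vector) form2 \<Rightarrow> ('i, 'e) christoffel \<Rightarrow> ('i, 'e \<times> 'e dual) endo" where
  "cot_I2 \<omega> C i \<xi> w =
     (let x = fst \<xi>; (u, \<beta>) = hv_split (C i) \<xi> w
      in hv_join (C i) \<xi> (- sharp_map (\<omega> i x) \<beta>, flat_map (\<omega> i x) u))"

definition cot_I3 ::
  "('i, 'e::real_normed_vector) endo \<Rightarrow> ('i, 'e) form2 \<Rightarrow> ('i, 'e) christoffel \<Rightarrow>
   ('i, 'e \<times> 'e dual) endo" where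
  "cot_I3 J \<omega> C i \<xi> w = cot_I1 J C i \<xi> (cot_I2 \<omega> C i \<xi> w)"


section \<open>The developing map and the induced actions\<close>

text \<open>A local affine diffeomorphism into the model space with its standard flat connection, i.e. a
  global map restricting to flat coordinates near each point.\<close>

definition developing_map ::
  "('i, 'a, 'e::real_normed_vector) atlas \<Rightarrow> ('i, 'e) christoffel \<Rightarrow> ('a \<Rightarrow> 'e) \<Rightarrow> bool" where
  "developing_map M C dev \<longleftrightarrow> (\<forall>p\<in>points M. \<exists>U. p \<in> U \<and> flat_coordinates M C U dev)"

text \<open>The affine map with \<open>dev \<circ> a = \<theta>\<^sub>a \<circ> dev\<close>; it is unique because \<open>dev\<close> is open.\<close>

definition theta ::
  "('i, 'a, 'e::real_normed_vector) atlas \<Rightarrow> ('a \<Rightarrow> 'e) \<Rightarrow> ('a \<Rightarrow> 'a) \<Rightarrow> 'e \<Rightarrow> 'e" where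
  "theta M dev a = (THE f. (\<exists>L b. linear L \<and> f = (\<lambda>x. L x + b)) \<and>
                           (\<forall>m\<in>points M. dev (a m) = f (dev m)))"

text \<open>The constant bilinear form on the model space that corresponds to \<open>\<omega>\<close> under \<open>d dev\<close>.\<close>

definition flat_omega ::
  "('i, 'a, 'e::real_normed_vector) atlas \<Rightarrow> ('a \<Rightarrow> 'e) \<Rightarrow> ('i, 'e) form2 \<Rightarrow> 'e \<Rightarrow> 'e \<Rightarrow> real" where
  "flat_omega M dev \<omega> = (THE B. bilinear B \<and>
     (\<forall>i\<in>charts M. \<forall>m\<in>cdom M i. let D = Dd (dev \<circ> cinv M i) (cmap M i m) in
        \<forall>u v. B (D u) (D v) = \<omega> i (cmap M i m) u v))"

definition theta_hat ::
  "('i, 'a, 'e::real_normed_vector) atlas \<Rightarrow> ('a \<Rightarrow> 'e) \<Rightarrow> ('i, 'e) form2 \<Rightarrow>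
   ('a \<Rightarrow> 'a) \<Rightarrow> 'e dual \<Rightarrow> 'e dual" where
  "theta_hat M dev \<omega> a =
     flat_map (flat_omega M dev \<omega>) \<circ> theta M dev a \<circ> sharp_map (flat_omega M dev \<omega>)"

definition linear_part :: "('v::real_vector \<Rightarrow> 'v) \<Rightarrow> 'v \<Rightarrow> 'v" where
  "linear_part f w = f w - f 0"

definition affine_semidirect :: "'g monoid \<Rightarrow> ('g \<Rightarrow> 'v::real_vector \<Rightarrow> 'v) \<Rightarrow> ('g \<times> 'v) monoid" where
  "affine_semidirect G \<theta> =
     \<lparr>carrier = carrier G \<times> UNIV,
      mult = (\<lambda>(a, u) (b, w). (a \<otimes>\<^bsub>G\<^esub> b, u + linear_part (\<theta> a) w)),
      one = (\<one>\<^bsub>G\<^esub>, 0)\<rparr>"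

text \<open>The inverse of the trivialization \<open>T\<^sup>*M \<simeq> M \<times> 'e dual\<close>: \<open>(m, v)\<close> corresponds to the
  covector \<open>v \<circ> d dev\<^sub>m\<close> at \<open>m\<close>.\<close>

definition cot_point ::
  "('i, 'a, 'e::real_normed_vector) atlas \<Rightarrow> ('a \<Rightarrow> 'e) \<Rightarrow> 'a \<times> 'e dual \<Rightarrow> 'a \<times> ('i \<Rightarrow> 'e dual)" where
  "cot_point M dev = (\<lambda>(m, v). (m, \<lambda>i. if i \<in> charts M \<and> m \<in> cdom M i
      then Blinfun (\<lambda>u. blinfun_apply v (Dd (dev \<circ> cinv M i) (cmap M i m) u)) else 0))"

definition psi_hat ::
  "('i, 'a, 'e::real_normed_vector) atlas \<Rightarrow> ('a \<Rightarrow> 'e) \<Rightarrow> ('i, 'e) form2 \<Rightarrow>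
   ('a \<Rightarrow> 'a) \<times> 'e dual \<Rightarrow> 'a \<times> ('i \<Rightarrow> 'e dual) \<Rightarrow> 'a \<times> ('i \<Rightarrow> 'e dual)" where
  "psi_hat M dev \<omega> = (\<lambda>(a, u). \<lambda>\<xi>\<in>points (cotangent_bundle M).
     (let (m, v) = inv_into (points M \<times> UNIV) (cot_point M dev) \<xi>
      in cot_point M dev (a m, theta_hat M dev \<omega> a v + u)))"

end

theory Submission
  imports Defs
begin

text \<open>
  The developing map and the parallel form \<open>\<omega>\<close> identify the cotangent bundle with \<open>M \<times> \<real>\<^sup>n\<close>. Split a tangent
  vector of \<open>T\<^sup>*M\<close> as \<open>(u, \<omega>(w, \<cdot>))\<close> with \<open>u\<close>, \<open>w\<close> tangent to \<open>M\<close>; then the structure is given by the block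
  formulas \<open>g(u, u') + g(w, w')\<close>, \<open>I\<^sub>1(u, w) = (Ju, -Jw)\<close>, \<open>I\<^sub>2(u, w) = (-w, u)\<close>,
  \<open>I\<^sub>3(u, w) = (-Jw, -Ju)\<close>, which only involve \<open>g\<close> and \<open>J\<close>. An affine holomorphic isometry \<open>a\<close> with
  \<open>dev \<circ> a = L \<circ> dev + b\<close> acts on \<open>M \<times> \<real>\<^sup>n\<close> by \<open>(m, w) \<mapsto> (a m, L w + c)\<close>, and since \<open>L\<close> preserves \<open>\<omega>\<close> its
  differential is \<open>(u, w) \<mapsto> (da u, da w)\<close>. Hence it preserves every block tensor built from \<open>g\<close> and \<open>J\<close>.

  In flat coordinates \<open>\<omega>\<close> is constant, and the Hessian condition says that the derivative of \<open>J\<close> is symmetric,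
  \<open>(\<partial>\<^sub>r J) s = (\<partial>\<^sub>s J) r\<close>. This makes the three Nijenhuis tensors vanish and the three Kaehler forms closed: two
  of them have constant coefficients, the third is closed by the symmetry.
\<close>

text \<open>The charts of \<open>M\<close> are arbitrary, so in the bundle charts the Christoffel
  symbols enter every tensor on the cotangent bundle. The computations are therefore made along
  \<open>Theta\<close>, a parametrization of part of the bundle by flat coordinates, and reach the
  bundle charts by naturality: an intertwining relation along a smooth map whose differential is
  onto.

  The symmetry of the derivative of J arises as follows. Since g = Bf(., J.) with \<open>Bf\<close>
  constant, Bf(s, (d_r J) t) is the covariant derivative of g, that is, a third derivative of the
  Hessian potential. It is totally symmetric, and \<open>Bf\<close> is nondegenerate. The other rule
  needed comes from differentiating J J = -1.

  The fibre coordinate is w rather than the covector Bf(w, .). As \<open>theta_hat\<close> is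
  conjugate to \<open>theta\<close>, the group then acts on base and fibre through the same linear
  map L, and no transposed inverse appears.

  Constants (the form \<open>Bf\<close>, the linear part and the translation part of an affine map)
  all come from one principle: a family that is compatible on overlaps and has zero derivative in
  flat coordinates is constant on a connected manifold.\<close>

section \<open>Calculus of smooth maps\<close>

text \<open>Finite dimension has to cover the dual space \<open>'e \<Rightarrow>\<^sub>L real\<close>, which is not an instance of
  \<open>euclidean_space\<close>. It is expressed by a finite frame \<open>b\<close> with bounded coordinate functionals
  \<open>\<phi>\<close>; their bounded linearity is spelled out because inside the class declaration \<open>'a\<close> does not
  yet have the sort that \<open>bounded_linear\<close> needs.\<close>

class fin_dim = real_normed_vector +
  assumes ex_frame_raw: "\<exists>(n::nat) \<phi> b.
    (\<forall>i<n. (\<forall>x y. \<phi> i (x + y) = \<phi> i x + \<phi> i y) \<and> (\<forall>r x. \<phi> i (r *\<^sub>R x) = r * \<phi> i x) \<and>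
       (\<exists>K. \<forall>x. \<bar>\<phi> i x\<bar> \<le> norm x * K)) \<and>
    (\<forall>x. (\<Sum>i<n. \<phi> i x *\<^sub>R b i) = x)"

lemma bounded_linear_real_iff:
  "bounded_linear (f :: 'a::real_normed_vector \<Rightarrow> real) \<longleftrightarrow>
    (\<forall>x y. f (x + y) = f x + f y) \<and> (\<forall>r x. f (r *\<^sub>R x) = r * f x) \<and> (\<exists>K. \<forall>x. \<bar>f x\<bar> \<le> norm x * K)"
  by (auto simp: bounded_linear_def bounded_linear_axioms_def linear_iff)

lemma ex_frame_nat: "\<exists>(n::nat) \<phi> b. (\<forall>i<n. bounded_linear (\<phi> i :: 'a::fin_dim \<Rightarrow> real)) \<and>
    (\<forall>x. (\<Sum>i<n. \<phi> i x *\<^sub>R b i) = x)"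
  using ex_frame_raw[where 'a = 'a] unfolding bounded_linear_real_iff .

text \<open>The class axiom indexes a frame by natural numbers. Products, operator spaces and
  Euclidean spaces come with frames over index sets of their own, which are renumbered here.\<close>

lemma fin_dimI:
  fixes \<phi> :: "'i \<Rightarrow> 'a::real_normed_vector \<Rightarrow> real"
  assumes "finite I" and "\<And>i. i \<in> I \<Longrightarrow> bounded_linear (\<phi> i)"
    and "\<And>x. (\<Sum>i\<in>I. \<phi> i x *\<^sub>R b i) = x"
  shows "\<exists>(n::nat) (\<phi> :: nat \<Rightarrow> 'a \<Rightarrow> real) b.
    (\<forall>i<n. (\<forall>x y. \<phi> i (x + y) = \<phi> i x + \<phi> i y) \<and> (\<forall>r x. \<phi> i (r *\<^sub>R x) = r * \<phi> i x) \<and>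
       (\<exists>K. \<forall>x. \<bar>\<phi> i x\<bar> \<le> norm x * K)) \<and>
    (\<forall>x. (\<Sum>i<n. \<phi> i x *\<^sub>R b i) = x)"
proof -
  obtain h where h: "bij_betw h {..<card I} I"
    using ex_bij_betw_nat_finite[OF assms(1)] by (auto simp: lessThan_atLeast0)
  have A: "\<forall>x. (\<Sum>k<card I. \<phi> (h k) x *\<^sub>R b (h k)) = x"
    using assms(3) sum.reindex_bij_betw[OF h, of "\<lambda>i. \<phi> i _ *\<^sub>R b i"] by simp
  have "\<forall>k<card I. bounded_linear (\<phi> (h k))"
    using assms(2) h by (auto simp: bij_betw_def)
  note B = this[unfolded bounded_linear_real_iff]
  show ?thesis
    by (rule exI[of _ "card I"], rule exI[of _ "\<lambda>k. \<phi> (h k)"], rule exI[of _ "\<lambda>k. b (h k)"],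
        rule conjI, fact B, fact A)
qed

lemma linear_frame:
  assumes "linear f" "\<And>x. (\<Sum>i<n. \<phi> i x *\<^sub>R b i) = x"
  shows "f t = (\<Sum>i<(n::nat). \<phi> i t *\<^sub>R f (b i))"
proof -
  have "f t = f (\<Sum>i<n. \<phi> i t *\<^sub>R b i)" by (simp add: assms(2))
  also have "\<dots> = (\<Sum>i<n. \<phi> i t *\<^sub>R f (b i))" by (simp add: linear_sum[OF assms(1)] linear_scale[OF assms(1)])
  finally show ?thesis .
qed

instance prod :: (fin_dim, fin_dim) fin_dim
proof
  obtain n :: nat and \<phi> :: "nat \<Rightarrow> 'a \<Rightarrow> real" and b where
    1: "\<forall>i<n. bounded_linear (\<phi> i)" "\<forall>x. (\<Sum>i<n. \<phi> i x *\<^sub>R b i) = x" using ex_frame_nat by blast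
  obtain m :: nat and \<psi> :: "nat \<Rightarrow> 'b \<Rightarrow> real" and c where
    2: "\<forall>i<m. bounded_linear (\<psi> i)" "\<forall>x. (\<Sum>i<m. \<psi> i x *\<^sub>R c i) = x" using ex_frame_nat by blast
  let ?F = "\<lambda>s (p::'a\<times>'b). case s of Inl i \<Rightarrow> \<phi> i (fst p) | Inr j \<Rightarrow> \<psi> j (snd p)"
  let ?B = "\<lambda>s. case s of Inl i \<Rightarrow> (b i, 0) | Inr j \<Rightarrow> (0, c j)"
  have bl: "bounded_linear (?F s)" if "s \<in> {..<n} <+> {..<m}" for s
    using that 1(1) 2(1)
    by (auto intro!: bounded_linear_compose[OF _ bounded_linear_fst] bounded_linear_compose[OF _ bounded_linear_snd])
  have "(\<Sum>s\<in>{..<n} <+> {..<m}. ?F s p *\<^sub>R ?B s) = p" for p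
    using 1(2)[rule_format, of "fst p"] 2(2)[rule_format, of "snd p"]
    by (simp add: sum.Plus prod_eq_iff fst_sum snd_sum)
  then show "\<exists>(n::nat) (\<phi> :: nat \<Rightarrow> ('a \<times> 'b) \<Rightarrow> real) b.
    (\<forall>i<n. (\<forall>x y. \<phi> i (x + y) = \<phi> i x + \<phi> i y) \<and> (\<forall>r x. \<phi> i (r *\<^sub>R x) = r * \<phi> i x) \<and>
       (\<exists>K. \<forall>x. \<bar>\<phi> i x\<bar> \<le> norm x * K)) \<and>
    (\<forall>x. (\<Sum>i<n. \<phi> i x *\<^sub>R b i) = x)"
    by (intro fin_dimI[of "{..<n} <+> {..<m}" ?F ?B] bl) auto
qed

instance blinfun :: (fin_dim, fin_dim) fin_dim
proof
  obtain n :: nat and \<phi> :: "nat \<Rightarrow> 'a \<Rightarrow> real" and b where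
    1: "\<forall>i<n. bounded_linear (\<phi> i)" "\<forall>x. (\<Sum>i<n. \<phi> i x *\<^sub>R b i) = x" using ex_frame_nat by blast
  obtain m :: nat and \<psi> :: "nat \<Rightarrow> 'b \<Rightarrow> real" and c where
    2: "\<forall>i<m. bounded_linear (\<psi> i)" "\<forall>x. (\<Sum>i<m. \<psi> i x *\<^sub>R c i) = x" using ex_frame_nat by blast
  \<comment> \<open>The frame consists of the rank-one operators built from a coordinate functional
    of the source and a frame vector of the target. The coordinates of \<open>f\<close> are those of
    the vectors \<open>f (b i)\<close>.\<close>
  let ?F = "\<lambda>(i,j) (f::'a \<Rightarrow>\<^sub>L 'b). \<psi> j (f (b i))"
  let ?B = "\<lambda>(i,j). Blinfun (\<lambda>x. \<phi> i x *\<^sub>R c j)"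
  have bl: "bounded_linear (?F s)" if "s \<in> {..<n} \<times> {..<m}" for s
    using that 2(1) by (auto intro!: bounded_linear_compose[OF _ blinfun.bounded_linear_left])
  have "(\<Sum>s\<in>{..<n} \<times> {..<m}. ?F s f *\<^sub>R ?B s) = f" for f
  proof (rule blinfun_eqI)
    fix x
    have app: "blinfun_apply (\<Sum>s\<in>S. G s) x = (\<Sum>s\<in>S. blinfun_apply (G s) x)" for S and G :: "nat \<times> nat \<Rightarrow> 'a \<Rightarrow>\<^sub>L 'b"
      by (rule blinfun.sum_left)
    have "f x = (\<Sum>i<n. \<phi> i x *\<^sub>R f (b i))"
      by (rule linear_frame[OF _ 1(2)[rule_format]]) (simp add: blinfun.bounded_linear_right bounded_linear.linear)
    also have "\<dots> = (\<Sum>i<n. \<phi> i x *\<^sub>R (\<Sum>j<m. \<psi> j (f (b i)) *\<^sub>R c j))"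
      by (simp add: 2(2)[rule_format])
    also have "\<dots> = (\<Sum>s\<in>{..<n} \<times> {..<m}. blinfun_apply (?F s f *\<^sub>R ?B s) x)"
      unfolding scaleR_sum_right sum.cartesian_product
      using 1(1) by (intro sum.cong refl)
        (auto simp: blinfun.scaleR_left bounded_linear_Blinfun_apply bounded_linear_scaleR_const mult.commute split: prod.splits)
    finally show "blinfun_apply (\<Sum>s\<in>{..<n} \<times> {..<m}. ?F s f *\<^sub>R ?B s) x = blinfun_apply f x"
      by (simp add: app)
  qed
  then show "\<exists>(n::nat) (\<phi> :: nat \<Rightarrow> ('a \<Rightarrow>\<^sub>L 'b) \<Rightarrow> real) b.
    (\<forall>i<n. (\<forall>x y. \<phi> i (x + y) = \<phi> i x + \<phi> i y) \<and> (\<forall>r x. \<phi> i (r *\<^sub>R x) = r * \<phi> i x) \<and>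
       (\<exists>K. \<forall>x. \<bar>\<phi> i x\<bar> \<le> norm x * K)) \<and>
    (\<forall>x. (\<Sum>i<n. \<phi> i x *\<^sub>R b i) = x)"
    by (intro fin_dimI[of "{..<n} \<times> {..<m}" ?F ?B] bl) auto
qed

instance euclidean_space \<subseteq> fin_dim
  by standard
    (rule fin_dimI[of Basis "\<lambda>b x. x \<bullet> b" "\<lambda>b. b"], auto simp: euclidean_representation bounded_linear_inner_left)

lemma ex_frame:
  obtains n :: nat and \<phi> :: "nat \<Rightarrow> 'a::fin_dim \<Rightarrow> real" and b where
    "\<And>i. i < n \<Longrightarrow> bounded_linear (\<phi> i)" "\<And>x. (\<Sum>i<n. \<phi> i x *\<^sub>R b i) = x"
  using ex_frame_nat by blast

lemma linear_imp_bounded_linear: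
  fixes f :: "'a::fin_dim \<Rightarrow> 'b::real_normed_vector"
  assumes "linear f"
  shows "bounded_linear f"
proof -
  obtain n :: nat and \<phi> :: "nat \<Rightarrow> 'a \<Rightarrow> real" and b where
    frame: "\<And>i. i < n \<Longrightarrow> bounded_linear (\<phi> i)" "\<And>x. (\<Sum>i<n. \<phi> i x *\<^sub>R b i) = x" using ex_frame by blast
  have "f = (\<lambda>x. \<Sum>i<n. \<phi> i x *\<^sub>R f (b i))"
    by (rule ext) (rule linear_frame[OF assms frame(2)])
  moreover have "bounded_linear (\<lambda>x. \<Sum>i<n. \<phi> i x *\<^sub>R f (b i))"
    by (intro bounded_linear_sum bounded_linear_scaleR_const) (auto intro: frame)
  ultimately show ?thesis by (rule ssubst[of f])
qed

section \<open>Derivatives on open sets and functions of class C^k\<close>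

lemma has_derivative_cong_open:
  assumes "open S" "x \<in> S" "\<And>y. y \<in> S \<Longrightarrow> f y = g y"
  shows "(f has_derivative f') (at x) \<longleftrightarrow> (g has_derivative f') (at x)"
  using assms has_derivative_transform_within_open by metis

lemma Dd_cong_open:
  assumes "open S" "x \<in> S" "\<And>y. y \<in> S \<Longrightarrow> f y = g y"
  shows "Dd f x = Dd g x"
  unfolding frechet_derivative_def using has_derivative_cong_open[OF assms, simplified] by simp

lemma Dd_eqI: "(f has_derivative f') (at x) \<Longrightarrow> Dd f x = f'"
  by (rule frechet_derivative_at[symmetric])

lemma has_derivative_Dd: "f differentiable (at x) \<Longrightarrow> (f has_derivative Dd f x) (at x)"
  by (simp add: frechet_derivative_works)

lemma linear_Dd: "f differentiable (at x) \<Longrightarrow> linear (Dd f x)"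
  by (rule linear_frechet_derivative)

lemma differentiable_cong_open:
  assumes "open S" "x \<in> S" "\<And>y. y \<in> S \<Longrightarrow> f y = g y"
  shows "f differentiable (at x) \<longleftrightarrow> g differentiable (at x)"
  unfolding differentiable_def using has_derivative_cong_open[OF assms, simplified] by simp

lemma D2_cong_open:
  assumes "open S" "x \<in> S" "\<And>y. y \<in> S \<Longrightarrow> f y = g y"
  shows "D2 f x = D2 g x"
proof (intro ext)
  fix u v
  show "D2 f x u v = D2 g x u v"
    unfolding D2_def
    by (subst Dd_cong_open[OF assms(1,2), of _ "\<lambda>y. Dd g y v"]) (simp_all add: Dd_cong_open[OF assms(1) _ assms(3)])
qed

lemma Ck_on_cong:
  assumes "open S" "\<And>y. y \<in> S \<Longrightarrow> f y = g y" "Ck_on k f S"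
  shows "Ck_on k g S"
  using assms(2,3)
proof (induction k arbitrary: f g)
  case 0
  then show ?case using continuous_on_cong[of S S f g] by simp
next
  case (Suc k)
  have "g differentiable (at x)" if "x \<in> S" for x
    using Suc.prems differentiable_cong_open[OF assms(1) that, of f g] that by auto
  moreover have "Ck_on k (\<lambda>x. Dd g x v) S" for v
  proof (rule Suc.IH[of "\<lambda>x. Dd f x v"])
    show "Dd f x v = Dd g x v" if "x \<in> S" for x
      using Dd_cong_open[OF assms(1) that Suc.prems(1)] by simp
    show "Ck_on k (\<lambda>x. Dd f x v) S" using Suc.prems(2) by simp
  qed
  ultimately show ?case by simp
qed

lemma Ck_on_mono: "T \<subseteq> S \<Longrightarrow> Ck_on k f S \<Longrightarrow> Ck_on k f T"
  by (induction k arbitrary: f) (auto intro: continuous_on_subset)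

lemma Ck_on_Suc_imp: "Ck_on (Suc k) f S \<Longrightarrow> Ck_on k f S"
proof (induction k arbitrary: f)
  case 0
  then show ?case
    by (simp add: continuous_at_imp_continuous_on differentiable_imp_continuous_within)
next
  case (Suc k)
  then show ?case by auto
qed

lemma Ck_on_local:
  assumes "\<And>x. x \<in> S \<Longrightarrow> \<exists>U. open U \<and> x \<in> U \<and> Ck_on k f U"
  shows "Ck_on k f S"
  using assms
proof (induction k arbitrary: f)
  case 0
  then show ?case
    by (auto intro!: continuous_at_imp_continuous_on) (metis continuous_on_eq_continuous_at)
next
  case (Suc k)
  have "f differentiable (at x)" if "x \<in> S" for x using Suc.prems that by fastforce
  moreover have "Ck_on k (\<lambda>x. Dd f x v) S" for v
    by (rule Suc.IH) (use Suc.prems in fastforce)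
  ultimately show ?case by simp
qed

lemma Ck_on_const: "Ck_on k (\<lambda>x. c) S"
  by (induction k arbitrary: c) (auto simp: frechet_derivative_const)

lemma Ck_on_linear_image:
  assumes "bounded_linear h" "open S" "Ck_on k f S"
  shows "Ck_on k (\<lambda>x. h (f x)) S"
  using assms(3)
proof (induction k arbitrary: f)
  case 0
  then show ?case by (auto intro: bounded_linear.continuous_on[OF assms(1)])
next
  case (Suc k)
  have D: "((\<lambda>x. h (f x)) has_derivative (\<lambda>v. h (Dd f x v))) (at x)" if "x \<in> S" for x
    using Suc.prems that by (intro bounded_linear.has_derivative[OF assms(1)] has_derivative_Dd) auto
  have "Ck_on k (\<lambda>x. Dd (\<lambda>x. h (f x)) x v) S" for v
    using Suc.prems Suc.IH[of "\<lambda>x. Dd f x v"]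
    by - (rule Ck_on_cong[OF assms(2), of "\<lambda>x. h (Dd f x v)"], auto simp: Dd_eqI[OF D])
  then show ?case using D by (auto simp: differentiable_def)
qed

lemma Ck_on_ident: "Ck_on k (\<lambda>x. x) S"
  by (cases k) (auto simp: frechet_derivative_ident Ck_on_const)

lemma Ck_on_add:
  assumes "open S" "Ck_on k f S" "Ck_on k g S"
  shows "Ck_on k (\<lambda>x. f x + g x) S"
  using assms(2,3)
proof (induction k arbitrary: f g)
  case 0
  then show ?case by (auto intro: continuous_on_add)
next
  case (Suc k)
  have D: "((\<lambda>x. f x + g x) has_derivative (\<lambda>v. Dd f x v + Dd g x v)) (at x)" if "x \<in> S" for x
    using Suc.prems that by (intro has_derivative_add has_derivative_Dd) auto
  have "Ck_on k (\<lambda>x. Dd (\<lambda>x. f x + g x) x v) S" for v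
    using Suc.prems Suc.IH[of "\<lambda>x. Dd f x v" "\<lambda>x. Dd g x v"]
    by - (rule Ck_on_cong[OF assms(1), of "\<lambda>x. Dd f x v + Dd g x v"], auto simp: Dd_eqI[OF D])
  then show ?case using D by (auto simp: differentiable_def)
qed

lemma Ck_on_bilinear:
  assumes "bounded_bilinear h" "open S" "Ck_on k f S" "Ck_on k g S"
  shows "Ck_on k (\<lambda>x. h (f x) (g x)) S"
  using assms(3,4)
proof (induction k arbitrary: f g)
  case 0
  then show ?case by (auto intro: bounded_bilinear.continuous_on[OF assms(1)])
next
  case (Suc k)
  have D: "((\<lambda>x. h (f x) (g x)) has_derivative (\<lambda>v. h (f x) (Dd g x v) + h (Dd f x v) (g x))) (at x)" if "x \<in> S" for x
    using Suc.prems that by (intro bounded_bilinear.FDERIV[OF assms(1)] has_derivative_Dd) auto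
  have "Ck_on k (\<lambda>x. Dd (\<lambda>x. h (f x) (g x)) x v) S" for v
  proof -
    have "Ck_on k f S" "Ck_on k g S" using Suc.prems Ck_on_Suc_imp by auto
    then have "Ck_on k (\<lambda>x. h (f x) (Dd g x v) + h (Dd f x v) (g x)) S"
      using Suc.prems by - (rule Ck_on_add[OF assms(2)]; rule Suc.IH; simp)
    then show ?thesis
      by (rule Ck_on_cong[OF assms(2), rotated]) (auto simp: Dd_eqI[OF D])
  qed
  then show ?case using D by (auto simp: differentiable_def)
qed

lemma Ck_on_sum:
  assumes "open S" "\<And>i. i \<in> I \<Longrightarrow> Ck_on k (f i) S"
  shows "Ck_on k (\<lambda>x. \<Sum>i\<in>I. f i x) S"
proof (cases "finite I")
  case True
  then show ?thesis using assms(2)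
    by (induction I) (auto intro: Ck_on_const Ck_on_add[OF assms(1)])
qed (simp add: Ck_on_const)

text \<open>The derivative of the composite is \<open>Dd g (f x)\<close> applied to the moving
  vector \<open>Dd f x v\<close>, while \<open>Ck_on\<close> speaks of fixed directions. Expanding
  the moving vector in a frame of the middle space leaves products of functions that the induction
  covers; this is where finite dimension enters.\<close>

lemma Ck_on_compose:
  fixes g :: "'b::fin_dim \<Rightarrow> 'c::real_normed_vector"
  assumes "open S" "open T" "f ` S \<subseteq> T" "Ck_on k f S" "Ck_on k g T"
  shows "Ck_on k (\<lambda>x. g (f x)) S"
  using assms(4,5)
proof (induction k arbitrary: g)
  case 0
  then show ?case
    using continuous_on_compose2[of T g S f] assms(3) by simp
next
  case (Suc k)
  obtain n :: nat and \<phi> :: "nat \<Rightarrow> 'b \<Rightarrow> real" and b where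
    frame: "\<And>i. i < n \<Longrightarrow> bounded_linear (\<phi> i)" "\<And>x. (\<Sum>i<n. \<phi> i x *\<^sub>R b i) = x" using ex_frame by blast
  have fS: "f x \<in> T" if "x \<in> S" for x using that assms(3) by auto
  have D: "((\<lambda>x. g (f x)) has_derivative (\<lambda>v. Dd g (f x) (Dd f x v))) (at x)" if "x \<in> S" for x
    using Suc.prems that fS[OF that]
    by (intro has_derivative_compose[of f _ _ _ g] has_derivative_Dd) auto
  have E: "Dd g (f x) (Dd f x v) = (\<Sum>i<n. \<phi> i (Dd f x v) *\<^sub>R Dd g (f x) (b i))" if "x \<in> S" for x v
  proof -
    have l: "linear (Dd g (f x))" using Suc.prems that fS[OF that] by (intro linear_Dd) auto
    show ?thesis by (rule linear_frame[OF l frame(2)])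
  qed
  have "Ck_on k (\<lambda>x. Dd (\<lambda>x. g (f x)) x v) S" for v
  proof (rule Ck_on_cong[OF assms(1)])
    show "(\<Sum>i<n. \<phi> i (Dd f x v) *\<^sub>R Dd g (f x) (b i)) = Dd (\<lambda>x. g (f x)) x v" if "x \<in> S" for x
      using E[OF that] Dd_eqI[OF D[OF that]] by simp
    show "Ck_on k (\<lambda>x. \<Sum>i<n. \<phi> i (Dd f x v) *\<^sub>R Dd g (f x) (b i)) S"
    proof (rule Ck_on_sum[OF assms(1)], rule Ck_on_bilinear[OF bounded_bilinear_scaleR assms(1)])
      fix i assume i: "i \<in> {..<n}"
      show "Ck_on k (\<lambda>x. \<phi> i (Dd f x v)) S"
        by (rule Ck_on_linear_image[OF frame(1) assms(1)]) (use i Suc.prems in auto)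
      show "Ck_on k (\<lambda>x. Dd g (f x) (b i)) S"
        by (rule Suc.IH[OF Ck_on_Suc_imp[OF Suc.prems(1)]]) (use Suc.prems in auto)
    qed
  qed
  then show ?case using D by (auto simp: differentiable_def)
qed

lemma smooth_on_cong:
  "open S \<Longrightarrow> (\<And>y. y \<in> S \<Longrightarrow> f y = g y) \<Longrightarrow> smooth_on f S \<Longrightarrow> smooth_on g S"
  unfolding smooth_on_def using Ck_on_cong by blast

lemma smooth_on_mono: "smooth_on f S \<Longrightarrow> T \<subseteq> S \<Longrightarrow> smooth_on f T"
  unfolding smooth_on_def using Ck_on_mono by blast

lemma smooth_on_local:
  assumes "\<And>x. x \<in> S \<Longrightarrow> \<exists>U. open U \<and> x \<in> U \<and> smooth_on f U"
  shows "smooth_on f S"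
  unfolding smooth_on_def by (intro allI Ck_on_local) (use assms smooth_on_def in blast)

lemma smooth_on_const: "smooth_on (\<lambda>x. c) S"
  by (simp add: smooth_on_def Ck_on_const)

lemma smooth_on_ident: "smooth_on (\<lambda>x. x) S"
  by (simp add: smooth_on_def Ck_on_ident)

lemma smooth_on_linear_image: "bounded_linear h \<Longrightarrow> open S \<Longrightarrow> smooth_on f S \<Longrightarrow> smooth_on (\<lambda>x. h (f x)) S"
  by (simp add: smooth_on_def Ck_on_linear_image)

lemma smooth_on_add: "open S \<Longrightarrow> smooth_on f S \<Longrightarrow> smooth_on g S \<Longrightarrow> smooth_on (\<lambda>x. f x + g x) S"
  by (simp add: smooth_on_def Ck_on_add)

lemma smooth_on_minus: "open S \<Longrightarrow> smooth_on f S \<Longrightarrow> smooth_on (\<lambda>x. - f x) S"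
  by (rule smooth_on_linear_image) (auto intro: bounded_linear_minus bounded_linear_ident)

lemma smooth_on_diff: "open S \<Longrightarrow> smooth_on f S \<Longrightarrow> smooth_on g S \<Longrightarrow> smooth_on (\<lambda>x. f x - g x) S"
  using smooth_on_add[of S f "\<lambda>x. - g x"] smooth_on_minus[of S g] by simp

lemma smooth_on_sum:
  "open S \<Longrightarrow> (\<And>i. i \<in> I \<Longrightarrow> smooth_on (f i) S) \<Longrightarrow> smooth_on (\<lambda>x. \<Sum>i\<in>I. f i x) S"
  by (simp add: smooth_on_def Ck_on_sum)

lemma smooth_on_bilinear:
  "bounded_bilinear h \<Longrightarrow> open S \<Longrightarrow> smooth_on f S \<Longrightarrow> smooth_on g S \<Longrightarrow> smooth_on (\<lambda>x. h (f x) (g x)) S"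
  by (simp add: smooth_on_def Ck_on_bilinear)

lemma smooth_on_compose:
  fixes g :: "'b::fin_dim \<Rightarrow> 'c::real_normed_vector"
  shows "open S \<Longrightarrow> open T \<Longrightarrow> smooth_on g T \<Longrightarrow> smooth_on f S \<Longrightarrow> f ` S \<subseteq> T \<Longrightarrow> smooth_on (\<lambda>x. g (f x)) S"
  by (simp add: smooth_on_def Ck_on_compose)

lemma smooth_on_Pair:
  assumes "open S" "smooth_on f S" "smooth_on g S"
  shows "smooth_on (\<lambda>x. (f x, g x)) S"
proof -
  have 1: "bounded_linear (\<lambda>y. (y, 0))" by (intro bounded_linear_Pair bounded_linear_ident bounded_linear_zero)
  have 2: "bounded_linear (\<lambda>y. (0, y))" by (intro bounded_linear_Pair bounded_linear_ident bounded_linear_zero)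
  have "smooth_on (\<lambda>x. (f x, 0) + (0, g x)) S"
    using smooth_on_add[OF assms(1) smooth_on_linear_image[OF 1 assms(1,2)] smooth_on_linear_image[OF 2 assms(1,3)]] .
  then show ?thesis by simp
qed

lemma smooth_on_fst: "open S \<Longrightarrow> smooth_on f S \<Longrightarrow> smooth_on (\<lambda>x. fst (f x)) S"
  by (rule smooth_on_linear_image[OF bounded_linear_fst])

lemma smooth_on_snd: "open S \<Longrightarrow> smooth_on f S \<Longrightarrow> smooth_on (\<lambda>x. snd (f x)) S"
  by (rule smooth_on_linear_image[OF bounded_linear_snd])

lemma smooth_on_Dd: "smooth_on f S \<Longrightarrow> smooth_on (\<lambda>x. Dd f x v) S"
  unfolding smooth_on_def by (metis Ck_on.simps(2))

lemma smooth_on_differentiable: "smooth_on f S \<Longrightarrow> x \<in> S \<Longrightarrow> f differentiable (at x)"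
  unfolding smooth_on_def by (metis Ck_on.simps(2))

lemma smooth_on_has_derivative: "smooth_on f S \<Longrightarrow> x \<in> S \<Longrightarrow> (f has_derivative Dd f x) (at x)"
  by (simp add: has_derivative_Dd smooth_on_differentiable)

lemma smooth_on_linear_Dd: "smooth_on f S \<Longrightarrow> x \<in> S \<Longrightarrow> linear (Dd f x)"
  by (simp add: linear_Dd smooth_on_differentiable)

lemma smooth_on_continuous_on: "smooth_on f S \<Longrightarrow> continuous_on S f"
  unfolding smooth_on_def by (metis Ck_on.simps(1))

text \<open>Tensor components are assumed smooth only for fixed arguments. This passes to moving
  arguments, one slot at a time, again by a frame expansion.\<close>

lemma smooth_on_apply:
  fixes L :: "'a::real_normed_vector \<Rightarrow> 'b::fin_dim \<Rightarrow> 'c::real_normed_vector"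
  assumes "open S" "\<And>v. smooth_on (\<lambda>x. L x v) S" "\<And>x. x \<in> S \<Longrightarrow> linear (L x)" "smooth_on s S"
  shows "smooth_on (\<lambda>x. L x (s x)) S"
proof -
  obtain n :: nat and \<phi> :: "nat \<Rightarrow> 'b \<Rightarrow> real" and b where
    frame: "\<And>i. i < n \<Longrightarrow> bounded_linear (\<phi> i)" "\<And>x. (\<Sum>i<n. \<phi> i x *\<^sub>R b i) = x" using ex_frame by blast
  have "smooth_on (\<lambda>x. \<Sum>i<n. \<phi> i (s x) *\<^sub>R L x (b i)) S"
    by (rule smooth_on_sum[OF assms(1)], rule smooth_on_bilinear[OF bounded_bilinear_scaleR assms(1)],
        rule smooth_on_linear_image[OF frame(1) assms(1,4)], simp, rule assms(2))
  moreover have "(\<Sum>i<n. \<phi> i (s x) *\<^sub>R L x (b i)) = L x (s x)" if "x \<in> S" for x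
    by (rule linear_frame[OF assms(3)[OF that] frame(2), symmetric])
  ultimately show ?thesis by (rule smooth_on_cong[OF assms(1), rotated])
qed

text \<open>In finite dimension a family of functionals that is smooth on each vector is smooth as a
  map into the dual space, because it is a combination of fixed functionals with smooth
  coefficients.\<close>

lemma smooth_on_Blinfun:
  fixes P :: "'a::real_normed_vector \<Rightarrow> 'b::fin_dim \<Rightarrow> real"
  assumes "open S" "\<And>v. smooth_on (\<lambda>x. P x v) S" "\<And>x. x \<in> S \<Longrightarrow> linear (P x)"
  shows "smooth_on (\<lambda>x. Blinfun (P x)) S"
proof -
  obtain n :: nat and \<phi> :: "nat \<Rightarrow> 'b \<Rightarrow> real" and b where
    frame: "\<And>i. i < n \<Longrightarrow> bounded_linear (\<phi> i)" "\<And>x. (\<Sum>i<n. \<phi> i x *\<^sub>R b i) = x" using ex_frame by blast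
  have "smooth_on (\<lambda>x. \<Sum>i<n. P x (b i) *\<^sub>R Blinfun (\<phi> i)) S"
    by (rule smooth_on_sum[OF assms(1)], rule smooth_on_bilinear[OF bounded_bilinear_scaleR assms(1)],
        rule assms(2), rule smooth_on_const)
  moreover have "(\<Sum>i<n. P x (b i) *\<^sub>R Blinfun (\<phi> i)) = Blinfun (P x)" if "x \<in> S" for x
  proof (rule blinfun_eqI)
    fix v
    have l: "linear (P x)" using assms(3)[OF that] .
    have "blinfun_apply (Blinfun (P x)) v = P x v"
      by (simp add: bounded_linear_Blinfun_apply linear_imp_bounded_linear[OF l])
    also have "\<dots> = (\<Sum>i<n. \<phi> i v *\<^sub>R P x (b i))" by (rule linear_frame[OF l frame(2)])
    also have "\<dots> = blinfun_apply (\<Sum>i<n. P x (b i) *\<^sub>R Blinfun (\<phi> i)) v"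
      unfolding blinfun.sum_left
      by (intro sum.cong refl) (simp add: blinfun.scaleR_left bounded_linear_Blinfun_apply frame(1))
    finally show "blinfun_apply (\<Sum>i<n. P x (b i) *\<^sub>R Blinfun (\<phi> i)) v = blinfun_apply (Blinfun (P x)) v" ..
  qed
  ultimately show ?thesis by (rule smooth_on_cong[OF assms(1), rotated])
qed

text \<open>The product rule for evaluation, for a family \<open>L\<close> that is differentiable
  only on each fixed vector.\<close>

lemma has_derivative_apply:
  fixes L :: "'a::real_normed_vector \<Rightarrow> 'b::fin_dim \<Rightarrow> 'c::real_normed_vector"
  assumes "open S" "x \<in> S" "\<And>v. (\<lambda>y. L y v) differentiable (at x)" "\<And>y. y \<in> S \<Longrightarrow> linear (L y)"
    and "(s has_derivative s') (at x)"
  shows "((\<lambda>y. L y (s y)) has_derivative (\<lambda>r. Dd (\<lambda>y. L y (s x)) x r + L x (s' r))) (at x)"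
proof -
  obtain n :: nat and \<phi> :: "nat \<Rightarrow> 'b \<Rightarrow> real" and b where
    frame: "\<And>i. i < n \<Longrightarrow> bounded_linear (\<phi> i)" "\<And>x. (\<Sum>i<n. \<phi> i x *\<^sub>R b i) = x" using ex_frame by blast
  have e: "L y t = (\<Sum>i<n. \<phi> i t *\<^sub>R L y (b i))" if "y \<in> S" for y t
    by (rule linear_frame[OF assms(4)[OF that] frame(2)])
  have d: "((\<lambda>y. \<Sum>i<n. \<phi> i (f y) *\<^sub>R L y (b i)) has_derivative
      (\<lambda>r. \<Sum>i<n. \<phi> i (f x) *\<^sub>R Dd (\<lambda>y. L y (b i)) x r + \<phi> i (f' r) *\<^sub>R L x (b i))) (at x)"
    if "(f has_derivative f') (at x)" for f f'
    by (intro has_derivative_sum bounded_bilinear.FDERIV[OF bounded_bilinear_scaleR]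
        bounded_linear.has_derivative[OF _ that] frame(1) has_derivative_Dd assms(3)) auto
  have c: "((\<lambda>y. L y (f y)) has_derivative
      (\<lambda>r. \<Sum>i<n. \<phi> i (f x) *\<^sub>R Dd (\<lambda>y. L y (b i)) x r + \<phi> i (f' r) *\<^sub>R L x (b i))) (at x)"
    if "(f has_derivative f') (at x)" for f f'
    using d[OF that] has_derivative_cong_open[OF assms(1,2), OF e[of _ "f _"]] by simp
  have z: "\<phi> i 0 = 0" if "i < n" for i using frame(1)[OF that] by (simp add: linear_0 bounded_linear.linear)
  have "Dd (\<lambda>y. L y (s x)) x = (\<lambda>r. \<Sum>i<n. \<phi> i (s x) *\<^sub>R Dd (\<lambda>y. L y (b i)) x r + \<phi> i 0 *\<^sub>R L x (b i))"
    by (rule Dd_eqI) (rule c[OF has_derivative_const])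
  then have "Dd (\<lambda>y. L y (s x)) x r = (\<Sum>i<n. \<phi> i (s x) *\<^sub>R Dd (\<lambda>y. L y (b i)) x r)" for r
    by (simp add: z)
  moreover have "L x (s' r) = (\<Sum>i<n. \<phi> i (s' r) *\<^sub>R L x (b i))" for r using e[OF assms(2)] .
  ultimately show ?thesis using c[OF assms(5)] by (simp add: sum.distrib)
qed

text \<open>The last summand is what makes Christoffel symbols transform inhomogeneously; every
  later comparison of connections rests on this formula.\<close>

lemma D2_compose:
  fixes g :: "'b::fin_dim \<Rightarrow> 'c::real_normed_vector"
  assumes "open S" "open T" "smooth_on g T" "smooth_on f S" "f ` S \<subseteq> T" "x \<in> S"
  shows "D2 (\<lambda>x. g (f x)) x u v = D2 g (f x) (Dd f x u) (Dd f x v) + Dd g (f x) (D2 f x u v)"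
proof -
  have fT: "f y \<in> T" if "y \<in> S" for y using that assms(5) by auto
  \<comment> \<open>The chain rule is needed for two outer functions: \<open>g\<close> itself, and
    the directional derivative of \<open>g\<close> along a frozen vector.\<close>
  have ch: "Dd (\<lambda>x. h (f x)) y v = Dd h (f y) (Dd f y v)" if "y \<in> S" "smooth_on h T" for y v and h :: "'b \<Rightarrow> 'c"
  proof -
    have "((\<lambda>x. h (f x)) has_derivative (\<lambda>v. Dd h (f y) (Dd f y v))) (at y)"
      by (rule has_derivative_compose[OF smooth_on_has_derivative[OF assms(4) that(1)]
          smooth_on_has_derivative[OF that(2) fT[OF that(1)]]])
    then show ?thesis by (simp add: Dd_eqI)
  qed
  have sm: "smooth_on (\<lambda>y. Dd g (f y) w) S" for w
    by (rule smooth_on_compose[OF assms(1,2) smooth_on_Dd[OF assms(3)] assms(4,5)])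
  have "((\<lambda>y. Dd g (f y) (Dd f y v)) has_derivative
      (\<lambda>r. Dd (\<lambda>y. Dd g (f y) (Dd f x v)) x r + Dd g (f x) (Dd (\<lambda>y. Dd f y v) x r))) (at x)"
    using smooth_on_linear_Dd[OF assms(3) fT] smooth_on_differentiable[OF sm assms(6)]
    by (intro has_derivative_apply[OF assms(1,6)] smooth_on_has_derivative[OF smooth_on_Dd[OF assms(4)] assms(6)])
  then have 1: "Dd (\<lambda>y. Dd g (f y) (Dd f y v)) x u =
      Dd (\<lambda>y. Dd g (f y) (Dd f x v)) x u + Dd g (f x) (D2 f x u v)"
    by (simp add: Dd_eqI D2_def)
  have "D2 (\<lambda>x. g (f x)) x u v = Dd (\<lambda>y. Dd g (f y) (Dd f y v)) x u"
    unfolding D2_def by (subst Dd_cong_open[OF assms(1,6) ch[OF _ assms(3)]]) auto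
  also have "\<dots> = Dd (\<lambda>y. Dd g (f y) (Dd f x v)) x u + Dd g (f x) (D2 f x u v)" by (fact 1)
  also have "Dd (\<lambda>y. Dd g (f y) (Dd f x v)) x u = D2 g (f x) (Dd f x u) (Dd f x v)"
    unfolding D2_def using ch[OF assms(6) smooth_on_Dd[OF assms(3)]] .
  finally show ?thesis .
qed

lemma Dd_compose:
  assumes "f differentiable (at x)" "g differentiable (at (f x))"
  shows "Dd (\<lambda>x. g (f x)) x v = Dd g (f x) (Dd f x v)"
  using has_derivative_compose[OF has_derivative_Dd[OF assms(1)] has_derivative_Dd[OF assms(2)]]
  by (simp add: Dd_eqI)

section \<open>Symmetry of second derivatives and naturality of tensor equations\<close>

text \<open>Two applications of the mean value theorem, first along \<open>u\<close> to the
  difference across \<open>v\<close>, then along \<open>v\<close> to the resulting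
  derivative.\<close>

lemma second_difference_mvt:
  fixes f :: "'a::real_normed_vector \<Rightarrow> real"
  assumes f: "smooth_on f S" and s: "0 < s"
    and inS: "\<And>a b. 0 \<le> a \<Longrightarrow> a \<le> s \<Longrightarrow> 0 \<le> b \<Longrightarrow> b \<le> s \<Longrightarrow> x + a *\<^sub>R u + b *\<^sub>R v \<in> S"
  obtains a b where "0 \<le> a" "a \<le> s" "0 \<le> b" "b \<le> s"
    "f (x + s *\<^sub>R u + s *\<^sub>R v) - f (x + s *\<^sub>R u) - (f (x + s *\<^sub>R v) - f x) =
      s * (s * D2 f (x + a *\<^sub>R u + b *\<^sub>R v) v u)"
proof -
  have du: "((\<lambda>a. h (x + a *\<^sub>R u + b *\<^sub>R v)) has_real_derivative Dd h (x + a *\<^sub>R u + b *\<^sub>R v) u) (at a)"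
    if "0 \<le> a" "a \<le> s" "0 \<le> b" "b \<le> s" "smooth_on h S" for h :: "'a \<Rightarrow> real" and a b
  proof -
    have "((\<lambda>a. x + a *\<^sub>R u + b *\<^sub>R v) has_derivative (\<lambda>r. r *\<^sub>R u)) (at a)"
      by (auto intro!: derivative_eq_intros)
    from has_derivative_compose[OF this smooth_on_has_derivative[OF that(5) inS]]
    show ?thesis using that linear_scale[OF smooth_on_linear_Dd[OF that(5) inS]]
      by (simp add: has_field_derivative_def mult_commute_abs)
  qed
  have dv: "((\<lambda>b. h (x + a *\<^sub>R u + b *\<^sub>R v)) has_real_derivative Dd h (x + a *\<^sub>R u + b *\<^sub>R v) v) (at b)"
    if "0 \<le> a" "a \<le> s" "0 \<le> b" "b \<le> s" "smooth_on h S" for h :: "'a \<Rightarrow> real" and a b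
  proof -
    have "((\<lambda>b. x + a *\<^sub>R u + b *\<^sub>R v) has_derivative (\<lambda>r. r *\<^sub>R v)) (at b)"
      by (auto intro!: derivative_eq_intros)
    from has_derivative_compose[OF this smooth_on_has_derivative[OF that(5) inS]]
    show ?thesis using that linear_scale[OF smooth_on_linear_Dd[OF that(5) inS]]
      by (simp add: has_field_derivative_def mult_commute_abs)
  qed
  \<comment> \<open>The zero multiple of \<open>v\<close> is kept so that \<open>du\<close> applies
    to both terms.\<close>
  let ?p = "\<lambda>a. f (x + a *\<^sub>R u + s *\<^sub>R v) - f (x + a *\<^sub>R u + 0 *\<^sub>R v)"
  have "\<exists>a. 0 < a \<and> a < s \<and> ?p s - ?p 0 =
      (s - 0) * (Dd f (x + a *\<^sub>R u + s *\<^sub>R v) u - Dd f (x + a *\<^sub>R u + 0 *\<^sub>R v) u)"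
    by (rule MVT2[OF s]) (use s f du in \<open>auto intro!: DERIV_diff simp del: scaleR_zero_left\<close>)
  then obtain a where a: "0 < a" "a < s" and 1: "?p s - ?p 0 =
      s * (Dd f (x + a *\<^sub>R u + s *\<^sub>R v) u - Dd f (x + a *\<^sub>R u + 0 *\<^sub>R v) u)" by auto
  let ?q = "\<lambda>b. Dd f (x + a *\<^sub>R u + b *\<^sub>R v) u"
  have "\<exists>b. 0 < b \<and> b < s \<and> ?q s - ?q 0 = (s - 0) * Dd (\<lambda>y. Dd f y u) (x + a *\<^sub>R u + b *\<^sub>R v) v"
    by (rule MVT2[OF s]) (use a dv[OF _ _ _ _ smooth_on_Dd[OF f]] in auto)
  then obtain b where b: "0 < b" "b < s" and 2: "?q s - ?q 0 = s * D2 f (x + a *\<^sub>R u + b *\<^sub>R v) v u"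
    by (auto simp: D2_def)
  show ?thesis
    by (rule that[of a b]) (use a b 1 2 in auto)
qed

text \<open>The second difference over a small parallelogram is symmetric in \<open>u\<close> and
  \<open>v\<close>, so the two mixed derivatives agree at two nearby points. Continuity then
  excludes a gap at \<open>x\<close>.\<close>

lemma D2_commute_real:
  fixes f :: "'a::real_normed_vector \<Rightarrow> real"
  assumes S: "open S" "x \<in> S" and f: "smooth_on f S"
  shows "D2 f x u v = D2 f x v u"
proof (rule ccontr)
  assume ne: "D2 f x u v \<noteq> D2 f x v u"
  \<comment> \<open>Half of the supposed gap: two errors strictly below \<open>e\<close> cannot
    bridge it.\<close>
  define e where "e = \<bar>D2 f x u v - D2 f x v u\<bar> / 2"
  have e: "e > 0" using ne by (simp add: e_def)
  have cont: "\<exists>d>0. \<forall>y\<in>ball x d. \<bar>D2 f y p q - D2 f x p q\<bar> < e" for p q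
  proof -
    have "continuous_on S (\<lambda>y. D2 f y p q)"
      unfolding D2_def by (intro smooth_on_continuous_on smooth_on_Dd f)
    then have "isCont (\<lambda>y. D2 f y p q) x" using S continuous_on_eq_continuous_at by blast
    then have "\<exists>d>0. \<forall>y. dist y x < d \<longrightarrow> dist (D2 f y p q) (D2 f x p q) < e"
      using e unfolding continuous_at_eps_delta by blast
    then show ?thesis by (auto simp: dist_real_def dist_commute)
  qed
  obtain d1 where d1: "d1 > 0" "\<forall>y\<in>ball x d1. \<bar>D2 f y u v - D2 f x u v\<bar> < e" using cont by blast
  obtain d2 where d2: "d2 > 0" "\<forall>y\<in>ball x d2. \<bar>D2 f y v u - D2 f x v u\<bar> < e" using cont by blast
  obtain r where r: "r > 0" "ball x r \<subseteq> S" using S openE by blast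
  define d where "d = min r (min d1 d2)"
  \<comment> \<open>The scale keeps the whole parallelogram within distance \<open>d\<close> of
    \<open>x\<close>. The summand 1 covers the case that both vectors vanish.\<close>
  define s where "s = d / (norm u + norm v + 1)"
  have d: "d > 0" using r d1 d2 by (simp add: d_def)
  have s: "s > 0" unfolding s_def using d by (intro divide_pos_pos) (auto simp: add_nonneg_pos)
  \<comment> \<open>Stated for \<open>p\<close> and \<open>q\<close> with the same sum of norms, so
    that it serves for both orders of \<open>u\<close> and \<open>v\<close>.\<close>
  have near: "x + a *\<^sub>R p + b *\<^sub>R q \<in> ball x d"
    if "0 \<le> a" "a \<le> s" "0 \<le> b" "b \<le> s" "norm p + norm q = norm u + norm v" for a b p q
  proof -
    have "norm (a *\<^sub>R p + b *\<^sub>R q) \<le> a * norm p + b * norm q"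
      using norm_triangle_ineq[of "a *\<^sub>R p" "b *\<^sub>R q"] that by simp
    also have "\<dots> \<le> s * norm p + s * norm q" using that by (intro add_mono mult_right_mono) auto
    also have "\<dots> = s * (norm u + norm v)" using that by (simp flip: distrib_left)
    also have "\<dots> < s * (norm u + norm v + 1)" using s by simp
    also have "\<dots> = d" unfolding s_def by (simp add: add_nonneg_eq_0_iff)
    finally show ?thesis by (metis add.assoc add_diff_cancel_left' dist_commute dist_norm mem_ball)
  qed
  have sub: "ball x d \<subseteq> S" using r by (auto simp: d_def)
  obtain a b where ab: "0 \<le> a" "a \<le> s" "0 \<le> b" "b \<le> s"
    "f (x + s *\<^sub>R u + s *\<^sub>R v) - f (x + s *\<^sub>R u) - (f (x + s *\<^sub>R v) - f x) =
      s * (s * D2 f (x + a *\<^sub>R u + b *\<^sub>R v) v u)"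
    using second_difference_mvt[OF f s, of x u v] near sub by (metis subsetD)
  obtain a' b' where ab': "0 \<le> a'" "a' \<le> s" "0 \<le> b'" "b' \<le> s"
    "f (x + s *\<^sub>R v + s *\<^sub>R u) - f (x + s *\<^sub>R v) - (f (x + s *\<^sub>R u) - f x) =
      s * (s * D2 f (x + a' *\<^sub>R v + b' *\<^sub>R u) u v)"
    using second_difference_mvt[OF f s, of x v u] near sub by (metis add.commute subsetD)
  have "s * (s * D2 f (x + a *\<^sub>R u + b *\<^sub>R v) v u) = s * (s * D2 f (x + a' *\<^sub>R v + b' *\<^sub>R u) u v)"
    using ab(5) ab'(5) by (simp add: algebra_simps)
  then have eq: "D2 f (x + a *\<^sub>R u + b *\<^sub>R v) v u = D2 f (x + a' *\<^sub>R v + b' *\<^sub>R u) u v" using s by simp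
  have "\<bar>D2 f (x + a *\<^sub>R u + b *\<^sub>R v) v u - D2 f x v u\<bar> < e"
    using d2(2) near[OF ab(1-4), of u v] by (auto simp: d_def)
  moreover have "\<bar>D2 f (x + a' *\<^sub>R v + b' *\<^sub>R u) u v - D2 f x u v\<bar> < e"
    using d1(2) near[OF ab'(1-4), of v u] by (auto simp: d_def)
  ultimately show False using eq by (auto simp: e_def abs_if split: if_splits)
qed

lemma D2_linear_image:
  assumes "bounded_linear h" "open S" "x \<in> S" "smooth_on f S"
  shows "D2 (\<lambda>x. h (f x)) x u v = h (D2 f x u v)"
proof -
  have D: "Dd (\<lambda>x. h (g x)) y w = h (Dd g y w)" if "y \<in> S" "smooth_on g S" for y w g
    using bounded_linear.has_derivative[OF assms(1) smooth_on_has_derivative[OF that(2,1)]] by (simp add: Dd_eqI)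
  have "D2 (\<lambda>x. h (f x)) x u v = Dd (\<lambda>y. h (Dd f y v)) x u"
    unfolding D2_def by (subst Dd_cong_open[OF assms(2,3) D[OF _ assms(4)]]) auto
  then show ?thesis unfolding D2_def using D[OF assms(3) smooth_on_Dd[OF assms(4)]] by simp
qed

lemma D2_commute:
  fixes f :: "'a::real_normed_vector \<Rightarrow> 'b::fin_dim"
  assumes S: "open S" "x \<in> S" and f: "smooth_on f S"
  shows "D2 f x u v = D2 f x v u"
proof -
  obtain n :: nat and \<phi> :: "nat \<Rightarrow> 'b \<Rightarrow> real" and b where
    frame: "\<And>i. i < n \<Longrightarrow> bounded_linear (\<phi> i)" "\<And>x. (\<Sum>i<n. \<phi> i x *\<^sub>R b i) = x" using ex_frame by blast
  have "\<phi> i (D2 f x u v) = \<phi> i (D2 f x v u)" if "i < n" for i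
    using D2_commute_real[OF S smooth_on_linear_image[OF frame(1)[OF that] S(1) f], of u v]
      D2_linear_image[OF frame(1)[OF that] S f] by simp
  then have "(\<Sum>i<n. \<phi> i (D2 f x u v) *\<^sub>R b i) = (\<Sum>i<n. \<phi> i (D2 f x v u) *\<^sub>R b i)" by simp
  then show ?thesis unfolding frame(2) .
qed

text \<open>The codomain of \<open>A\<close> is arbitrary so that the formula covers endomorphisms,
  differentials of functions, and bilinear forms with one slot filled.\<close>

lemma Dd_pullback_endo:
  fixes \<Phi> :: "'a::real_normed_vector \<Rightarrow> 'b::fin_dim" and A :: "'b \<Rightarrow> 'b \<Rightarrow> 'c::real_normed_vector"
  assumes "open S" "open W" "smooth_on \<Phi> S" "\<Phi> ` S \<subseteq> W" "x \<in> S"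
    and lin: "\<And>y. y \<in> W \<Longrightarrow> linear (A y)" and sm: "\<And>t. smooth_on (\<lambda>y. A y t) W"
  shows "Dd (\<lambda>x. A (\<Phi> x) (Dd \<Phi> x v)) x u =
    Dd (\<lambda>y. A y (Dd \<Phi> x v)) (\<Phi> x) (Dd \<Phi> x u) + A (\<Phi> x) (D2 \<Phi> x u v)"
proof -
  have W: "\<Phi> y \<in> W" if "y \<in> S" for y using assms(4) that by auto
  have ch: "smooth_on (\<lambda>x. A (\<Phi> x) t) S" for t
    by (rule smooth_on_compose[OF assms(1,2) sm assms(3,4)])
  have "((\<lambda>y. A (\<Phi> y) (Dd \<Phi> y v)) has_derivative
      (\<lambda>r. Dd (\<lambda>y. A (\<Phi> y) (Dd \<Phi> x v)) x r + A (\<Phi> x) (Dd (\<lambda>y. Dd \<Phi> y v) x r))) (at x)"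
    by (rule has_derivative_apply[OF assms(1,5) smooth_on_differentiable[OF ch assms(5)] lin[OF W]
        smooth_on_has_derivative[OF smooth_on_Dd[OF assms(3)] assms(5)]])
  moreover have "Dd (\<lambda>y. A (\<Phi> y) t) x u = Dd (\<lambda>y. A y t) (\<Phi> x) (Dd \<Phi> x u)" for t
    by (rule Dd_compose[OF smooth_on_differentiable[OF assms(3,5)] smooth_on_differentiable[OF sm W[OF assms(5)]]])
  ultimately show ?thesis by (simp add: Dd_eqI D2_def)
qed

lemma Dd_pullback_form2:
  fixes \<Phi> :: "'a::real_normed_vector \<Rightarrow> 'b::fin_dim" and T :: "'b \<Rightarrow> 'b \<Rightarrow> 'b \<Rightarrow> real"
  assumes "open S" "open W" "smooth_on \<Phi> S" "\<Phi> ` S \<subseteq> W" "x \<in> S"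
    and bil: "\<And>y. y \<in> W \<Longrightarrow> bilinear (T y)" and sm: "\<And>s t. smooth_on (\<lambda>y. T y s t) W"
  shows "Dd (\<lambda>x. T (\<Phi> x) (Dd \<Phi> x v) (Dd \<Phi> x w)) x u =
    Dd (\<lambda>y. T y (Dd \<Phi> x v) (Dd \<Phi> x w)) (\<Phi> x) (Dd \<Phi> x u)
    + T (\<Phi> x) (D2 \<Phi> x u v) (Dd \<Phi> x w) + T (\<Phi> x) (Dd \<Phi> x v) (D2 \<Phi> x u w)"
proof -
  have W: "\<Phi> y \<in> W" if "y \<in> S" for y using assms(4) that by auto
  have l2: "linear (\<lambda>t. T y s t)" and l1: "linear (\<lambda>s. T y s t)" if "y \<in> W" for y s t
    using bil[OF that] by (auto simp: bilinear_def)
  have ch: "smooth_on (\<lambda>x. T (\<Phi> x) (Dd \<Phi> x v) t) S" for t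
  proof (rule smooth_on_apply[where L = "\<lambda>x s. T (\<Phi> x) s t", OF assms(1) _ l1[OF W] smooth_on_Dd[OF assms(3)]])
    show "smooth_on (\<lambda>x. T (\<Phi> x) s t) S" for s
      by (rule smooth_on_compose[OF assms(1,2) sm assms(3,4)])
  qed
  have "((\<lambda>y. T (\<Phi> y) (Dd \<Phi> y v) (Dd \<Phi> y w)) has_derivative
      (\<lambda>r. Dd (\<lambda>y. T (\<Phi> y) (Dd \<Phi> y v) (Dd \<Phi> x w)) x r
        + T (\<Phi> x) (Dd \<Phi> x v) (Dd (\<lambda>y. Dd \<Phi> y w) x r))) (at x)"
    by (rule has_derivative_apply[OF assms(1,5) smooth_on_differentiable[OF ch assms(5)] l2[OF W]
        smooth_on_has_derivative[OF smooth_on_Dd[OF assms(3)] assms(5)]])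
  moreover have "Dd (\<lambda>y. T (\<Phi> y) (Dd \<Phi> y v) t) x u =
      Dd (\<lambda>y. T y (Dd \<Phi> x v) t) (\<Phi> x) (Dd \<Phi> x u) + T (\<Phi> x) (D2 \<Phi> x u v) t" for t
    by (rule Dd_pullback_endo[OF assms(1-5) l1 sm])
  ultimately show ?thesis by (simp add: Dd_eqI D2_def)
qed

lemma nijenhuis_const:
  assumes "linear (J x)"
  shows "nijenhuis J (\<lambda>_. u) (\<lambda>_. v) x =
    Dd (\<lambda>y. J y v) x (J x u) - Dd (\<lambda>y. J y u) x (J x v)
      + J x (Dd (\<lambda>y. J y u) x v) - J x (Dd (\<lambda>y. J y v) x u)"
  unfolding nijenhuis_def lie_bracket_def
  by (simp add: frechet_derivative_const linear_neg[OF assms])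

text \<open>The second derivatives of the map that appear when the Nijenhuis tensor is transported
  come in pairs with exchanged arguments and opposite signs, so they cancel by symmetry. No inverse
  of the map is involved.\<close>

lemma nijenhuis_natural:
  fixes \<Phi> :: "'a::fin_dim \<Rightarrow> 'b::fin_dim"
  assumes S: "open S" "open W" "smooth_on \<Phi> S" "\<Phi> ` S \<subseteq> W" "x \<in> S"
    and B: "\<And>y. y \<in> W \<Longrightarrow> linear (B y)" "\<And>t. smooth_on (\<lambda>y. B y t) W"
    and A: "\<And>y. y \<in> S \<Longrightarrow> linear (A y)" "\<And>t. smooth_on (\<lambda>y. A y t) S"
    and rel: "\<And>y u. y \<in> S \<Longrightarrow> B (\<Phi> y) (Dd \<Phi> y u) = Dd \<Phi> y (A y u)"
  shows "nijenhuis B (\<lambda>_. Dd \<Phi> x u) (\<lambda>_. Dd \<Phi> x v) (\<Phi> x) = Dd \<Phi> x (nijenhuis A (\<lambda>_. u) (\<lambda>_. v) x)"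
proof -
  have W: "\<Phi> x \<in> W" using S by auto
  \<comment> \<open>Differentiating the intertwining relation in two ways and solving for the
    derivative of \<open>B\<close>.\<close>
  have DB: "Dd (\<lambda>y. B y (Dd \<Phi> x v)) (\<Phi> x) (Dd \<Phi> x u) =
      D2 \<Phi> x u (A x v) + Dd \<Phi> x (Dd (\<lambda>y. A y v) x u) - B (\<Phi> x) (D2 \<Phi> x u v)" for u v
  proof -
    have "Dd (\<lambda>x. B (\<Phi> x) (Dd \<Phi> x v)) x u = Dd (\<lambda>y. Dd \<Phi> y (A y v)) x u"
      by (rule fun_cong[OF Dd_cong_open[OF S(1,5)]]) (rule rel)
    also have "\<dots> = D2 \<Phi> x u (A x v) + Dd \<Phi> x (Dd (\<lambda>y. A y v) x u)"
      using has_derivative_apply[where L = "Dd \<Phi>" and s = "\<lambda>y. A y v", OF S(1,5)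
          smooth_on_differentiable[OF smooth_on_Dd[OF S(3)] S(5)]
          smooth_on_linear_Dd[OF S(3)] smooth_on_has_derivative[OF A(2) S(5)]]
      by (simp add: Dd_eqI D2_def)
    finally show ?thesis using Dd_pullback_endo[OF S B] by (simp add: algebra_simps)
  qed
  have lB: "linear (B (\<Phi> x))" using B W by auto
  have lP: "linear (Dd \<Phi> x)" using smooth_on_linear_Dd[OF S(3,5)] .
  note comm = D2_commute[OF S(1,5,3)]
  have BB: "B (\<Phi> x) (Dd \<Phi> x z) = Dd \<Phi> x (A x z)" for z by (rule rel[OF S(5)])
  show ?thesis
    unfolding nijenhuis_const[where J = B and x = "\<Phi> x", OF lB] nijenhuis_const[where J = A and x = x, OF A(1)[OF S(5)]] BB DB
    by (simp add: linear_add[OF lB] linear_diff[OF lB] linear_add[OF lP] linear_diff[OF lP] BB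
        comm[of v u] comm[of "A x v" "A x u"] comm[of "A x v" u] comm[of v "A x u"])
qed

text \<open>In the cyclic sum the six terms with a second derivative of the map cancel in pairs, by
  the symmetry of second derivatives and the alternation of \<open>T\<close>.\<close>

lemma closed_natural:
  fixes \<Phi> :: "'a::real_normed_vector \<Rightarrow> 'b::fin_dim" and T :: "'b \<Rightarrow> 'b \<Rightarrow> 'b \<Rightarrow> real"
  assumes S: "open S" "open W" "smooth_on \<Phi> S" "\<Phi> ` S \<subseteq> W" "x \<in> S"
    and T: "\<And>y. y \<in> W \<Longrightarrow> bilinear (T y)" "\<And>s t. smooth_on (\<lambda>y. T y s t) W"
    and alt: "\<And>s t. T (\<Phi> x) s t = - T (\<Phi> x) t s"
    and rel: "\<And>y u v. y \<in> S \<Longrightarrow> T (\<Phi> y) (Dd \<Phi> y u) (Dd \<Phi> y v) = R y u v"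
    and closed: "Dd (\<lambda>y. R y v w) x u + Dd (\<lambda>y. R y w u) x v + Dd (\<lambda>y. R y u v) x w = 0"
  shows "Dd (\<lambda>y. T y (Dd \<Phi> x v) (Dd \<Phi> x w)) (\<Phi> x) (Dd \<Phi> x u)
    + Dd (\<lambda>y. T y (Dd \<Phi> x w) (Dd \<Phi> x u)) (\<Phi> x) (Dd \<Phi> x v)
    + Dd (\<lambda>y. T y (Dd \<Phi> x u) (Dd \<Phi> x v)) (\<Phi> x) (Dd \<Phi> x w) = 0"
proof -
  have D: "Dd (\<lambda>y. T y (Dd \<Phi> x v) (Dd \<Phi> x w)) (\<Phi> x) (Dd \<Phi> x u) =
      Dd (\<lambda>y. R y v w) x u - T (\<Phi> x) (D2 \<Phi> x u v) (Dd \<Phi> x w) - T (\<Phi> x) (Dd \<Phi> x v) (D2 \<Phi> x u w)" for u v w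
  proof -
    have "Dd (\<lambda>x. T (\<Phi> x) (Dd \<Phi> x v) (Dd \<Phi> x w)) x u = Dd (\<lambda>y. R y v w) x u"
      by (rule fun_cong[OF Dd_cong_open[OF S(1,5)]]) (rule rel)
    then show ?thesis using Dd_pullback_form2[OF S T] by simp
  qed
  note comm = D2_commute[OF S(1,5,3)]
  show ?thesis unfolding D
    using closed alt[of "D2 \<Phi> x u v" "Dd \<Phi> x w"] alt[of "D2 \<Phi> x v w" "Dd \<Phi> x u"] alt[of "D2 \<Phi> x u w" "Dd \<Phi> x v"]
    by (simp add: comm[of v u] comm[of w u] comm[of w v])
qed

lemma zero_derivative_locally_constant:
  fixes f :: "'a::real_normed_vector \<Rightarrow> 'b::real_normed_vector"
  assumes "open S" "x \<in> S" "\<And>y. y \<in> S \<Longrightarrow> (f has_derivative (\<lambda>_. 0)) (at y)"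
  obtains r where "r > 0" "ball x r \<subseteq> S" "\<And>y. y \<in> ball x r \<Longrightarrow> f y = f x"
proof -
  obtain r where r: "r > 0" "ball x r \<subseteq> S" using assms openE by blast
  have "f y = f x" if "y \<in> ball x r" for y
  proof (rule has_derivative_zero_unique[of "ball x r" f])
    show "(f has_derivative (\<lambda>h. 0)) (at z within ball x r)" if "z \<in> ball x r" for z
      by (rule has_derivative_at_withinI[OF assms(3)]) (use r(2) that in blast)
  qed (use r that in auto)
  then show ?thesis using r that by blast
qed

section \<open>Manifolds given by atlases\<close>

lemma second_countable_euclidean: "second_countable (euclidean :: 'a::second_countable_topology topology)"
proof -
  obtain B :: "'a set set" where B: "countable B" "topological_basis B"
    using ex_countable_basis by blast
  have "\<exists>V\<in>B. x \<in> V \<and> V \<subseteq> U" if "open U" "x \<in> U" for U x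
    using topological_basisE[OF B(2) that] by metis
  then show ?thesis
    unfolding second_countable_def using B(1) topological_basis_open[OF B(2)] by auto
qed

lemma second_countable_prod_topology:
  assumes "second_countable X" "second_countable Y"
  shows "second_countable (prod_topology X Y)"
proof -
  obtain A where A: "countable A" "\<forall>V\<in>A. openin X V"
    "\<forall>U x. openin X U \<and> x \<in> U \<longrightarrow> (\<exists>V\<in>A. x \<in> V \<and> V \<subseteq> U)"
    using assms(1) unfolding second_countable_def by auto
  obtain B where B: "countable B" "\<forall>V\<in>B. openin Y V"
    "\<forall>U x. openin Y U \<and> x \<in> U \<longrightarrow> (\<exists>V\<in>B. x \<in> V \<and> V \<subseteq> U)"
    using assms(2) unfolding second_countable_def by auto
  let ?C = "(\<lambda>(U, V). U \<times> V) ` (A \<times> B)"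
  have "countable ?C" using A B by auto
  moreover have "\<forall>V\<in>?C. openin (prod_topology X Y) V"
    using A B by (auto simp: openin_prod_Times_iff)
  moreover have "\<forall>U z. openin (prod_topology X Y) U \<and> z \<in> U \<longrightarrow> (\<exists>V\<in>?C. z \<in> V \<and> V \<subseteq> U)"
  proof (intro allI impI)
    fix U z assume U: "openin (prod_topology X Y) U \<and> z \<in> U"
    obtain x y where z: "z = (x, y)" by (cases z)
    obtain P Q where PQ: "openin X P" "openin Y Q" "x \<in> P" "y \<in> Q" "P \<times> Q \<subseteq> U"
      using U unfolding z openin_prod_topology_alt by blast
    obtain P' where P': "P' \<in> A" "x \<in> P'" "P' \<subseteq> P" using A(3) PQ(1,3) by blast
    obtain Q' where Q': "Q' \<in> B" "y \<in> Q'" "Q' \<subseteq> Q" using B(3) PQ(2,4) by blast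
    have "P' \<times> Q' \<in> ?C" using P' Q' by blast
    moreover have "z \<in> P' \<times> Q'" "P' \<times> Q' \<subseteq> U" using P' Q' PQ z by blast+
    ultimately show "\<exists>V\<in>?C. z \<in> V \<and> V \<subseteq> U" by blast
  qed
  ultimately show ?thesis unfolding second_countable_def by blast
qed

text \<open>The definition through \<open>topology\<close> can be unfolded once the open sets are
  known to form a topology. Injectivity of the charts makes images commute with
  intersections.\<close>

lemma openin_manifold_topology:
  assumes inj: "\<forall>i\<in>charts M. inj_on (cmap M i) (cdom M i)"
  shows "openin (manifold_topology M) U \<longleftrightarrow>
    U \<subseteq> points M \<and> (\<forall>i\<in>charts M. open (cmap M i ` (U \<inter> cdom M i)))"
proof -
  have "istopology (\<lambda>U. U \<subseteq> points M \<and> (\<forall>i\<in>charts M. open (cmap M i ` (U \<inter> cdom M i))))"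
    unfolding istopology_def
  proof (intro conjI allI impI ballI)
    fix S T i
    assume S: "S \<subseteq> points M \<and> (\<forall>i\<in>charts M. open (cmap M i ` (S \<inter> cdom M i)))"
      and T: "T \<subseteq> points M \<and> (\<forall>i\<in>charts M. open (cmap M i ` (T \<inter> cdom M i)))"
    then show "S \<inter> T \<subseteq> points M" by auto
    assume i: "i \<in> charts M"
    have "cmap M i ` (S \<inter> T \<inter> cdom M i) = cmap M i ` (S \<inter> cdom M i) \<inter> cmap M i ` (T \<inter> cdom M i)"
      using inj i by (subst inj_on_image_Int[of _ "cdom M i", symmetric]) (auto intro: arg_cong[of _ _ "image (cmap M i)"])
    then show "open (cmap M i ` (S \<inter> T \<inter> cdom M i))" using S T i by auto
  next
    fix K i
    assume K: "\<forall>S\<in>K. S \<subseteq> points M \<and> (\<forall>i\<in>charts M. open (cmap M i ` (S \<inter> cdom M i)))"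
    then show "\<Union>K \<subseteq> points M" by auto
    assume i: "i \<in> charts M"
    have "cmap M i ` (\<Union>K \<inter> cdom M i) = (\<Union>S\<in>K. cmap M i ` (S \<inter> cdom M i))" by auto
    then show "open (cmap M i ` (\<Union>K \<inter> cdom M i))" using K i by auto
  qed
  then show ?thesis unfolding manifold_topology_def by (simp add: topology_inverse')
qed

locale smooth_mfd =
  fixes M :: "('i, 'a, 'e::real_normed_vector) atlas"
  assumes smooth: "smooth_manifold M"
begin

abbreviation cimg :: "'i \<Rightarrow> 'e set" where "cimg i \<equiv> cmap M i ` cdom M i"

lemma inj_cmap: "i \<in> charts M \<Longrightarrow> inj_on (cmap M i) (cdom M i)"
  using smooth by (simp add: smooth_manifold_def)

lemma points_eq: "points M = (\<Union>i\<in>charts M. cdom M i)"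
  using smooth by (simp add: smooth_manifold_def)

lemma cdom_points: "i \<in> charts M \<Longrightarrow> p \<in> cdom M i \<Longrightarrow> p \<in> points M"
  using points_eq by auto

lemma obtain_chart: "p \<in> points M \<Longrightarrow> (\<And>i. i \<in> charts M \<Longrightarrow> p \<in> cdom M i \<Longrightarrow> thesis) \<Longrightarrow> thesis"
  using points_eq by auto

lemma cinv_cmap [simp]: "i \<in> charts M \<Longrightarrow> p \<in> cdom M i \<Longrightarrow> cinv M i (cmap M i p) = p"
  by (simp add: cinv_def inj_cmap)

lemma cmap_cinv [simp]: "x \<in> cimg i \<Longrightarrow> cmap M i (cinv M i x) = x"
  unfolding cinv_def by (rule f_inv_into_f)

lemma cinv_in_cdom: "x \<in> cimg i \<Longrightarrow> cinv M i x \<in> cdom M i"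
  unfolding cinv_def by (rule inv_into_into)

lemma openin_iff: "openin (manifold_topology M) U \<longleftrightarrow>
    U \<subseteq> points M \<and> (\<forall>i\<in>charts M. open (cmap M i ` (U \<inter> cdom M i)))"
  by (rule openin_manifold_topology) (simp add: inj_cmap)

lemma open_overlap: "i \<in> charts M \<Longrightarrow> j \<in> charts M \<Longrightarrow> open (cmap M i ` (cdom M i \<inter> cdom M j))"
  using smooth by (simp add: smooth_manifold_def)

lemma open_cimg: "i \<in> charts M \<Longrightarrow> open (cimg i)"
  using open_overlap[of i i] by simp

lemma openin_cdom: "i \<in> charts M \<Longrightarrow> openin (manifold_topology M) (cdom M i)"
  unfolding openin_iff using open_overlap cdom_points by (auto simp: Int_commute)

lemma topspace_eq: "topspace (manifold_topology M) = points M"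
proof
  show "topspace (manifold_topology M) \<subseteq> points M"
    using openin_topspace[of "manifold_topology M"] openin_iff by blast
  show "points M \<subseteq> topspace (manifold_topology M)"
    using openin_subset[OF openin_cdom] points_eq by auto
qed

lemma locally_constant_imp_constant:
  assumes conn: "connected_space (manifold_topology M)"
    and loc: "\<And>i p. i \<in> charts M \<Longrightarrow> p \<in> cdom M i \<Longrightarrow>
      \<exists>X. open X \<and> cmap M i p \<in> X \<and> X \<subseteq> cimg i \<and> (\<forall>x\<in>X. c (cinv M i x) = c p)"
    and pq: "p \<in> points M" "q \<in> points M"
  shows "c p = c q"
proof (rule ccontr)
  assume ne: "c p \<noteq> c q"
  \<comment> \<open>For an arbitrary predicate of the value, so that it gives both halves of the
    disconnection.\<close>
  have op: "openin (manifold_topology M) {m \<in> points M. P (c m)}" for P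
    unfolding openin_iff
  proof (intro conjI ballI)
    fix i assume i: "i \<in> charts M"
    show "open (cmap M i ` ({m \<in> points M. P (c m)} \<inter> cdom M i))"
    proof (subst open_subopen, intro ballI)
      fix x assume "x \<in> cmap M i ` ({m \<in> points M. P (c m)} \<inter> cdom M i)"
      then obtain m where m: "m \<in> cdom M i" "P (c m)" "x = cmap M i m" by auto
      obtain X where X: "open X" "x \<in> X" "X \<subseteq> cimg i" "\<forall>y\<in>X. c (cinv M i y) = c m"
        using loc[OF i m(1)] m(3) by blast
      have "X \<subseteq> cmap M i ` ({m \<in> points M. P (c m)} \<inter> cdom M i)"
      proof
        fix y assume y: "y \<in> X"
        have "cinv M i y \<in> cdom M i" "P (c (cinv M i y))" "y = cmap M i (cinv M i y)"
          using X y m cinv_in_cdom by auto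
        then show "y \<in> cmap M i ` ({m \<in> points M. P (c m)} \<inter> cdom M i)"
          using cdom_points[OF i] by blast
      qed
      with X show "\<exists>T. open T \<and> x \<in> T \<and> T \<subseteq> cmap M i ` ({m \<in> points M. P (c m)} \<inter> cdom M i)" by blast
    qed
  qed auto
  let ?A = "{m \<in> points M. c m = c p}" and ?B = "{m \<in> points M. c m \<noteq> c p}"
  have "openin (manifold_topology M) ?A" "openin (manifold_topology M) ?B" by (rule op)+
  moreover have "topspace (manifold_topology M) \<subseteq> ?A \<union> ?B" "?A \<inter> ?B = {}" "?A \<noteq> {}" "?B \<noteq> {}"
    using pq ne by (auto simp: topspace_eq)
  ultimately show False using conn unfolding connected_space_def by metis
qed

lemma smooth_map_id: "smooth_map M M id"
  using smooth by (auto simp: smooth_map_def smooth_manifold_def local_rep_def Int_def)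

lemma local_rep_ident:
  "i \<in> charts M \<Longrightarrow> x \<in> cimg i \<Longrightarrow> local_rep M i M i (\<lambda>p. p) x = x"
  by (simp add: local_rep_def)

end

section \<open>Composites and inverses of smooth maps, and transport of tensors and connections
  along them\<close>

lemma smooth_map_points: "smooth_map M N \<phi> \<Longrightarrow> p \<in> points M \<Longrightarrow> \<phi> p \<in> points N"
  unfolding smooth_map_def by blast

text \<open>The composite is a parameter that is prescribed on the points only. This allows for
  values outside the manifold that differ, as for the extensional maps of a permutation group or for
  \<open>inv_into\<close>.\<close>

locale smooth_map_comp =
  M: smooth_mfd M + N: smooth_mfd N + P: smooth_mfd P
  for M :: "('i, 'a, 'e::fin_dim) atlas" and N :: "('j, 'b, 'f::fin_dim) atlas"
    and P :: "('k, 'c, 'g::fin_dim) atlas" +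
  fixes \<phi> \<psi> \<rho>
  assumes phi: "smooth_map M N \<phi>" and psi: "smooth_map N P \<psi>"
    and comp: "\<And>p. p \<in> points M \<Longrightarrow> \<rho> p = \<psi> (\<phi> p)"
begin

lemma smooth_near:
  assumes i: "i \<in> charts M" "p \<in> cdom M i" and j: "j \<in> charts N" "\<phi> p \<in> cdom N j"
    and k: "k \<in> charts P" "\<rho> p \<in> cdom P k"
  obtains S T where "open S" "open T" "cmap M i p \<in> S" "cmap N j (\<phi> p) \<in> T"
    "S \<subseteq> cmap M i ` {p \<in> cdom M i. \<rho> p \<in> cdom P k}"
    "smooth_on (local_rep M i N j \<phi>) S" "smooth_on (local_rep N j P k \<psi>) T" "local_rep M i N j \<phi> ` S \<subseteq> T"
    "\<And>x. x \<in> S \<Longrightarrow> local_rep M i P k \<rho> x = local_rep N j P k \<psi> (local_rep M i N j \<phi> x)"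
proof -
  let ?S = "cmap M i ` {p \<in> cdom M i. \<phi> p \<in> cdom N j}"
  let ?T = "cmap N j ` {p \<in> cdom N j. \<psi> p \<in> cdom P k}"
  have S: "open ?S" "smooth_on (local_rep M i N j \<phi>) ?S" using phi i j by (auto simp: smooth_map_def)
  have T: "open ?T" "smooth_on (local_rep N j P k \<psi>) ?T" using psi k j by (auto simp: smooth_map_def)
  \<comment> \<open>Shrinking to a preimage makes the three local representatives comparable. That a
    point of this set passes through the chosen middle chart follows from injectivity of that
    chart.\<close>
  define O' where "O' = ?S \<inter> local_rep M i N j \<phi> -` ?T"
  have O': "open O'"
    unfolding O'_def by (rule continuous_open_preimage[OF smooth_on_continuous_on[OF S(2)] S(1) T(1)])
  have mem: "x \<in> O' \<Longrightarrow> \<exists>p. p \<in> cdom M i \<and> \<phi> p \<in> cdom N j \<and> \<rho> p \<in> cdom P k \<and> x = cmap M i p" for x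
  proof -
    assume "x \<in> O'"
    then obtain p q where p: "p \<in> cdom M i" "\<phi> p \<in> cdom N j" "x = cmap M i p"
      and q: "q \<in> cdom N j" "\<psi> q \<in> cdom P k" "local_rep M i N j \<phi> x = cmap N j q"
      by (auto simp: O'_def)
    then have "cmap N j (\<phi> p) = cmap N j q" using i by (simp add: local_rep_def)
    then have "\<phi> p = q" using N.inj_cmap[OF j(1)] p q by (auto dest: inj_onD)
    then show ?thesis using p q comp M.cdom_points[OF i(1)] by metis
  qed
  show ?thesis
  proof (rule that[OF O' T(1)])
    show "cmap M i p \<in> O'" "cmap N j (\<phi> p) \<in> ?T"
      using i j k comp[OF M.cdom_points[OF i]] by (auto simp: O'_def local_rep_def)
    show "O' \<subseteq> cmap M i ` {p \<in> cdom M i. \<rho> p \<in> cdom P k}" using mem by blast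
    show "smooth_on (local_rep M i N j \<phi>) O'" by (rule smooth_on_mono[OF S(2)]) (simp add: O'_def)
    show "smooth_on (local_rep N j P k \<psi>) ?T" by (fact T(2))
    show "local_rep M i N j \<phi> ` O' \<subseteq> ?T" by (auto simp: O'_def)
    show "local_rep M i P k \<rho> x = local_rep N j P k \<psi> (local_rep M i N j \<phi> x)" if "x \<in> O'" for x
      using mem[OF that] i j comp M.cdom_points by (auto simp: local_rep_def)
  qed
qed

lemma smooth_map: "smooth_map M P \<rho>"
  unfolding smooth_map_def
proof (intro conjI ballI)
  show "\<rho> ` points M \<subseteq> points P"
    using smooth_map_points[OF psi smooth_map_points[OF phi]] comp by auto
  fix i k assume i: "i \<in> charts M" and k: "k \<in> charts P"
  have ex: "\<exists>S. open S \<and> x \<in> S \<and> S \<subseteq> cmap M i ` {p \<in> cdom M i. \<rho> p \<in> cdom P k} \<and> smooth_on (local_rep M i P k \<rho>) S"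
    if x: "x \<in> cmap M i ` {p \<in> cdom M i. \<rho> p \<in> cdom P k}" for x
  proof -
    obtain p where p: "p \<in> cdom M i" "\<rho> p \<in> cdom P k" "x = cmap M i p" using x by auto
    have "\<phi> p \<in> points N" by (rule smooth_map_points[OF phi M.cdom_points[OF i p(1)]])
    then obtain j where j: "j \<in> charts N" "\<phi> p \<in> cdom N j" using N.obtain_chart by blast
    show ?thesis
    proof (rule smooth_near[OF i p(1) j k p(2)])
      fix S T assume ST: "open S" "open T" "cmap M i p \<in> S" "cmap N j (\<phi> p) \<in> T"
        "S \<subseteq> cmap M i ` {p \<in> cdom M i. \<rho> p \<in> cdom P k}"
        "smooth_on (local_rep M i N j \<phi>) S" "smooth_on (local_rep N j P k \<psi>) T" "local_rep M i N j \<phi> ` S \<subseteq> T"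
        "\<And>x. x \<in> S \<Longrightarrow> local_rep M i P k \<rho> x = local_rep N j P k \<psi> (local_rep M i N j \<phi> x)"
      have "smooth_on (local_rep M i P k \<rho>) S"
        by (rule smooth_on_cong[OF ST(1) ST(9)[symmetric] smooth_on_compose[OF ST(1,2,7,6,8)]])
      then show ?thesis using ST(1,3,5) p(3) by blast
    qed
  qed
  show "open (cmap M i ` {p \<in> cdom M i. \<rho> p \<in> cdom P k})"
    unfolding open_subopen[of "cmap M i ` _"] using ex by meson
  show "smooth_on (local_rep M i P k \<rho>) (cmap M i ` {p \<in> cdom M i. \<rho> p \<in> cdom P k})"
    by (rule smooth_on_local) (use ex in meson)
qed

context
  fixes i p j k
  assumes i: "i \<in> charts M" "p \<in> cdom M i" and j: "j \<in> charts N" "\<phi> p \<in> cdom N j"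
    and k: "k \<in> charts P" "\<rho> p \<in> cdom P k"
begin

abbreviation (input) "R1 \<equiv> local_rep M i N j \<phi>"
abbreviation (input) "R2 \<equiv> local_rep N j P k \<psi>"
abbreviation (input) "R3 \<equiv> local_rep M i P k \<rho>"

lemma chain:
  "Dd R3 (cmap M i p) v = Dd R2 (cmap N j (\<phi> p)) (Dd R1 (cmap M i p) v)"
  "D2 R3 (cmap M i p) u v = D2 R2 (cmap N j (\<phi> p)) (Dd R1 (cmap M i p) u) (Dd R1 (cmap M i p) v)
      + Dd R2 (cmap N j (\<phi> p)) (D2 R1 (cmap M i p) u v)"
  "linear (Dd R2 (cmap N j (\<phi> p)))" "linear (Dd R1 (cmap M i p))"
proof -
  obtain S T where ST: "open S" "open T" "cmap M i p \<in> S" "cmap N j (\<phi> p) \<in> T"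
      "smooth_on R1 S" "smooth_on R2 T" "R1 ` S \<subseteq> T" "\<And>x. x \<in> S \<Longrightarrow> R3 x = R2 (R1 x)"
    by (rule smooth_near[OF i j k], rule that; (assumption | blast))
  have e: "R1 (cmap M i p) = cmap N j (\<phi> p)" using i by (simp add: local_rep_def)
  have c1: "Dd R3 (cmap M i p) = Dd (\<lambda>x. R2 (R1 x)) (cmap M i p)"
    by (rule Dd_cong_open[OF ST(1,3,8)])
  have c2: "D2 R3 (cmap M i p) = D2 (\<lambda>x. R2 (R1 x)) (cmap M i p)"
    by (rule D2_cong_open[OF ST(1,3,8)])
  show "Dd R3 (cmap M i p) v = Dd R2 (cmap N j (\<phi> p)) (Dd R1 (cmap M i p) v)"
    using Dd_compose[OF smooth_on_differentiable[OF ST(5,3)], of R2, unfolded e, OF smooth_on_differentiable[OF ST(6,4)]]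
    unfolding c1 by simp
  show "D2 R3 (cmap M i p) u v = D2 R2 (cmap N j (\<phi> p)) (Dd R1 (cmap M i p) u) (Dd R1 (cmap M i p) v)
      + Dd R2 (cmap N j (\<phi> p)) (D2 R1 (cmap M i p) u v)"
    using D2_compose[OF ST(1,2,6,5,7,3)] unfolding c2 e .
  show "linear (Dd R2 (cmap N j (\<phi> p)))" "linear (Dd R1 (cmap M i p))"
    by (rule smooth_on_linear_Dd[OF ST(6,4)], rule smooth_on_linear_Dd[OF ST(5,3)])
qed

end

lemma intermediate_chart:
  assumes "i \<in> charts M" "p \<in> cdom M i"
  obtains j where "j \<in> charts N" "\<phi> p \<in> cdom N j"
proof -
  have "\<phi> p \<in> points N" by (rule smooth_map_points[OF phi M.cdom_points[OF assms]])
  then show thesis using N.obtain_chart that by blast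
qed

lemma maps_form2:
  assumes "maps_form2 M g N h \<phi>" "maps_form2 N h P l \<psi>"
  shows "maps_form2 M g P l \<rho>"
  unfolding maps_form2_def Let_def
proof (intro ballI impI allI)
  fix i k p u v assume i: "i \<in> charts M" and k: "k \<in> charts P" and p: "p \<in> cdom M i" "\<rho> p \<in> cdom P k"
  obtain j where j: "j \<in> charts N" "\<phi> p \<in> cdom N j" using intermediate_chart[OF i p(1)] .
  have c: "\<rho> p = \<psi> (\<phi> p)" by (rule comp[OF M.cdom_points[OF i p(1)]])
  show "l k (cmap P k (\<rho> p)) (Dd (local_rep M i P k \<rho>) (cmap M i p) u) (Dd (local_rep M i P k \<rho>) (cmap M i p) v) =
      g i (cmap M i p) u v"
    unfolding chain(1)[OF i p(1) j k p(2)]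
    using assms i j k p c unfolding maps_form2_def Let_def by simp
qed

lemma maps_endo:
  assumes "maps_endo M A N B \<phi>" "maps_endo N B P D \<psi>"
  shows "maps_endo M A P D \<rho>"
  unfolding maps_endo_def Let_def
proof (intro ballI impI allI)
  fix i k p u assume i: "i \<in> charts M" and k: "k \<in> charts P" and p: "p \<in> cdom M i" "\<rho> p \<in> cdom P k"
  obtain j where j: "j \<in> charts N" "\<phi> p \<in> cdom N j" using intermediate_chart[OF i p(1)] .
  have c: "\<rho> p = \<psi> (\<phi> p)" by (rule comp[OF M.cdom_points[OF i p(1)]])
  show "D k (cmap P k (\<rho> p)) (Dd (local_rep M i P k \<rho>) (cmap M i p) u) =
      Dd (local_rep M i P k \<rho>) (cmap M i p) (A i (cmap M i p) u)"
    unfolding chain(1)[OF i p(1) j k p(2)]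
    using assms i j k p c unfolding maps_endo_def Let_def by simp
qed

text \<open>The inhomogeneous terms of the two transformation laws add up to the one for the
  composite, by the second equation of \<open>chain\<close>.\<close>

lemma maps_connection:
  assumes "maps_connection M A N B \<phi>" "maps_connection N B P D \<psi>"
  shows "maps_connection M A P D \<rho>"
  unfolding maps_connection_def christoffel_related_def
proof (intro ballI impI allI)
  fix i k p u v assume i: "i \<in> charts M" and k: "k \<in> charts P" and p: "p \<in> cdom M i" "\<rho> p \<in> cdom P k"
  obtain j where j: "j \<in> charts N" "\<phi> p \<in> cdom N j" using intermediate_chart[OF i p(1)] .
  have c: "\<rho> p = \<psi> (\<phi> p)" by (rule comp[OF M.cdom_points[OF i p(1)]])
  let ?D1 = "Dd (local_rep M i N j \<phi>) (cmap M i p)" and ?D2 = "Dd (local_rep N j P k \<psi>) (cmap N j (\<phi> p))"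
  have 1: "B j (cmap N j (\<phi> p)) (?D1 u) (?D1 v) + D2 (local_rep M i N j \<phi>) (cmap M i p) u v =
      ?D1 (A i (cmap M i p) u v)"
    using assms(1) i j p unfolding maps_connection_def christoffel_related_def by simp
  have 2: "D k (cmap P k (\<psi> (\<phi> p))) (?D2 (?D1 u)) (?D2 (?D1 v))
      + D2 (local_rep N j P k \<psi>) (cmap N j (\<phi> p)) (?D1 u) (?D1 v) =
      ?D2 (B j (cmap N j (\<phi> p)) (?D1 u) (?D1 v))"
    using assms(2) j k p c unfolding maps_connection_def christoffel_related_def by simp
  show "D k (cmap P k (\<rho> p)) (Dd (local_rep M i P k \<rho>) (cmap M i p) u) (Dd (local_rep M i P k \<rho>) (cmap M i p) v)
      + D2 (local_rep M i P k \<rho>) (cmap M i p) u v =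
      Dd (local_rep M i P k \<rho>) (cmap M i p) (A i (cmap M i p) u v)"
    unfolding chain(1,2)[OF i p(1) j k p(2)] c 1[symmetric]
    using 2 by (simp add: linear_add[OF chain(3)[OF i p(1) j k p(2)]] add.assoc[symmetric])
qed

end

text \<open>Both composites are instances of \<open>smooth_map_comp\<close> with the identity as
  composite, so the inverse derivatives are read off from the chain rule.\<close>

locale smooth_inverse_maps =
  M: smooth_mfd M + N: smooth_mfd N
  for M :: "('i, 'a, 'e::fin_dim) atlas" and N :: "('j, 'b, 'f::fin_dim) atlas" +
  fixes \<phi> \<phi>'
  assumes phi: "smooth_map M N \<phi>" and phi': "smooth_map N M \<phi>'"
    and inv: "\<And>p. p \<in> points M \<Longrightarrow> \<phi>' (\<phi> p) = p" and inv': "\<And>q. q \<in> points N \<Longrightarrow> \<phi> (\<phi>' q) = q"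
begin

sublocale A: smooth_map_comp M N M \<phi> \<phi>' "\<lambda>p. p"
  by unfold_locales (auto simp: phi phi' inv)

sublocale B: smooth_map_comp N M N \<phi>' \<phi> "\<lambda>p. p"
  by unfold_locales (auto simp: phi phi' inv')

context
  fixes i j q
  assumes i: "i \<in> charts M" "\<phi>' q \<in> cdom M i" and j: "j \<in> charts N" "q \<in> cdom N j"
begin

abbreviation (input) "R \<equiv> local_rep M i N j \<phi>"
abbreviation (input) "R' \<equiv> local_rep N j M i \<phi>'"

lemma phi_phi'_q: "\<phi> (\<phi>' q) = q" "\<phi> (\<phi>' q) \<in> cdom N j"
  using inv' N.cdom_points[OF j] j by auto

text \<open>The third equation is the second derivative of \<open>phi\<close> after its inverse
  being the identity. It expresses the second derivative of the inverse, as the transformation law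
  of a connection requires.\<close>

lemma Dd_inverse:
  "Dd R (cmap M i (\<phi>' q)) (Dd R' (cmap N j q) v) = v"
  "Dd R' (cmap N j q) (Dd R (cmap M i (\<phi>' q)) w) = w"
  "D2 R (cmap M i (\<phi>' q)) (Dd R' (cmap N j q) u) (Dd R' (cmap N j q) v)
     + Dd R (cmap M i (\<phi>' q)) (D2 R' (cmap N j q) u v) = 0"
proof -
  have idN: "Dd (local_rep N j N j (\<lambda>p. p)) (cmap N j q) = (\<lambda>v. v)"
    "D2 (local_rep N j N j (\<lambda>p. p)) (cmap N j q) u v = 0" for u v
  proof -
    have m: "cmap N j q \<in> N.cimg j" using j by auto
    show "Dd (local_rep N j N j (\<lambda>p. p)) (cmap N j q) = (\<lambda>v. v)"
      by (subst Dd_cong_open[OF N.open_cimg[OF j(1)] m N.local_rep_ident[OF j(1)]])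
        (auto simp: frechet_derivative_ident)
    show "D2 (local_rep N j N j (\<lambda>p. p)) (cmap N j q) u v = 0"
      by (subst D2_cong_open[OF N.open_cimg[OF j(1)] m N.local_rep_ident[OF j(1)]])
        (auto simp: D2_def frechet_derivative_ident frechet_derivative_const)
  qed
  have idM: "Dd (local_rep M i M i (\<lambda>p. p)) (cmap M i (\<phi>' q)) = (\<lambda>v. v)"
  proof -
    have m: "cmap M i (\<phi>' q) \<in> M.cimg i" using i by auto
    show ?thesis
      by (subst Dd_cong_open[OF M.open_cimg[OF i(1)] m M.local_rep_ident[OF i(1)]])
        (auto simp: frechet_derivative_ident)
  qed
  show "Dd R (cmap M i (\<phi>' q)) (Dd R' (cmap N j q) v) = v"
    using B.chain(1)[OF j i j, of v] by (simp add: idN)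
  show "Dd R' (cmap N j q) (Dd R (cmap M i (\<phi>' q)) w) = w"
    using A.chain(1)[OF i j(1) phi_phi'_q(2) i, of w] by (simp add: idM phi_phi'_q)
  show "D2 R (cmap M i (\<phi>' q)) (Dd R' (cmap N j q) u) (Dd R' (cmap N j q) v)
     + Dd R (cmap M i (\<phi>' q)) (D2 R' (cmap N j q) u v) = 0"
    using B.chain(2)[OF j i j, of u v] by (simp add: idN)
qed

end

lemma maps_form2_inverse:
  assumes "maps_form2 M g N h \<phi>"
  shows "maps_form2 N h M g \<phi>'"
  unfolding maps_form2_def Let_def
proof (intro ballI impI allI)
  fix j i q u v assume j: "j \<in> charts N" and i: "i \<in> charts M" and q: "q \<in> cdom N j" "\<phi>' q \<in> cdom M i"
  note f = phi_phi'_q[OF i q(2) j q(1)]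
  have "\<And>u v. h j (cmap N j q) (Dd (local_rep M i N j \<phi>) (cmap M i (\<phi>' q)) u) (Dd (local_rep M i N j \<phi>) (cmap M i (\<phi>' q)) v)
      = g i (cmap M i (\<phi>' q)) u v"
    using assms i j q f unfolding maps_form2_def Let_def by metis
  from this[symmetric] show "g i (cmap M i (\<phi>' q)) (Dd (local_rep N j M i \<phi>') (cmap N j q) u) (Dd (local_rep N j M i \<phi>') (cmap N j q) v) =
      h j (cmap N j q) u v"
    by (simp add: Dd_inverse[OF i q(2) j q(1)])
qed

lemma maps_endo_inverse:
  assumes "maps_endo M A N B \<phi>"
  shows "maps_endo N B M A \<phi>'"
  unfolding maps_endo_def Let_def
proof (intro ballI impI allI)
  fix j i q u assume j: "j \<in> charts N" and i: "i \<in> charts M" and q: "q \<in> cdom N j" "\<phi>' q \<in> cdom M i"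
  note f = phi_phi'_q[OF i q(2) j q(1)] and d = Dd_inverse[OF i q(2) j q(1)]
  let ?D = "Dd (local_rep M i N j \<phi>) (cmap M i (\<phi>' q))" and ?D' = "Dd (local_rep N j M i \<phi>') (cmap N j q)"
  have "B j (cmap N j q) (?D (?D' u)) = ?D (A i (cmap M i (\<phi>' q)) (?D' u))"
    using assms i j q f unfolding maps_endo_def Let_def by metis
  then have "?D' (B j (cmap N j q) u) = ?D' (?D (A i (cmap M i (\<phi>' q)) (?D' u)))" by (simp add: d)
  then show "A i (cmap M i (\<phi>' q)) (?D' u) = ?D' (B j (cmap N j q) u)" by (simp add: d)
qed

lemma maps_connection_inverse:
  assumes "maps_connection M A N B \<phi>"
  shows "maps_connection N B M A \<phi>'"
  unfolding maps_connection_def christoffel_related_def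
proof (intro ballI impI allI)
  fix j i q u v assume j: "j \<in> charts N" and i: "i \<in> charts M" and q: "q \<in> cdom N j" "\<phi>' q \<in> cdom M i"
  note f = phi_phi'_q[OF i q(2) j q(1)] and d = Dd_inverse[OF i q(2) j q(1)]
  let ?D = "Dd (local_rep M i N j \<phi>) (cmap M i (\<phi>' q))" and ?D' = "Dd (local_rep N j M i \<phi>') (cmap N j q)"
  let ?d = "D2 (local_rep N j M i \<phi>') (cmap N j q) u v"
  have l: "linear ?D" "linear ?D'"
    using B.chain(3,4)[OF j q(1) i q(2) j q(1)] .
  have 1: "B j (cmap N j q) (?D (?D' u)) (?D (?D' v)) + D2 (local_rep M i N j \<phi>) (cmap M i (\<phi>' q)) (?D' u) (?D' v)
      = ?D (A i (cmap M i (\<phi>' q)) (?D' u) (?D' v))"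
    using assms i j q f unfolding maps_connection_def christoffel_related_def by metis
  have 2: "D2 (local_rep M i N j \<phi>) (cmap M i (\<phi>' q)) (?D' u) (?D' v) = - ?D ?d"
    using d(3)[of u v] by (simp add: eq_neg_iff_add_eq_0)
  have "?D' (B j (cmap N j q) u v - ?D ?d) = ?D' (?D (A i (cmap M i (\<phi>' q)) (?D' u) (?D' v)))"
    using 1 2 by (simp add: d)
  then have "?D' (B j (cmap N j q) u v) - ?d = A i (cmap M i (\<phi>' q)) (?D' u) (?D' v)"
    by (simp add: d linear_diff[OF l(2)])
  then show "A i (cmap M i (\<phi>' q)) (?D' u) (?D' v) + ?d = ?D' (B j (cmap N j q) u v)" by (simp add: algebra_simps)
qed

end

text \<open>The map is seen as a composite with \<open>id\<close>, where only agreement on the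
  points is demanded. Smoothness of \<open>inv_into\<close> is obtained in this way.\<close>

lemma smooth_map_cong_points:
  fixes M :: "('i, 'a, 'e::fin_dim) atlas" and N :: "('j, 'b, 'f::fin_dim) atlas"
  assumes "smooth_manifold M" "smooth_manifold N" "smooth_map M N \<phi>" "\<And>p. p \<in> points M \<Longrightarrow> \<psi> p = \<phi> p"
  shows "smooth_map M N \<psi>"
proof -
  interpret M: smooth_mfd M by (rule smooth_mfd.intro[OF assms(1)])
  interpret c: smooth_map_comp M M N id \<phi> \<psi>
    by (intro smooth_map_comp.intro smooth_mfd.intro smooth_map_comp_axioms.intro assms(1-3) M.smooth_map_id)
      (simp add: assms(4))
  show ?thesis by (rule c.smooth_map)
qed

section \<open>The product of a manifold with a model space\<close>

context smooth_mfd begin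

lemma openin_chart_preimage:
  assumes i: "i \<in> charts M" and A: "open A" "A \<subseteq> cimg i"
  shows "openin (manifold_topology M) (cinv M i ` A)"
  unfolding openin_iff
proof (intro conjI ballI)
  show "cinv M i ` A \<subseteq> points M"
    using A cinv_in_cdom cdom_points[OF i] by blast
  fix j assume j: "j \<in> charts M"
  let ?S = "cmap M j ` (cdom M j \<inter> cdom M i)"
  have cont: "continuous_on ?S (cmap M i \<circ> cinv M j)"
    using smooth i j unfolding smooth_manifold_def by (intro smooth_on_continuous_on) blast
  have "cmap M j ` (cinv M i ` A \<inter> cdom M j) = ?S \<inter> (cmap M i \<circ> cinv M j) -` A"
  proof (intro subset_antisym subsetI)
    fix z assume "z \<in> cmap M j ` (cinv M i ` A \<inter> cdom M j)"
    then obtain x where x: "x \<in> A" "cinv M i x \<in> cdom M j" "z = cmap M j (cinv M i x)" by blast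
    then have "x \<in> cimg i" using A by blast
    then show "z \<in> ?S \<inter> (cmap M i \<circ> cinv M j) -` A"
      using x cinv_in_cdom[of x i] cmap_cinv[of x i] j by simp
  next
    fix z assume z: "z \<in> ?S \<inter> (cmap M i \<circ> cinv M j) -` A"
    then obtain p where p: "p \<in> cdom M j" "p \<in> cdom M i" "z = cmap M j p" by blast
    then have "cmap M i p \<in> A" using z j by simp
    moreover have "p = cinv M i (cmap M i p)" using p i by simp
    ultimately show "z \<in> cmap M j ` (cinv M i ` A \<inter> cdom M j)" using p by blast
  qed
  then show "open (cmap M j ` (cinv M i ` A \<inter> cdom M j))"
    using continuous_open_preimage[OF cont open_overlap[OF j i] A(1)] by simp
qed

text \<open>Describes the product topology chart by chart, in the form in which it can be compared
  with the topology defined by the bundle charts.\<close>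

lemma openin_prod_iff:
  fixes W :: "('a \<times> 'f::topological_space) set"
  shows "openin (prod_topology (manifold_topology M) euclidean) W \<longleftrightarrow>
    W \<subseteq> points M \<times> UNIV \<and> (\<forall>i\<in>charts M. open {z. fst z \<in> cimg i \<and> (cinv M i (fst z), snd z) \<in> W})"
    (is "?L \<longleftrightarrow> ?R")
proof
  assume L: ?L
  then have "W \<subseteq> points M \<times> UNIV" using openin_subset by (fastforce simp: topspace_eq)
  moreover have "open {z. fst z \<in> cimg i \<and> (cinv M i (fst z), snd z) \<in> W}" if i: "i \<in> charts M" for i
  proof (subst open_subopen, intro ballI)
    fix z assume z: "z \<in> {z. fst z \<in> cimg i \<and> (cinv M i (fst z), snd z) \<in> W}"
    then have "(cinv M i (fst z), snd z) \<in> W" by simp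
    from L[unfolded openin_prod_topology_alt, rule_format, OF this]
    obtain U V where UV: "openin (manifold_topology M) U" "open V" "cinv M i (fst z) \<in> U" "snd z \<in> V" "U \<times> V \<subseteq> W"
      by auto
    let ?T = "cmap M i ` (U \<inter> cdom M i) \<times> V"
    have zi: "fst z \<in> cimg i" using z by simp
    have "fst z \<in> cmap M i ` (U \<inter> cdom M i)"
      using UV(3) cinv_in_cdom[OF zi] cmap_cinv[OF zi] by (metis IntI imageI)
    then have "z \<in> ?T" using UV(4) by (simp add: mem_Times_iff)
    moreover have "open ?T" using UV(1,2) i openin_iff open_Times by blast
    moreover have "?T \<subseteq> {z. fst z \<in> cimg i \<and> (cinv M i (fst z), snd z) \<in> W}"
      using UV(5) i by auto
    ultimately show "\<exists>T. open T \<and> z \<in> T \<and> T \<subseteq> {z. fst z \<in> cimg i \<and> (cinv M i (fst z), snd z) \<in> W}" by blast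
  qed
  ultimately show ?R by blast
next
  assume R: ?R
  show ?L unfolding openin_prod_topology_alt
  proof (intro allI impI)
    fix m w assume mw: "(m, w) \<in> W"
    then have "m \<in> points M" using R by blast
    then obtain i where i: "i \<in> charts M" "m \<in> cdom M i" by (rule obtain_chart)
    let ?S = "{z. fst z \<in> cimg i \<and> (cinv M i (fst z), snd z) \<in> W}"
    have "open ?S" "(cmap M i m, w) \<in> ?S" using R i mw by auto
    then obtain A V where AV: "open A" "open V" "(cmap M i m, w) \<in> A \<times> V" "A \<times> V \<subseteq> ?S"
      by (rule open_prod_elim)
    then have A: "A \<subseteq> cimg i" by fastforce
    have "openin (manifold_topology M) (cinv M i ` A)"
      by (rule openin_chart_preimage[OF i(1) AV(1) A])
    moreover have "m \<in> cinv M i ` A" using AV(3) i by force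
    moreover have "cinv M i ` A \<times> V \<subseteq> W" using AV(4) by auto
    ultimately show "\<exists>U V. openin (manifold_topology M) U \<and> openin euclidean V \<and> m \<in> U \<and> w \<in> V \<and> U \<times> V \<subseteq> W"
      using AV(2,3) by auto
  qed
qed

end

section \<open>Nondegenerate forms and block endomorphisms\<close>

lemma Blinfun_linear_apply:
  fixes f :: "'a::fin_dim \<Rightarrow> 'b::real_normed_vector"
  shows "linear f \<Longrightarrow> blinfun_apply (Blinfun f) v = f v"
  by (simp add: bounded_linear_Blinfun_apply linear_imp_bounded_linear)

lemma linear_blinfun_apply: "linear (blinfun_apply f)"
  by (simp add: bounded_linear.linear blinfun.bounded_linear_right)

lemma bilinear_linear_left: "bilinear f \<Longrightarrow> linear (\<lambda>x. f x y)"
  and bilinear_linear_right: "bilinear f \<Longrightarrow> linear (f x)"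
  by (simp_all add: bilinear_def)

text \<open>No symmetry is imposed: the instances are the symmetric \<open>g\<close> as well as the
  alternating forms \<open>om\<close> and \<open>Bf\<close>.\<close>

locale nondegenerate_form =
  fixes B :: "'e::euclidean_space \<Rightarrow> 'e \<Rightarrow> real"
  assumes bil: "bilinear B" and nondeg: "\<And>u. (\<And>v. B u v = 0) \<Longrightarrow> u = 0"
begin

lemma flat_apply [simp]: "blinfun_apply (flat_map B u) v = B u v"
  unfolding flat_map_def by (rule Blinfun_linear_apply[OF bilinear_linear_right[OF bil]])

lemma flat_linear: "linear (flat_map B)"
  by (rule linearI; rule blinfun_eqI)
    (simp_all add: bilinear_ladd[OF bil] bilinear_lmul[OF bil] blinfun.add_left blinfun.scaleR_left)

lemma flat_bij: "bij (flat_map B)"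
proof -
  \<comment> \<open>The matrix of the form, an endomorphism of the Euclidean space, for which
    injectivity implies surjectivity. Surjectivity onto the dual space is then read off on the
    standard basis.\<close>
  let ?A = "\<lambda>w. \<Sum>b\<in>Basis. B w b *\<^sub>R b"
  have A: "?A w \<bullet> b = B w b" if "b \<in> Basis" for w b
    using that by (simp add: inner_sum_left inner_Basis if_distrib cong: if_cong)
  have lin: "linear ?A"
    by (rule linearI) (simp_all add: bilinear_ladd[OF bil] bilinear_lmul[OF bil] scaleR_add_left sum.distrib
        scaleR_sum_right)
  have ext: "f = h" if "linear f" "linear h" "\<And>b. b \<in> Basis \<Longrightarrow> f b = h b" for f h :: "'e \<Rightarrow> real"
    using linear_eq_stdbasis[OF that] .
  have "inj ?A"
  proof (subst linear_injective_0[OF lin], intro allI impI)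
    fix u assume "?A u = 0"
    then have "B u b = 0" if "b \<in> Basis" for b using A[OF that, of u] by simp
    then have "B u = (\<lambda>_. 0)"
      by (intro ext bilinear_linear_right[OF bil]) (auto simp: linear_iff)
    then show "u = 0" using nondeg by simp
  qed
  then have surj: "surj ?A" by (rule linear_injective_imp_surjective[OF lin _ refl])
  have "inj (flat_map B)"
  proof (subst linear_injective_0[OF flat_linear], intro allI impI)
    fix u assume "flat_map B u = 0"
    then have "B u v = 0" for v using flat_apply[of u v] by simp
    then show "u = 0" using nondeg by simp
  qed
  moreover have "\<exists>w. flat_map B w = p" for p
  proof -
    obtain w where w: "(\<Sum>b\<in>Basis. blinfun_apply p b *\<^sub>R b) = ?A w" using surjE[OF surj] by blast
    have P: "(\<Sum>b\<in>Basis. blinfun_apply p b *\<^sub>R b) \<bullet> b = blinfun_apply p b" if "b \<in> Basis" for b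
      using that by (simp add: inner_sum_left inner_Basis if_distrib cong: if_cong)
    have "B w = blinfun_apply p"
    proof (rule ext[OF bilinear_linear_right[OF bil] linear_blinfun_apply])
      show "B w b = blinfun_apply p b" if "b \<in> Basis" for b
        using A[OF that, of w] P[OF that] by (simp only: w)
    qed
    then show ?thesis by (intro exI[of _ w] blinfun_eqI) simp
  qed
  ultimately show ?thesis unfolding bij_def surj_def by metis
qed

lemma sharp_flat [simp]: "sharp_map B (flat_map B u) = u"
  unfolding sharp_map_def using flat_bij by (simp add: bij_def)

lemma flat_sharp [simp]: "flat_map B (sharp_map B p) = p"
  unfolding sharp_map_def using flat_bij by (simp add: bij_def surj_f_inv_f)

lemma B_sharp [simp]: "B (sharp_map B p) v = blinfun_apply p v"
  using flat_apply[of "sharp_map B p" v] by simp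

lemma sharp_eqI: "(\<And>v. B w v = blinfun_apply p v) \<Longrightarrow> sharp_map B p = w"
  by (metis blinfun_eqI flat_apply sharp_flat)

lemma sharp_linear: "linear (sharp_map B)"
  by (rule linearI; rule sharp_eqI)
    (simp_all add: bilinear_ladd[OF bil] bilinear_lmul[OF bil] blinfun.add_left blinfun.scaleR_left)

end

text \<open>The three blocks have a common type so that tensoriality, integrability and invariance
  can be proved once for every \<open>blk\<close> among them.\<close>

definition block1 :: "('e::real_vector \<Rightarrow> 'e) \<Rightarrow> 'e \<times> 'e \<Rightarrow> 'e \<times> 'e" where
  "block1 A z = (A (fst z), - A (snd z))"

definition block2 :: "('e::real_vector \<Rightarrow> 'e) \<Rightarrow> 'e \<times> 'e \<Rightarrow> 'e \<times> 'e" where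
  "block2 A z = (- snd z, fst z)"

definition block3 :: "('e::real_vector \<Rightarrow> 'e) \<Rightarrow> 'e \<times> 'e \<Rightarrow> 'e \<times> 'e" where
  "block3 A z = (- A (snd z), - A (fst z))"

lemmas blk_defs = block1_def block2_def block3_def

lemma linear_blk:
  assumes "linear A" "blk \<in> {block1, block2, block3}"
  shows "linear (blk A)"
  using assms(2)
  by (auto simp: blk_defs linear_iff linear_add[OF assms(1)] linear_scale[OF assms(1)])

lemma blk_blk:
  assumes "linear A" "\<And>u. A (A u) = - u" "blk \<in> {block1, block2, block3}"
  shows "blk A (blk A z) = - z"
  using assms(3) by (auto simp: blk_defs linear_neg[OF assms(1)] assms(2) prod_eq_iff)

text \<open>Blocks are made of \<open>A\<close>, signs and the exchange of the two slots, all of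
  which commute with applying one linear map to both slots. This is the algebraic core of the
  invariance.\<close>

lemma blk_natural:
  assumes "linear T" "\<And>u. A' (T u) = T (A u)" "blk \<in> {block1, block2, block3}"
  shows "blk A' (map_prod T T z) = map_prod T T (blk A z)"
  using assms(3) by (auto simp: blk_defs linear_neg[OF assms(1)] assms(2) prod_eq_iff)

lemma smooth_on_blk:
  assumes o: "open S" and A: "\<And>v. smooth_on (\<lambda>x. A x v) S" and blk: "blk \<in> {block1, block2, block3}"
  shows "smooth_on (\<lambda>x. blk (A x) z) S"
  using blk by (auto simp: blk_defs intro!: smooth_on_Pair[OF o] smooth_on_minus[OF o] A smooth_on_const)

section \<open>Flat charts of a special Kaehler manifold with a developing map\<close>

text \<open>Connectedness turns locally constant into constant, and a point is needed at which to
  read off the constants.\<close>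

locale developed_special_kaehler = smooth_mfd M
  for M :: "('i, 'a, 'e::euclidean_space) atlas" +
  fixes J :: "('i, 'e) endo" and g :: "('i, 'e) form2" and C :: "('i, 'e) christoffel" and dev :: "'a \<Rightarrow> 'e"
  assumes sk: "special_kaehler M J g C"
    and developing: "developing_map M C dev"
    and connected: "connected_space (manifold_topology M)"
    and nonempty: "points M \<noteq> {}"
begin

definition om :: "('i, 'e) form2" where "om = kaehler_form g J"

definition F :: "'i \<Rightarrow> 'e \<Rightarrow> 'e" where "F i = dev \<circ> cinv M i"

lemma om_eq: "om i x u v = g i x (J i x u) v" by (simp add: om_def kaehler_form_def)

lemma kaehler: "kaehler_manifold M J g" and affine: "affine_connection M C"
  and parallel: "parallel_form2 M C (kaehler_form g J)" and hessian: "hessian_metric M C g"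
  using sk by (simp_all add: special_kaehler_def)

lemma riem: "riemannian_metric M g" and cplx: "complex_structure M J"
  using kaehler by (simp_all add: kaehler_manifold_def)

lemma g_form2: "form2_field M g" and J_endo: "endo_field M J"
  using riem cplx by (simp_all add: riemannian_metric_def complex_structure_def)

lemma smooth_g: "i \<in> charts M \<Longrightarrow> smooth_on (\<lambda>x. g i x u v) (cimg i)"
  using g_form2 by (simp add: form2_field_def)

lemma smooth_J: "i \<in> charts M \<Longrightarrow> smooth_on (\<lambda>x. J i x u) (cimg i)"
  using J_endo by (simp add: endo_field_def)

lemma smooth_C: "i \<in> charts M \<Longrightarrow> smooth_on (\<lambda>x. C i x u v) (cimg i)"
  using affine by (simp add: affine_connection_def)

lemma bilinear_g: "i \<in> charts M \<Longrightarrow> x \<in> cimg i \<Longrightarrow> bilinear (g i x)"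
  using g_form2 unfolding form2_field_def by blast

lemma bilinear_C: "i \<in> charts M \<Longrightarrow> x \<in> cimg i \<Longrightarrow> bilinear (C i x)"
  using affine unfolding affine_connection_def by blast

lemma linear_J: "i \<in> charts M \<Longrightarrow> x \<in> cimg i \<Longrightarrow> linear (J i x)"
  using J_endo unfolding endo_field_def by blast

lemma g_sym: "i \<in> charts M \<Longrightarrow> x \<in> cimg i \<Longrightarrow> g i x u v = g i x v u"
  using riem unfolding riemannian_metric_def by blast

lemma g_pos: "i \<in> charts M \<Longrightarrow> x \<in> cimg i \<Longrightarrow> u \<noteq> 0 \<Longrightarrow> g i x u u > 0"
  using riem unfolding riemannian_metric_def by blast

lemma JJ: "i \<in> charts M \<Longrightarrow> x \<in> cimg i \<Longrightarrow> J i x (J i x u) = - u"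
  using cplx unfolding complex_structure_def by blast

lemma g_JJ: "i \<in> charts M \<Longrightarrow> x \<in> cimg i \<Longrightarrow> g i x (J i x u) (J i x v) = g i x u v"
  using kaehler unfolding kaehler_manifold_def by blast

lemma om_parallel: "i \<in> charts M \<Longrightarrow> x \<in> cimg i \<Longrightarrow>
    Dd (\<lambda>y. om i y v w) x u = om i x (C i x u v) w + om i x v (C i x u w)"
  using parallel[unfolded parallel_form2_def cov_deriv_def, rule_format, of i x v w u]
  by (simp add: om_def frechet_derivative_const)

lemma smooth_om: "i \<in> charts M \<Longrightarrow> smooth_on (\<lambda>x. om i x u v) (cimg i)"
  unfolding om_eq
  by (rule smooth_on_apply[where L = "\<lambda>x s. g i x s v"])
    (auto simp: open_cimg smooth_g smooth_J bilinear_linear_left bilinear_g)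

lemma bilinear_om: "i \<in> charts M \<Longrightarrow> x \<in> cimg i \<Longrightarrow> bilinear (om i x)"
  using linear_compose[OF linear_J bilinear_linear_left[OF bilinear_g], unfolded o_def]
    bilinear_linear_right[OF bilinear_g]
  unfolding bilinear_def om_eq by blast

lemma om_alt: "i \<in> charts M \<Longrightarrow> x \<in> cimg i \<Longrightarrow> om i x u v = - om i x v u"
  using g_JJ[of i x "J i x u" v] g_sym[of i x "J i x v" u] bilinear_lneg[OF bilinear_g, of i x u "J i x v"]
  by (simp add: om_eq JJ)

lemma om_J: "i \<in> charts M \<Longrightarrow> x \<in> cimg i \<Longrightarrow> om i x u (J i x v) = g i x u v"
  by (simp add: om_eq g_JJ)

text \<open>Pairing \<open>u\<close> with \<open>J u\<close> gives \<open>g i x u u\<close>, which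
  is positive for nonzero \<open>u\<close>.\<close>

lemma nondegenerate_om: "i \<in> charts M \<Longrightarrow> x \<in> cimg i \<Longrightarrow> nondegenerate_form (om i x)"
  using bilinear_om[of i x] om_J[of i x] g_pos[of i x] by unfold_locales (blast, metis less_irrefl)

lemma nondegenerate_g: "i \<in> charts M \<Longrightarrow> x \<in> cimg i \<Longrightarrow> nondegenerate_form (g i x)"
  using bilinear_g[of i x] g_pos[of i x] by unfold_locales (blast, metis less_irrefl)

text \<open>\<open>G\<close> is a local inverse of the chart expression \<open>F i\<close> of the developing map.\<close>

definition flat_chart :: "'i \<Rightarrow> 'e set \<Rightarrow> 'e set \<Rightarrow> ('e \<Rightarrow> 'e) \<Rightarrow> bool" where
  "flat_chart i X Y G \<longleftrightarrow> i \<in> charts M \<and> open X \<and> X \<subseteq> cimg i \<and> open Y \<and> F i ` X \<subseteq> Y \<and> G ` Y \<subseteq> X \<and>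
     (\<forall>x\<in>X. G (F i x) = x) \<and> (\<forall>y\<in>Y. F i (G y) = y) \<and> smooth_on (F i) X \<and> smooth_on G Y \<and>
     (\<forall>x\<in>X. \<forall>u v. D2 (F i) x u v = Dd (F i) x (C i x u v))"

text \<open>With vanishing target symbols, \<open>christoffel_related\<close> becomes the equation
  for the second derivative. It is needed for the developing map and for the coordinates of the
  Hessian condition, which may differ.\<close>

lemma flat_coordinates_chart:
  assumes "flat_coordinates M C U \<xi>" "i \<in> charts M"
  shows "open (cmap M i ` (U \<inter> cdom M i))" "open (\<xi> ` (U \<inter> cdom M i))"
    "smooth_on (\<xi> \<circ> cinv M i) (cmap M i ` (U \<inter> cdom M i))"
    "\<And>x u v. x \<in> cmap M i ` (U \<inter> cdom M i) \<Longrightarrow> D2 (\<xi> \<circ> cinv M i) x u v = Dd (\<xi> \<circ> cinv M i) x (C i x u v)"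
proof -
  show "open (cmap M i ` (U \<inter> cdom M i))" "open (\<xi> ` (U \<inter> cdom M i))"
    "smooth_on (\<xi> \<circ> cinv M i) (cmap M i ` (U \<inter> cdom M i))"
    using assms unfolding flat_coordinates_def openin_iff by blast+
  fix x u v assume "x \<in> cmap M i ` (U \<inter> cdom M i)"
  then show "D2 (\<xi> \<circ> cinv M i) x u v = Dd (\<xi> \<circ> cinv M i) x (C i x u v)"
    using assms unfolding flat_coordinates_def christoffel_related_def by force
qed

lemma ex_flat_chart:
  assumes i: "i \<in> charts M" and x: "x \<in> cimg i"
  obtains X Y G where "flat_chart i X Y G" "x \<in> X"
proof -
  have p: "cinv M i x \<in> points M" using cinv_in_cdom[OF x] cdom_points[OF i] by blast
  then obtain U where U: "cinv M i x \<in> U" "flat_coordinates M C U dev"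
    using developing unfolding developing_map_def by blast
  let ?X = "cmap M i ` (U \<inter> cdom M i)" and ?Y = "dev ` (U \<inter> cdom M i)" and ?G = "cmap M i \<circ> inv_into U dev"
  note fc = flat_coordinates_chart[OF U(2) i]
  have inj: "inj_on dev U" and sG: "smooth_on ?G ?Y" using U(2) i unfolding flat_coordinates_def by blast+
  have "flat_chart i ?X ?Y ?G" unfolding flat_chart_def
    using fc i sG inj by (auto simp: F_def image_subset_iff)
  moreover have "x \<in> ?X" using U(1) cinv_in_cdom[OF x] cmap_cinv[OF x] by (metis IntI imageI)
  ultimately show ?thesis using that by blast
qed

context
  fixes i X Y G assumes fc: "flat_chart i X Y G"
begin

lemma fc_simps: "i \<in> charts M" "open X" "X \<subseteq> cimg i" "open Y" "F i ` X \<subseteq> Y" "G ` Y \<subseteq> X"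
  "\<And>x. x \<in> X \<Longrightarrow> G (F i x) = x" "\<And>y. y \<in> Y \<Longrightarrow> F i (G y) = y" "smooth_on (F i) X" "smooth_on G Y"
  "\<And>x u v. x \<in> X \<Longrightarrow> D2 (F i) x u v = Dd (F i) x (C i x u v)"
  "\<And>x. x \<in> X \<Longrightarrow> F i x \<in> Y" "\<And>y. y \<in> Y \<Longrightarrow> G y \<in> X"
  "\<And>x. x \<in> X \<Longrightarrow> x \<in> cimg i" "\<And>y. y \<in> Y \<Longrightarrow> G y \<in> cimg i"
  using fc unfolding flat_chart_def by blast+

lemma fc_linear_DF: "x \<in> X \<Longrightarrow> linear (Dd (F i) x)"
  by (rule smooth_on_linear_Dd[OF fc_simps(9)])

lemma fc_linear_DG: "y \<in> Y \<Longrightarrow> linear (Dd G y)"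
  by (rule smooth_on_linear_Dd[OF fc_simps(10)])

lemma fc_DG_DF:
  assumes "x \<in> X" shows "Dd G (F i x) (Dd (F i) x u) = u"
proof -
  have "Dd (\<lambda>x. G (F i x)) x u = Dd G (F i x) (Dd (F i) x u)"
    by (rule Dd_compose[OF smooth_on_differentiable[OF fc_simps(9) assms]
        smooth_on_differentiable[OF fc_simps(10) fc_simps(12)[OF assms]]])
  moreover have "Dd (\<lambda>x. G (F i x)) x = Dd (\<lambda>x. x) x"
    by (rule Dd_cong_open[OF fc_simps(2) assms fc_simps(7)])
  ultimately show ?thesis by (simp add: frechet_derivative_ident)
qed

lemma fc_DF_DG:
  assumes "y \<in> Y" shows "Dd (F i) (G y) (Dd G y u) = u"
proof -
  have "Dd (\<lambda>y. F i (G y)) y u = Dd (F i) (G y) (Dd G y u)"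
    by (rule Dd_compose[OF smooth_on_differentiable[OF fc_simps(10) assms]
        smooth_on_differentiable[OF fc_simps(9) fc_simps(13)[OF assms]]])
  moreover have "Dd (\<lambda>y. F i (G y)) y = Dd (\<lambda>x. x) y"
    by (rule Dd_cong_open[OF fc_simps(4) assms fc_simps(8)])
  ultimately show ?thesis by (simp add: frechet_derivative_ident)
qed

text \<open>Differentiate \<open>F i (G y) = y\<close> twice and cancel the injective differential
  of \<open>F i\<close>: the Christoffel symbols reappear as second derivatives of the inverse
  coordinates.\<close>

lemma fc_D2G:
  assumes "y \<in> Y" shows "D2 G y u v = - C i (G y) (Dd G y u) (Dd G y v)"
proof -
  have Gy: "G y \<in> X" using fc_simps(13)[OF assms] .
  have "D2 (\<lambda>y. F i (G y)) y u v = D2 (F i) (G y) (Dd G y u) (Dd G y v) + Dd (F i) (G y) (D2 G y u v)"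
    by (rule D2_compose[OF fc_simps(4,2,9,10,6) assms])
  moreover have "D2 (\<lambda>y. F i (G y)) y u v = D2 (\<lambda>y. y) y u v"
    by (rule fun_cong[OF fun_cong[OF D2_cong_open[OF fc_simps(4) assms fc_simps(8)]]])
  moreover have "D2 (\<lambda>y. y) y u v = 0"
    by (simp add: D2_def frechet_derivative_ident frechet_derivative_const)
  ultimately have "Dd (F i) (G y) (C i (G y) (Dd G y u) (Dd G y v) + D2 G y u v) = 0"
    using Gy by (simp add: fc_simps(11) linear_add[OF fc_linear_DF])
  then have "Dd G (F i (G y)) (Dd (F i) (G y) (C i (G y) (Dd G y u) (Dd G y v) + D2 G y u v)) = 0"
    by (simp add: linear_0[OF fc_linear_DG] fc_simps(8)[OF assms] assms)
  then have "C i (G y) (Dd G y u) (Dd G y v) + D2 G y u v = 0"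
    unfolding fc_DG_DF[OF Gy] .
  then show ?thesis by (simp add: eq_neg_iff_add_eq_0 add.commute)
qed

text \<open>The right-hand side is the covariant derivative of \<open>T\<close>: in flat coordinates
  covariant differentiation is ordinary differentiation of components.\<close>

lemma fc_Dd_form2:
  fixes T :: "'e \<Rightarrow> 'e \<Rightarrow> 'e \<Rightarrow> real"
  assumes y: "y \<in> Y" and T: "\<And>x. x \<in> cimg i \<Longrightarrow> bilinear (T x)" "\<And>s t. smooth_on (\<lambda>x. T x s t) (cimg i)"
  shows "Dd (\<lambda>y. T (G y) (Dd G y s) (Dd G y t)) y r =
    Dd (\<lambda>x. T x (Dd G y s) (Dd G y t)) (G y) (Dd G y r)
      - T (G y) (C i (G y) (Dd G y r) (Dd G y s)) (Dd G y t)
      - T (G y) (Dd G y s) (C i (G y) (Dd G y r) (Dd G y t))"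
proof -
  have "G ` Y \<subseteq> cimg i" using fc_simps(3,6) by blast
  from Dd_pullback_form2[OF fc_simps(4) open_cimg[OF fc_simps(1)] fc_simps(10) this y T]
  show ?thesis
    by (simp add: fc_D2G[OF y] bilinear_lneg[OF T(1)[OF fc_simps(15)[OF y]]] bilinear_rneg[OF T(1)[OF fc_simps(15)[OF y]]])
qed

lemma fc_om_constant:
  assumes y: "y \<in> Y"
  shows "((\<lambda>y. om i (G y) (Dd G y s) (Dd G y t)) has_derivative (\<lambda>_. 0)) (at y)"
proof -
  note i = fc_simps(1)
  have GY: "G ` Y \<subseteq> cimg i" using fc_simps(3,6) by blast
  \<comment> \<open>A vanishing \<open>Dd\<close> says something about the derivative only once
    differentiability is known.\<close>
  have "smooth_on (\<lambda>y. om i (G y) (Dd G y s) (Dd G y t)) Y"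
  proof (rule smooth_on_apply[where L = "\<lambda>y. om i (G y) (Dd G y s)", OF fc_simps(4)])
    show "smooth_on (\<lambda>y. om i (G y) (Dd G y s) t) Y" for t
      by (rule smooth_on_apply[where L = "\<lambda>y s. om i (G y) s t", OF fc_simps(4)
            smooth_on_compose[OF fc_simps(4) open_cimg[OF i] smooth_om[OF i] fc_simps(10) GY]
            bilinear_linear_left[OF bilinear_om[OF i fc_simps(15)]] smooth_on_Dd[OF fc_simps(10)]])
  qed (auto intro: bilinear_linear_right[OF bilinear_om[OF i fc_simps(15)]] smooth_on_Dd[OF fc_simps(10)])
  note D = smooth_on_has_derivative[OF this y]
  have "Dd (\<lambda>y. om i (G y) (Dd G y s) (Dd G y t)) y = (\<lambda>_. 0)"
    using fc_Dd_form2[OF y bilinear_om[OF i] smooth_om[OF i]]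
    by (simp add: om_parallel[OF i fc_simps(15)[OF y]] fun_eq_iff)
  then show ?thesis using D by simp
qed

end

section \<open>The differential of the developing map and its inverse\<close>

lemma smooth_F: "i \<in> charts M \<Longrightarrow> smooth_on (F i) (cimg i)"
proof (rule smooth_on_local)
  fix x assume i: "i \<in> charts M" and x: "x \<in> cimg i"
  obtain X Y G where fc: "flat_chart i X Y G" "x \<in> X" by (rule ex_flat_chart[OF i x])
  show "\<exists>U. open U \<and> x \<in> U \<and> smooth_on (F i) U" using fc(2) fc_simps(2,9)[OF fc(1)] by blast
qed

lemma D2_F:
  assumes i: "i \<in> charts M" and x: "x \<in> cimg i"
  shows "D2 (F i) x u v = Dd (F i) x (C i x u v)"
proof -
  obtain X Y G where fc: "flat_chart i X Y G" "x \<in> X" by (rule ex_flat_chart[OF i x])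
  show ?thesis by (rule fc_simps(11)[OF fc])
qed

lemma linear_DF: "i \<in> charts M \<Longrightarrow> x \<in> cimg i \<Longrightarrow> linear (Dd (F i) x)"
  by (rule smooth_on_linear_Dd[OF smooth_F])

text \<open>Inverting the differential instead of the map makes this available on the whole chart
  and independent of a choice of local inverse; \<open>fc_DG_eq\<close> links it to the derivative
  of any such inverse.\<close>

definition DFinv :: "'i \<Rightarrow> 'e \<Rightarrow> 'e \<Rightarrow> 'e" where "DFinv i x = inv_into UNIV (Dd (F i) x)"

lemma bij_DF:
  assumes i: "i \<in> charts M" and x: "x \<in> cimg i"
  shows "bij (Dd (F i) x)"
proof -
  obtain X Y G where fc: "flat_chart i X Y G" "x \<in> X" by (rule ex_flat_chart[OF i x])
  show ?thesis
    by (rule o_bij[of "Dd G (F i x)"])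
      (use fc_DG_DF[OF fc] fc_DF_DG[OF fc(1) fc_simps(12)[OF fc]] fc_simps(7)[OF fc] in \<open>auto simp: fun_eq_iff\<close>)
qed

lemma DF_DFinv [simp]: "i \<in> charts M \<Longrightarrow> x \<in> cimg i \<Longrightarrow> Dd (F i) x (DFinv i x t) = t"
  unfolding DFinv_def by (simp add: bij_DF bij_is_surj surj_f_inv_f)

lemma DFinv_DF [simp]: "i \<in> charts M \<Longrightarrow> x \<in> cimg i \<Longrightarrow> DFinv i x (Dd (F i) x u) = u"
  unfolding DFinv_def by (simp add: bij_DF bij_is_inj)

lemma linear_DFinv: "i \<in> charts M \<Longrightarrow> x \<in> cimg i \<Longrightarrow> linear (DFinv i x)"
  unfolding DFinv_def using linear_DF bij_DF by (metis bij_def inj_linear_imp_inv_linear)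

lemma fc_DG_eq: "flat_chart i X Y G \<Longrightarrow> y \<in> Y \<Longrightarrow> Dd G y t = DFinv i (G y) t"
  using DFinv_DF fc_DF_DG fc_simps(1,15) by metis

lemma smooth_DFinv: "i \<in> charts M \<Longrightarrow> smooth_on (\<lambda>x. DFinv i x t) (cimg i)"
proof (rule smooth_on_local)
  fix x assume i: "i \<in> charts M" and x: "x \<in> cimg i"
  obtain X Y G where fc: "flat_chart i X Y G" "x \<in> X" by (rule ex_flat_chart[OF i x])
  have "smooth_on (\<lambda>x. Dd G (F i x) t) X"
    by (rule smooth_on_compose[OF fc_simps(2,4)[OF fc(1)] smooth_on_Dd[OF fc_simps(10)[OF fc(1)]] fc_simps(9,5)[OF fc(1)]])
  then have "smooth_on (\<lambda>x. DFinv i x t) X"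
    by (rule smooth_on_cong[OF fc_simps(2)[OF fc(1)], rotated])
      (simp add: fc_DG_eq[OF fc(1)] fc_simps(7,12)[OF fc(1)])
  then show "\<exists>U. open U \<and> x \<in> U \<and> smooth_on (\<lambda>x. DFinv i x t) U"
    using fc fc_simps(2) by blast
qed

text \<open>Differentiating dev(a m) = L(dev m) + b: in the trivialization by the differential of
  \<open>dev\<close>, the differential of \<open>a\<close> is the fixed linear map \<open>L\<close>.
  With \<open>a\<close> and \<open>L\<close> the identities this compares two charts.\<close>

lemma dev_related:
  assumes a: "smooth_map M M a" and L: "linear L" "\<And>m. m \<in> points M \<Longrightarrow> dev (a m) = L (dev m) + b"
    and i: "i \<in> charts M" "p \<in> cdom M i" and j: "j \<in> charts M" "a p \<in> cdom M j"
  shows "Dd (F j) (cmap M j (a p)) (Dd (local_rep M i M j a) (cmap M i p) u) = L (Dd (F i) (cmap M i p) u)"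
proof -
  let ?S = "cmap M i ` {p \<in> cdom M i. a p \<in> cdom M j}"
  have S: "open ?S" "smooth_on (local_rep M i M j a) ?S" "cmap M i p \<in> ?S"
    using a i j unfolding smooth_map_def by blast+
  have eq: "F j (local_rep M i M j a x) = L (F i x) + b" if "x \<in> ?S" for x
    using that i j L(2) cdom_points[OF i(1)] by (auto simp: F_def local_rep_def)
  have lp: "local_rep M i M j a (cmap M i p) = cmap M j (a p)" using i by (simp add: local_rep_def)
  have "Dd (\<lambda>x. F j (local_rep M i M j a x)) (cmap M i p) u =
      Dd (F j) (local_rep M i M j a (cmap M i p)) (Dd (local_rep M i M j a) (cmap M i p) u)"
    using j by (intro Dd_compose smooth_on_differentiable[OF S(2,3)] smooth_on_differentiable[OF smooth_F]) (auto simp: lp)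
  moreover have "Dd (\<lambda>x. F j (local_rep M i M j a x)) (cmap M i p) = Dd (\<lambda>x. L (F i x) + b) (cmap M i p)"
    by (rule Dd_cong_open[OF S(1,3) eq])
  moreover have "((\<lambda>x. L (F i x) + b) has_derivative (\<lambda>u. L (Dd (F i) (cmap M i p) u))) (at (cmap M i p))"
    using bounded_linear.has_derivative[OF linear_imp_bounded_linear[OF L(1)] smooth_on_has_derivative[OF smooth_F]] i
    by (auto intro!: has_derivative_add_const)
  ultimately show ?thesis unfolding lp by (simp add: Dd_eqI)
qed

text \<open>The principle by which parallel objects become constants; it yields the coefficients of
  \<open>Bf\<close>, and the linear and translation parts of affine functions.\<close>

lemma flat_chart_constant:
  fixes c :: "'i \<Rightarrow> 'e \<Rightarrow> 'z::real_normed_vector"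
  assumes compat: "\<And>i j p. i \<in> charts M \<Longrightarrow> j \<in> charts M \<Longrightarrow> p \<in> cdom M i \<Longrightarrow> p \<in> cdom M j \<Longrightarrow>
      c i (cmap M i p) = c j (cmap M j p)"
    and der: "\<And>i X Y G y. flat_chart i X Y G \<Longrightarrow> y \<in> Y \<Longrightarrow> ((\<lambda>y. c i (G y)) has_derivative (\<lambda>_. 0)) (at y)"
    and ij: "i \<in> charts M" "x \<in> cimg i" "j \<in> charts M" "y \<in> cimg j"
  shows "c i x = c j y"
proof -
  \<comment> \<open>Glues the family to a function on points; by \<open>compat\<close> the value
    does not depend on the chart chosen.\<close>
  define c' where "c' m = (let i = (SOME i. i \<in> charts M \<and> m \<in> cdom M i) in c i (cmap M i m))" for m
  have c': "c' m = c i (cmap M i m)" if "i \<in> charts M" "m \<in> cdom M i" for i m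
  proof -
    have "(SOME i. i \<in> charts M \<and> m \<in> cdom M i) \<in> charts M \<and> m \<in> cdom M (SOME i. i \<in> charts M \<and> m \<in> cdom M i)"
      by (rule someI[of "\<lambda>i. i \<in> charts M \<and> m \<in> cdom M i" i]) (use that in blast)
    then show ?thesis unfolding c'_def Let_def using compat that by blast
  qed
  obtain m0 where m0: "m0 \<in> points M" using nonempty by blast
  have loc: "\<exists>X. open X \<and> cmap M i p \<in> X \<and> X \<subseteq> cimg i \<and> (\<forall>x\<in>X. c' (cinv M i x) = c' p)"
    if i: "i \<in> charts M" and p: "p \<in> cdom M i" for i p
  proof -
    have x: "cmap M i p \<in> cimg i" using p by blast
    obtain X Y G where fc: "flat_chart i X Y G" "cmap M i p \<in> X" by (rule ex_flat_chart[OF i x])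
    let ?y = "F i (cmap M i p)"
    have "\<exists>r>0. ball ?y r \<subseteq> Y \<and> (\<forall>z\<in>ball ?y r. c i (G z) = c i (G ?y))"
      using zero_derivative_locally_constant[where f = "\<lambda>y. c i (G y)",
          OF fc_simps(4)[OF fc(1)] fc_simps(12)[OF fc] der[OF fc(1)]] by metis
    then obtain r where r: "r > 0" "ball ?y r \<subseteq> Y" "\<forall>z\<in>ball ?y r. c i (G z) = c i (G ?y)" by blast
    let ?X = "X \<inter> F i -` ball ?y r"
    have "open ?X"
      by (rule continuous_open_preimage[OF smooth_on_continuous_on[OF fc_simps(9)[OF fc(1)]] fc_simps(2)[OF fc(1)] open_ball])
    moreover have "cmap M i p \<in> ?X" using fc(2) r(1) by simp
    moreover have "?X \<subseteq> cimg i" using fc_simps(3)[OF fc(1)] by blast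
    moreover have "c' (cinv M i x) = c' p" if x: "x \<in> ?X" for x
    proof -
      have "x \<in> cimg i" "x \<in> X" using x fc_simps(14)[OF fc(1)] by auto
      then have "c' (cinv M i x) = c i (G (F i x))"
        using c'[OF i cinv_in_cdom[of x i]] fc_simps(7)[OF fc(1)] cmap_cinv[of x i] by simp
      also have "\<dots> = c i (G ?y)" using r(3) x by blast
      also have "\<dots> = c' p" using c'[OF i p] fc_simps(7)[OF fc] by simp
      finally show ?thesis .
    qed
    ultimately show ?thesis by blast
  qed
  have *: "c i x = c' m0" if i: "i \<in> charts M" and x: "x \<in> cimg i" for i x
  proof -
    have "c i x = c' (cinv M i x)" using c'[OF i cinv_in_cdom[OF x]] cmap_cinv[OF x] by simp
    also have "\<dots> = c' m0"
      by (rule locally_constant_imp_constant[OF connected loc cdom_points[OF i cinv_in_cdom[OF x]] m0])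
    finally show ?thesis .
  qed
  show ?thesis using *[OF ij(1,2)] *[OF ij(3,4)] by simp
qed

section \<open>The parallel form as a constant bilinear form\<close>

lemma om_maps:
  assumes "maps_endo M J M J a" "maps_form2 M g M g a"
    and "i \<in> charts M" "p \<in> cdom M i" "j \<in> charts M" "a p \<in> cdom M j"
  shows "om j (cmap M j (a p)) (Dd (local_rep M i M j a) (cmap M i p) u) (Dd (local_rep M i M j a) (cmap M i p) v)
    = om i (cmap M i p) u v"
  using assms unfolding maps_endo_def maps_form2_def Let_def om_eq by simp

lemma maps_endo_id: "maps_endo M J M J id" and maps_form2_id: "maps_form2 M g M g id"
  and maps_connection_id: "maps_connection M C M C id"
  using J_endo g_form2 affine by (simp_all add: endo_field_def form2_field_def affine_connection_def)

lemma DFinv_transition: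
  assumes "i \<in> charts M" "p \<in> cdom M i" "j \<in> charts M" "p \<in> cdom M j"
  shows "DFinv j (cmap M j p) t = Dd (local_rep M i M j id) (cmap M i p) (DFinv i (cmap M i p) t)"
proof -
  have "Dd (F j) (cmap M j p) (Dd (local_rep M i M j id) (cmap M i p) (DFinv i (cmap M i p) t)) = t"
    using dev_related[OF smooth_map_id linear_ident, of 0 i p j] assms by simp
  then show ?thesis using DFinv_DF assms by (metis imageI)
qed

lemma some_chart: obtains i x where "i \<in> charts M" "x \<in> cimg i"
proof -
  obtain p where "p \<in> points M" using nonempty by blast
  then obtain i where "i \<in> charts M" "p \<in> cdom M i" using points_eq by blast
  then show thesis using that by blast
qed

text \<open>The coefficients of \<open>om\<close> in the frame given by \<open>DFinv\<close> have
  zero derivative in flat coordinates because \<open>om\<close> is parallel, so their value at one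
  point defines \<open>B\<close> everywhere.\<close>

lemma om_flat_constant:
  obtains B where "bilinear B"
    "\<And>i x u v. i \<in> charts M \<Longrightarrow> x \<in> cimg i \<Longrightarrow> B (Dd (F i) x u) (Dd (F i) x v) = om i x u v"
proof -
  have const: "om i x (DFinv i x s) (DFinv i x t) = om j y (DFinv j y s) (DFinv j y t)"
    if ij: "i \<in> charts M" "x \<in> cimg i" "j \<in> charts M" "y \<in> cimg j" for i x j y s t
  proof (rule flat_chart_constant[where c = "\<lambda>i x. om i x (DFinv i x s) (DFinv i x t)"])
    fix i j p assume ij: "i \<in> charts M" "j \<in> charts M" "p \<in> cdom M i" "p \<in> cdom M j"
    show "om i (cmap M i p) (DFinv i (cmap M i p) s) (DFinv i (cmap M i p) t) =
        om j (cmap M j p) (DFinv j (cmap M j p) s) (DFinv j (cmap M j p) t)"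
      using om_maps[OF maps_endo_id maps_form2_id ij(1,3,2)] ij
      by (simp add: DFinv_transition[OF ij(1,3,2,4)])
  next
    fix i X Y G y assume fc: "flat_chart i X Y G" and y: "y \<in> Y"
    show "((\<lambda>y. om i (G y) (DFinv i (G y) s) (DFinv i (G y) t)) has_derivative (\<lambda>_. 0)) (at y)"
      using fc_om_constant[OF fc y, of s t]
      by (subst has_derivative_cong_open[OF fc_simps(4)[OF fc] y, of _ "\<lambda>y. om i (G y) (Dd G y s) (Dd G y t)"])
        (simp_all add: fc_DG_eq[OF fc])
  qed (rule ij)+
  obtain i x where ix: "i \<in> charts M" "x \<in> cimg i" by (rule some_chart)
  define B where "B s t = om i x (DFinv i x s) (DFinv i x t)" for s t
  have B: "om j y (DFinv j y s) (DFinv j y t) = B s t" if jy: "j \<in> charts M" "y \<in> cimg j" for j y s t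
    unfolding B_def by (rule const[OF jy ix])
  have "bilinear B"
    unfolding bilinear_def B_def
    using linear_compose[OF linear_DFinv[OF ix] bilinear_linear_left[OF bilinear_om[OF ix]]]
      linear_compose[OF linear_DFinv[OF ix] bilinear_linear_right[OF bilinear_om[OF ix]]]
    by (simp add: o_def)
  moreover have "B (Dd (F i) x u) (Dd (F i) x v) = om i x u v" if "i \<in> charts M" "x \<in> cimg i" for i x u v
    using B[OF that, symmetric] that by simp
  ultimately show ?thesis by (rule that)
qed

definition Bf :: "'e \<Rightarrow> 'e \<Rightarrow> real" where "Bf = flat_omega M dev om"

text \<open>Resolves the definite description in \<open>flat_omega\<close>. Uniqueness needs a
  single point, since the differential of \<open>dev\<close> there is onto.\<close>

lemma Bf: "bilinear Bf" "i \<in> charts M \<Longrightarrow> x \<in> cimg i \<Longrightarrow> Bf (Dd (F i) x u) (Dd (F i) x v) = om i x u v"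
proof -
  let ?P = "\<lambda>B. bilinear B \<and> (\<forall>i\<in>charts M. \<forall>m\<in>cdom M i. let D = Dd (dev \<circ> cinv M i) (cmap M i m) in
        \<forall>u v. B (D u) (D v) = om i (cmap M i m) u v)"
  obtain B where B: "bilinear B"
    "\<And>i x u v. i \<in> charts M \<Longrightarrow> x \<in> cimg i \<Longrightarrow> B (Dd (F i) x u) (Dd (F i) x v) = om i x u v"
    by (rule om_flat_constant, rule that; (assumption | blast))
  obtain i0 x0 where ix: "i0 \<in> charts M" "x0 \<in> cimg i0" by (rule some_chart)
  then obtain p where i0: "i0 \<in> charts M" "p \<in> cdom M i0" "x0 = cmap M i0 p" by blast
  have P: "?P B" using B by (auto simp: F_def[symmetric])
  have "Bf = B" unfolding Bf_def flat_omega_def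
  proof (rule the_equality[where P = ?P, OF P])
    fix B' assume B': "?P B'"
    have "B' (Dd (F i0) (cmap M i0 p) u) (Dd (F i0) (cmap M i0 p) v) = om i0 (cmap M i0 p) u v" for u v
      using B' i0 by (auto simp: F_def[symmetric] Let_def)
    then have "B' (Dd (F i0) x0 u) (Dd (F i0) x0 v) = B (Dd (F i0) x0 u) (Dd (F i0) x0 v)" for u v
      using B(2)[OF ix] i0(3) by simp
    from this[of "DFinv i0 x0 _" "DFinv i0 x0 _"] have "B' s t = B s t" for s t
      using ix by simp
    then show "B' = B" by blast
  qed
  then show "bilinear Bf" "i \<in> charts M \<Longrightarrow> x \<in> cimg i \<Longrightarrow> Bf (Dd (F i) x u) (Dd (F i) x v) = om i x u v"
    using B by auto
qed

lemma Bf_eq: "i \<in> charts M \<Longrightarrow> x \<in> cimg i \<Longrightarrow> Bf s t = om i x (DFinv i x s) (DFinv i x t)"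
  using Bf(2)[of i x "DFinv i x s" "DFinv i x t"] by simp

lemma Bf_alt: "Bf s t = - Bf t s"
proof -
  obtain i x where ix: "i \<in> charts M" "x \<in> cimg i" by (rule some_chart)
  show ?thesis unfolding Bf_eq[OF ix] by (rule om_alt[OF ix])
qed

sublocale Bf: nondegenerate_form Bf
proof
  show "bilinear Bf" by (rule Bf)
  obtain i x where ix: "i \<in> charts M" "x \<in> cimg i" by (rule some_chart)
  interpret n: nondegenerate_form "om i x" by (rule nondegenerate_om[OF ix])
  fix u assume u: "\<And>v. Bf u v = 0"
  have "DFinv i x u = 0"
  proof (rule n.nondeg)
    fix v show "om i x (DFinv i x u) v = 0" using u[of "Dd (F i) x v"] ix by (simp add: Bf_eq[OF ix])
  qed
  then show "u = 0" using DF_DFinv[OF ix, of u] linear_0[OF linear_DF[OF ix]] by simp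
qed

text \<open>The hypothesis \<open>aff\<close> says that the second covariant derivative of the
  function vanishes. Its differential, composed with the inverse differential of \<open>dev\<close>,
  is then a constant \<open>L\<close>, and what remains after subtracting \<open>L\<close> after
  \<open>dev\<close> is a constant \<open>b\<close>.\<close>

lemma affine_function_factor:
  fixes \<phi> :: "'a \<Rightarrow> 'e"
  assumes sm: "\<And>i. i \<in> charts M \<Longrightarrow> smooth_on (\<phi> \<circ> cinv M i) (cimg i)"
    and aff: "\<And>i x u v. i \<in> charts M \<Longrightarrow> x \<in> cimg i \<Longrightarrow>
      D2 (\<phi> \<circ> cinv M i) x u v = Dd (\<phi> \<circ> cinv M i) x (C i x u v)"
  obtains L b where "linear L" "\<And>m. m \<in> points M \<Longrightarrow> \<phi> m = L (dev m) + b"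
    "\<And>i x u. i \<in> charts M \<Longrightarrow> x \<in> cimg i \<Longrightarrow> L (Dd (F i) x u) = Dd (\<phi> \<circ> cinv M i) x u"
proof -
  have lin: "linear (Dd (\<phi> \<circ> cinv M i) x)" if "i \<in> charts M" "x \<in> cimg i" for i x
    by (rule smooth_on_linear_Dd[OF sm[OF that(1)] that(2)])
  have const: "Dd (\<phi> \<circ> cinv M i) x (DFinv i x s) = Dd (\<phi> \<circ> cinv M j) y (DFinv j y s)"
    if ij: "i \<in> charts M" "x \<in> cimg i" "j \<in> charts M" "y \<in> cimg j" for i x j y s
  proof (rule flat_chart_constant[where c = "\<lambda>i x. Dd (\<phi> \<circ> cinv M i) x (DFinv i x s)"])
    fix i j p assume ij: "i \<in> charts M" "j \<in> charts M" "p \<in> cdom M i" "p \<in> cdom M j"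
    let ?S = "cmap M i ` {p \<in> cdom M i. id p \<in> cdom M j}"
    have S: "open ?S" "smooth_on (local_rep M i M j id) ?S" "cmap M i p \<in> ?S"
      using smooth_map_id ij unfolding smooth_map_def by (auto simp del: id_apply) simp
    have l: "local_rep M i M j id (cmap M i p) = cmap M j p" using ij by (simp add: local_rep_def)
    have "Dd (\<phi> \<circ> cinv M i) (cmap M i p) = Dd (\<lambda>x. (\<phi> \<circ> cinv M j) (local_rep M i M j id x)) (cmap M i p)"
      by (rule Dd_cong_open[OF S(1,3)]) (use ij in \<open>auto simp: local_rep_def\<close>)
    moreover have "Dd (\<lambda>x. (\<phi> \<circ> cinv M j) (local_rep M i M j id x)) (cmap M i p) u =
        Dd (\<phi> \<circ> cinv M j) (cmap M j p) (Dd (local_rep M i M j id) (cmap M i p) u)" for u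
      using Dd_compose[OF smooth_on_differentiable[OF S(2,3)], of "\<phi> \<circ> cinv M j", unfolded l]
        smooth_on_differentiable[OF sm[OF ij(2)]] ij by blast
    ultimately show "Dd (\<phi> \<circ> cinv M i) (cmap M i p) (DFinv i (cmap M i p) s) =
        Dd (\<phi> \<circ> cinv M j) (cmap M j p) (DFinv j (cmap M j p) s)"
      by (simp add: DFinv_transition[OF ij(1,3,2,4)])
  next
    fix i X Y G y assume fc: "flat_chart i X Y G" and y: "y \<in> Y"
    note i = fc_simps(1)[OF fc] and s4 = fc_simps(4)[OF fc] and s10 = fc_simps(10)[OF fc]
    have GY: "G ` Y \<subseteq> cimg i" using fc_simps(15)[OF fc] by blast
    have Gy: "G y \<in> cimg i" by (rule fc_simps(15)[OF fc y])
    have sm': "smooth_on (\<lambda>y. Dd (\<phi> \<circ> cinv M i) (G y) (Dd G y s)) Y"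
      by (rule smooth_on_apply[where L = "\<lambda>y. Dd (\<phi> \<circ> cinv M i) (G y)", OF s4
            smooth_on_compose[OF s4 open_cimg[OF i] smooth_on_Dd[OF sm[OF i]] s10 GY]
            lin[OF i fc_simps(15)[OF fc]] smooth_on_Dd[OF s10]])
    \<comment> \<open>The second derivative of the function and the Christoffel term from
      \<open>fc_D2G\<close> cancel by \<open>aff\<close>.\<close>
    have "Dd (\<lambda>y. Dd (\<phi> \<circ> cinv M i) (G y) (Dd G y s)) y r = 0" for r
      using Dd_pullback_endo[OF s4 open_cimg[OF i] s10 GY y lin[OF i] smooth_on_Dd[OF sm[OF i]], of s r]
        aff[OF i Gy, of "Dd G y r" "Dd G y s", unfolded D2_def]
      by (simp add: fc_D2G[OF fc y] linear_neg[OF lin[OF i Gy]])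
    then have "Dd (\<lambda>y. Dd (\<phi> \<circ> cinv M i) (G y) (Dd G y s)) y = (\<lambda>_. 0)" by blast
    then have "((\<lambda>y. Dd (\<phi> \<circ> cinv M i) (G y) (Dd G y s)) has_derivative (\<lambda>_. 0)) (at y)"
      using smooth_on_has_derivative[OF sm' y] by simp
    then show "((\<lambda>y. Dd (\<phi> \<circ> cinv M i) (G y) (DFinv i (G y) s)) has_derivative (\<lambda>_. 0)) (at y)"
      by (subst has_derivative_cong_open[OF s4 y, of _ "\<lambda>y. Dd (\<phi> \<circ> cinv M i) (G y) (Dd G y s)"])
        (simp_all add: fc_DG_eq[OF fc])
  qed (rule ij)+
  obtain i0 x0 where i0: "i0 \<in> charts M" "x0 \<in> cimg i0" by (rule some_chart)
  define L where "L s = Dd (\<phi> \<circ> cinv M i0) x0 (DFinv i0 x0 s)" for s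
  have L: "Dd (\<phi> \<circ> cinv M i) x (DFinv i x s) = L s" if ix: "i \<in> charts M" "x \<in> cimg i" for s i x
    unfolding L_def by (rule const[OF ix i0])
  have LD: "L (Dd (F i) x u) = Dd (\<phi> \<circ> cinv M i) x u" if "i \<in> charts M" "x \<in> cimg i" for i x u
    using L[OF that, symmetric] that by simp
  have linL: "linear L"
    unfolding L_def using linear_compose[OF linear_DFinv[OF i0] lin[OF i0]] by (simp add: o_def)
  have b: "\<phi> (cinv M i x) - L (F i x) = \<phi> (cinv M j y) - L (F j y)"
    if ij: "i \<in> charts M" "x \<in> cimg i" "j \<in> charts M" "y \<in> cimg j" for i x j y
  proof (rule flat_chart_constant[where c = "\<lambda>i x. \<phi> (cinv M i x) - L (F i x)"])
    fix i j p assume ij: "i \<in> charts M" "j \<in> charts M" "p \<in> cdom M i" "p \<in> cdom M j"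
    then show "\<phi> (cinv M i (cmap M i p)) - L (F i (cmap M i p)) = \<phi> (cinv M j (cmap M j p)) - L (F j (cmap M j p))"
      by (simp add: F_def)
  next
    fix i X Y G y assume fc: "flat_chart i X Y G" and y: "y \<in> Y"
    note i = fc_simps(1)[OF fc]
    have Gy: "G y \<in> cimg i" by (rule fc_simps(15)[OF fc y])
    have "((\<lambda>y. (\<phi> \<circ> cinv M i) (G y) - L (F i (G y))) has_derivative
        (\<lambda>r. Dd (\<phi> \<circ> cinv M i) (G y) (Dd G y r) - L (Dd (F i) (G y) (Dd G y r)))) (at y)"
      by (intro has_derivative_diff has_derivative_compose[OF smooth_on_has_derivative[OF fc_simps(10)[OF fc] y]]
          smooth_on_has_derivative[OF sm[OF i] Gy]
          bounded_linear.has_derivative[OF linear_imp_bounded_linear[OF linL] smooth_on_has_derivative[OF smooth_F[OF i] Gy]])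
    then show "((\<lambda>y. \<phi> (cinv M i (G y)) - L (F i (G y))) has_derivative (\<lambda>_. 0)) (at y)"
      by (simp add: LD[OF i Gy])
  qed (rule ij)+
  have "\<phi> m = L (dev m) + (\<phi> (cinv M i0 x0) - L (F i0 x0))" if m: "m \<in> points M" for m
  proof -
    obtain i where i: "i \<in> charts M" "m \<in> cdom M i" by (rule obtain_chart[OF m])
    then show ?thesis using b[OF i(1) _ i0, of "cmap M i m"] by (simp add: F_def algebra_simps)
  qed
  with linL show ?thesis using LD by (rule that)
qed

text \<open>Both \<open>dev\<close> and \<open>a\<close> are affine, hence so is the composite; the
  preceding factorization applies to it.\<close>

lemma developing_affine_factor:
  assumes a: "smooth_map M M a" and C: "maps_connection M C M C a"
  obtains L b where "linear L" "\<And>m. m \<in> points M \<Longrightarrow> dev (a m) = L (dev m) + b"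
proof -
  have key: "\<exists>S. open S \<and> x \<in> S \<and> smooth_on ((\<lambda>m. dev (a m)) \<circ> cinv M i) S \<and>
      D2 ((\<lambda>m. dev (a m)) \<circ> cinv M i) x u v = Dd ((\<lambda>m. dev (a m)) \<circ> cinv M i) x (C i x u v)"
    if i: "i \<in> charts M" and x: "x \<in> cimg i" for i x u v
  proof -
    obtain p where p: "p \<in> cdom M i" "x = cmap M i p" using x by blast
    obtain j where j: "j \<in> charts M" "a p \<in> cdom M j"
      using obtain_chart[OF smooth_map_points[OF a cdom_points[OF i p(1)]]] by blast
    let ?S = "cmap M i ` {p \<in> cdom M i. a p \<in> cdom M j}" and ?R = "local_rep M i M j a"
    have S: "open ?S" "smooth_on ?R ?S" "x \<in> ?S"
      using a i j p unfolding smooth_map_def by blast+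
    have RS: "?R ` ?S \<subseteq> cimg j" using i by (auto simp: local_rep_def)
    have l: "?R x = cmap M j (a p)" using i p by (simp add: local_rep_def)
    have eq: "F j (?R x) = ((\<lambda>m. dev (a m)) \<circ> cinv M i) x" if "x \<in> ?S" for x
      using that i j by (auto simp: F_def local_rep_def)
    have "smooth_on ((\<lambda>m. dev (a m)) \<circ> cinv M i) ?S"
      by (rule smooth_on_cong[OF S(1) eq smooth_on_compose[OF S(1) open_cimg[OF j(1)] smooth_F[OF j(1)] S(2) RS]])
    moreover have "D2 ((\<lambda>m. dev (a m)) \<circ> cinv M i) x u v = Dd ((\<lambda>m. dev (a m)) \<circ> cinv M i) x (C i x u v)"
    proof -
      have lj: "?R x \<in> cimg j" using S(3) RS by blast
      have d: "Dd ((\<lambda>m. dev (a m)) \<circ> cinv M i) x w = Dd (F j) (?R x) (Dd ?R x w)" for w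
      proof -
        have "Dd ((\<lambda>m. dev (a m)) \<circ> cinv M i) x = Dd (\<lambda>x. F j (?R x)) x"
          by (rule Dd_cong_open[OF S(1,3) eq[symmetric]])
        then show ?thesis
          using Dd_compose[OF smooth_on_differentiable[OF S(2,3)] smooth_on_differentiable[OF smooth_F[OF j(1)] lj]] by simp
      qed
      have "D2 ((\<lambda>m. dev (a m)) \<circ> cinv M i) x = D2 (\<lambda>x. F j (?R x)) x"
        by (rule D2_cong_open[OF S(1,3) eq[symmetric]])
      then have "D2 ((\<lambda>m. dev (a m)) \<circ> cinv M i) x u v =
          D2 (F j) (?R x) (Dd ?R x u) (Dd ?R x v) + Dd (F j) (?R x) (D2 ?R x u v)"
        using D2_compose[OF S(1) open_cimg[OF j(1)] smooth_F[OF j(1)] S(2) RS S(3)] by (simp only:)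
      also have "\<dots> = Dd (F j) (?R x) (C j (?R x) (Dd ?R x u) (Dd ?R x v) + D2 ?R x u v)"
        by (simp add: D2_F[OF j(1) lj] linear_add[OF linear_DF[OF j(1) lj]])
      also have "C j (?R x) (Dd ?R x u) (Dd ?R x v) + D2 ?R x u v = Dd ?R x (C i x u v)"
        using C i j p l unfolding maps_connection_def christoffel_related_def by simp
      finally show ?thesis unfolding d .
    qed
    ultimately show ?thesis using S by blast
  qed
  have sm: "smooth_on ((\<lambda>m. dev (a m)) \<circ> cinv M i) (cimg i)" if i: "i \<in> charts M" for i
  proof (rule smooth_on_local)
    fix x assume "x \<in> cimg i"
    from key[OF i this] show "\<exists>U. open U \<and> x \<in> U \<and> smooth_on ((\<lambda>m. dev (a m)) \<circ> cinv M i) U" by blast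
  qed
  have "D2 ((\<lambda>m. dev (a m)) \<circ> cinv M i) x u v = Dd ((\<lambda>m. dev (a m)) \<circ> cinv M i) x (C i x u v)"
    if "i \<in> charts M" "x \<in> cimg i" for i x u v
    using key[OF that] by blast
  note af = this
  show ?thesis
  proof (rule affine_function_factor[OF sm af])
    fix L b assume L: "linear L" "\<And>m. m \<in> points M \<Longrightarrow> dev (a m) = L (dev m) + b"
    show ?thesis by (rule that[OF L])
  qed
qed

section \<open>Affine holomorphic isometries\<close>

definition nabla_g :: "'i \<Rightarrow> 'e \<Rightarrow> 'e \<Rightarrow> 'e \<Rightarrow> 'e \<Rightarrow> real" where
  "nabla_g i x u v w = Dd (\<lambda>y. g i y v w) x u - g i x (C i x u v) w - g i x v (C i x u w)"

text \<open>In the coordinates of the Hessian condition the covariant derivative of \<open>g\<close>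
  consists of third derivatives of the potential, whose arguments may be exchanged.\<close>

lemma nabla_g_codazzi:
  assumes i: "i \<in> charts M" and x: "x \<in> cimg i"
  shows "nabla_g i x u v w = nabla_g i x v u w"
proof -
  have p: "cinv M i x \<in> points M" using cinv_in_cdom[OF x] cdom_points[OF i] by blast
  obtain U \<xi> f where U: "cinv M i x \<in> U" "flat_coordinates M C U \<xi>" "smooth_on f (\<xi> ` U)"
    and H: "\<forall>i\<in>charts M. \<forall>p\<in>U \<inter> cdom M i. let D = Dd (\<xi> \<circ> cinv M i) (cmap M i p) in
             \<forall>u v. g i (cmap M i p) u v = D2 f (\<xi> p) (D u) (D v)"
    using hessian p unfolding hessian_metric_def by blast
  let ?X = "cmap M i ` (U \<inter> cdom M i)" and ?W = "\<xi> ` (U \<inter> cdom M i)"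
  define \<Phi> where "\<Phi> = \<xi> \<circ> cinv M i"
  note X = flat_coordinates_chart[OF U(2) i, folded \<Phi>_def]
  have xX: "x \<in> ?X" using U(1) cinv_in_cdom[OF x] cmap_cinv[OF x] by (metis IntI imageI)
  have PhiW: "\<Phi> ` ?X \<subseteq> ?W" using i by (auto simp: \<Phi>_def)
  have f: "smooth_on f ?W" by (rule smooth_on_mono[OF U(3)]) blast
  have T2: "smooth_on (\<lambda>y. D2 f y s t) ?W" for s t
    unfolding D2_def by (intro smooth_on_Dd f)
  have Tbil: "bilinear (D2 f y)" if y: "y \<in> ?W" for y
  proof -
    have "linear (\<lambda>s. D2 f y s t)" for t
      unfolding D2_def by (rule smooth_on_linear_Dd[OF smooth_on_Dd[OF f] y])
    then show ?thesis
      unfolding bilinear_def using D2_commute[OF X(2) y f] by simp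
  qed
  have gx: "g i y u v = D2 f (\<Phi> y) (Dd \<Phi> y u) (Dd \<Phi> y v)" if y: "y \<in> ?X" for y u v
  proof -
    obtain p where p: "p \<in> U \<inter> cdom M i" "y = cmap M i p" using y by blast
    then have "\<Phi> y = \<xi> p" using i by (simp add: \<Phi>_def)
    then show ?thesis using H i p unfolding Let_def \<Phi>_def by simp
  qed
  \<comment> \<open>The Christoffel terms absorb the second derivatives of the coordinate change.
    The third derivative is written as a second derivative of \<open>f\<close> differentiated along
    one frozen vector, the form to which \<open>D2_commute\<close> applies.\<close>
  have N: "nabla_g i x u v w = D2 (\<lambda>z. Dd f z (Dd \<Phi> x w)) (\<Phi> x) (Dd \<Phi> x u) (Dd \<Phi> x v)" for u v w
  proof -
    have "Dd (\<lambda>y. g i y v w) x u = Dd (\<lambda>y. D2 f (\<Phi> y) (Dd \<Phi> y v) (Dd \<Phi> y w)) x u"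
      by (rule fun_cong[OF Dd_cong_open[OF X(1) xX gx]])
    also have "\<dots> = Dd (\<lambda>y. D2 f y (Dd \<Phi> x v) (Dd \<Phi> x w)) (\<Phi> x) (Dd \<Phi> x u)
        + D2 f (\<Phi> x) (D2 \<Phi> x u v) (Dd \<Phi> x w) + D2 f (\<Phi> x) (Dd \<Phi> x v) (D2 \<Phi> x u w)"
      by (rule Dd_pullback_form2[OF X(1,2,3) PhiW xX Tbil T2])
    also have "\<dots> = Dd (\<lambda>y. D2 f y (Dd \<Phi> x v) (Dd \<Phi> x w)) (\<Phi> x) (Dd \<Phi> x u)
        + g i x (C i x u v) w + g i x v (C i x u w)"
      by (simp add: X(4)[OF xX] gx[OF xX])
    finally show ?thesis unfolding nabla_g_def by (simp add: D2_def)
  qed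
  have Px: "\<Phi> x \<in> ?W" using PhiW xX by blast
  show ?thesis unfolding N by (rule D2_commute[OF X(2) Px smooth_on_Dd[OF f]])
qed

text \<open>The complex structure in flat coordinates. The parallel form is the constant \<open>Bf\<close> there and
  \<open>g = Bf(\<cdot>, J\<cdot>)\<close>, so the total symmetry of \<open>\<nabla>g\<close> becomes the symmetry of the derivative of \<open>J\<close>. All
  integrability conditions on the cotangent bundle reduce to this symmetry.\<close>

definition Jf :: "'i \<Rightarrow> ('e \<Rightarrow> 'e) \<Rightarrow> 'e \<Rightarrow> 'e \<Rightarrow> 'e" where
  "Jf i G y s = Dd (F i) (G y) (J i (G y) (Dd G y s))"

context
  fixes i X Y G assumes fc: "flat_chart i X Y G"
begin

private lemmas i = fc_simps(1)[OF fc] and s4 = fc_simps(4)[OF fc] and s10 = fc_simps(10)[OF fc]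
  and Gy = fc_simps(15)[OF fc] and lDG = fc_linear_DG[OF fc]

lemma DG_DF: "y \<in> Y \<Longrightarrow> Dd G y (Dd (F i) (G y) u) = u"
  using fc_DG_eq[OF fc] DFinv_DF[OF i Gy] by simp

lemma DG_Jf: "y \<in> Y \<Longrightarrow> Dd G y (Jf i G y s) = J i (G y) (Dd G y s)"
  unfolding Jf_def by (rule DG_DF)

lemma linear_Jf: "y \<in> Y \<Longrightarrow> linear (Jf i G y)"
  using linear_compose[OF linear_compose[OF lDG linear_J[OF i Gy]] linear_DF[OF i Gy], of y]
  by (simp add: Jf_def[abs_def] o_def)

lemma smooth_Jf: "smooth_on (\<lambda>y. Jf i G y s) Y"
proof -
  have GY: "G ` Y \<subseteq> cimg i" using Gy by blast
  have "smooth_on (\<lambda>y. J i (G y) (Dd G y s)) Y"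
    by (rule smooth_on_apply[where L = "\<lambda>y. J i (G y)", OF s4
          smooth_on_compose[OF s4 open_cimg[OF i] smooth_J[OF i] s10 GY] linear_J[OF i Gy] smooth_on_Dd[OF s10]])
  from smooth_on_apply[where L = "\<lambda>y. Dd (F i) (G y)", OF s4
      smooth_on_compose[OF s4 open_cimg[OF i] smooth_on_Dd[OF smooth_F[OF i]] s10 GY] linear_DF[OF i Gy] this]
  show ?thesis unfolding Jf_def .
qed

lemma Jf_Jf: "y \<in> Y \<Longrightarrow> Jf i G y (Jf i G y s) = - s"
  unfolding Jf_def[of i G y "Jf i G y s"] DG_Jf
  by (simp add: JJ[OF i Gy] linear_neg[OF linear_DF[OF i Gy]] fc_DF_DG[OF fc])

lemma Bf_Jf: "y \<in> Y \<Longrightarrow> Bf s (Jf i G y t) = g i (G y) (Dd G y s) (Dd G y t)"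
  using Bf(2)[OF i Gy, of y "Dd G y s" "J i (G y) (Dd G y t)"]
  by (simp add: Jf_def fc_DF_DG[OF fc] om_J[OF i Gy])

lemma Bf_Jf_sym: "y \<in> Y \<Longrightarrow> Bf s (Jf i G y t) = Bf t (Jf i G y s)"
  by (simp add: Bf_Jf g_sym[OF i Gy])

text \<open>As \<open>Bf\<close> does not depend on the point, differentiating \<open>Bf_Jf\<close>
  lets the derivative fall on J alone.\<close>

lemma Bf_DJf:
  assumes y: "y \<in> Y"
  shows "Bf s (Dd (\<lambda>y. Jf i G y t) y r) = nabla_g i (G y) (Dd G y r) (Dd G y s) (Dd G y t)"
proof -
  have "((\<lambda>y. Bf s (Jf i G y t)) has_derivative (\<lambda>r. Bf s (Dd (\<lambda>y. Jf i G y t) y r))) (at y)"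
    by (rule bounded_linear.has_derivative[OF linear_imp_bounded_linear[OF bilinear_linear_right[OF Bf(1)]]
          smooth_on_has_derivative[OF smooth_Jf y]])
  then have "Bf s (Dd (\<lambda>y. Jf i G y t) y r) = Dd (\<lambda>y. Bf s (Jf i G y t)) y r" by (simp add: Dd_eqI)
  also have "\<dots> = Dd (\<lambda>y. g i (G y) (Dd G y s) (Dd G y t)) y r"
    by (rule fun_cong[OF Dd_cong_open[OF s4 y Bf_Jf]])
  also have "\<dots> = nabla_g i (G y) (Dd G y r) (Dd G y s) (Dd G y t)"
    unfolding nabla_g_def by (rule fc_Dd_form2[OF fc y bilinear_g[OF i] smooth_g[OF i]])
  finally show ?thesis .
qed

lemma Bf_DJf_sym12:
  assumes y: "y \<in> Y"
  shows "Bf s (Dd (\<lambda>y. Jf i G y t) y r) = Bf r (Dd (\<lambda>y. Jf i G y t) y s)"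
  unfolding Bf_DJf[OF y] by (rule nabla_g_codazzi[OF i Gy[OF y]])

lemma Bf_DJf_sym23:
  assumes y: "y \<in> Y"
  shows "Bf s (Dd (\<lambda>y. Jf i G y t) y r) = Bf t (Dd (\<lambda>y. Jf i G y s) y r)"
proof -
  have "Dd (\<lambda>y. g i y v w) (G y) = Dd (\<lambda>y. g i y w v) (G y)" for v w
    by (rule Dd_cong_open[OF open_cimg[OF i] Gy[OF y] g_sym[OF i]])
  then show ?thesis
    unfolding Bf_DJf[OF y] nabla_g_def
    using g_sym[OF i Gy[OF y], of "C i (G y) (Dd G y r) (Dd G y s)" "Dd G y t"]
      g_sym[OF i Gy[OF y], of "C i (G y) (Dd G y r) (Dd G y t)" "Dd G y s"] by simp
qed

text \<open>The exterior covariant derivative of J vanishes, the customary form of the special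
  Kaehler condition.\<close>

lemma DJf_codazzi:
  assumes y: "y \<in> Y"
  shows "Dd (\<lambda>y. Jf i G y t) y r = Dd (\<lambda>y. Jf i G y r) y t"
proof -
  \<comment> \<open>The transpositions (12), (23), (12) in turn exchange \<open>r\<close> and
    \<open>t\<close> and leave \<open>s\<close> in place.\<close>
  have "Bf s (Dd (\<lambda>y. Jf i G y t) y r) = Bf s (Dd (\<lambda>y. Jf i G y r) y t)" for s
    using Bf_DJf_sym12[OF y, of s t r] Bf_DJf_sym23[OF y, of r t s] Bf_DJf_sym12[OF y, of s r t] by simp
  then have "Bf (Dd (\<lambda>y. Jf i G y t) y r - Dd (\<lambda>y. Jf i G y r) y t) s = 0" for s
    by (subst Bf_alt) (simp add: bilinear_rsub[OF Bf(1)])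
  then show ?thesis using Bf.nondeg[of "Dd (\<lambda>y. Jf i G y t) y r - Dd (\<lambda>y. Jf i G y r) y t"] by simp
qed

end

text \<open>The image of \<open>dev\<close> contains an open set, and an affine map is determined
  there by its derivative and one value.\<close>

lemma affine_unique:
  fixes L L' :: "'e \<Rightarrow> 'e"
  assumes L: "linear L" "linear L'" and eq: "\<And>m. m \<in> points M \<Longrightarrow> L (dev m) + b = L' (dev m) + b'"
  shows "L = L'" "b = b'"
proof -
  obtain i x where ix: "i \<in> charts M" "x \<in> cimg i" by (rule some_chart)
  obtain X Y G where fc: "flat_chart i X Y G" "x \<in> X" by (rule ex_flat_chart[OF ix])
  have y: "F i x \<in> Y" by (rule fc_simps(12)[OF fc])
  have e: "L z + b = L' z + b'" if "z \<in> Y" for z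
  proof -
    have "z = dev (cinv M i (G z))" using fc_simps(8)[OF fc(1) that] by (simp add: F_def)
    moreover have "cinv M i (G z) \<in> points M"
      by (rule cdom_points[OF ix(1) cinv_in_cdom[OF fc_simps(15)[OF fc(1) that]]])
    ultimately show ?thesis using eq by metis
  qed
  have "((\<lambda>z. L z + b) has_derivative L) (at (F i x))" "((\<lambda>z. L' z + b') has_derivative L') (at (F i x))"
    using L by (auto intro!: has_derivative_add_const bounded_linear_imp_has_derivative linear_imp_bounded_linear)
  then show "L = L'"
    using Dd_cong_open[where f = "\<lambda>z. L z + b" and g = "\<lambda>z. L' z + b'", OF fc_simps(4)[OF fc(1)] y e]
    by (simp add: Dd_eqI)
  then show "b = b'" using e[OF y] by simp
qed

lemma theta_eq:
  assumes "linear L" "\<And>m. m \<in> points M \<Longrightarrow> dev (a m) = L (dev m) + b"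
  shows "theta M dev a = (\<lambda>x. L x + b)"
  unfolding theta_def
proof (rule the_equality)
  show "(\<exists>L' b'. linear L' \<and> (\<lambda>x. L x + b) = (\<lambda>x. L' x + b')) \<and> (\<forall>m\<in>points M. dev (a m) = L (dev m) + b)"
    using assms by blast
  fix f assume f: "(\<exists>L b. linear L \<and> f = (\<lambda>x. L x + b)) \<and> (\<forall>m\<in>points M. dev (a m) = f (dev m))"
  then obtain L' b' where L': "linear L'" "f = (\<lambda>x. L' x + b')" by blast
  have "L (dev m) + b = L' (dev m) + b'" if "m \<in> points M" for m
    using f L' assms(2)[OF that] that by simp
  from affine_unique[OF assms(1) L'(1) this] show "f = (\<lambda>x. L x + b)" using L'(2) by simp
qed

abbreviation "isom \<equiv> affine_holomorphic_isometry M J g C"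

lemma iso_smooth: "isom a \<Longrightarrow> smooth_map M M a"
  by (simp add: affine_holomorphic_isometry_def diffeomorphism_def)

lemma iso_theta:
  assumes a: "isom a"
  obtains L b where "linear L" "theta M dev a = (\<lambda>x. L x + b)" "\<And>m. m \<in> points M \<Longrightarrow> dev (a m) = L (dev m) + b"
    "\<And>s t. Bf (L s) (L t) = Bf s t"
proof -
  have aa: "smooth_map M M a" "maps_connection M C M C a" "maps_endo M J M J a" "maps_form2 M g M g a"
    using a by (simp_all add: affine_holomorphic_isometry_def diffeomorphism_def)
  show ?thesis
  proof (rule developing_affine_factor[OF aa(1,2)])
    fix L b assume L: "linear L" "\<And>m. m \<in> points M \<Longrightarrow> dev (a m) = L (dev m) + b"
    \<comment> \<open>The isometry preserves \<open>om\<close>, which is made of \<open>g\<close>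
      and \<open>J\<close>. As \<open>Bf\<close> is constant, comparison at one point and its image
      is enough.\<close>
    have pres: "Bf (L s) (L t) = Bf s t" for s t
    proof -
      obtain i x where ix: "i \<in> charts M" "x \<in> cimg i" by (rule some_chart)
      then obtain p where p: "p \<in> cdom M i" "x = cmap M i p" by blast
      obtain j where j: "j \<in> charts M" "a p \<in> cdom M j"
        using obtain_chart[OF smooth_map_points[OF aa(1) cdom_points[OF ix(1) p(1)]]] by blast
      note r = dev_related[OF aa(1) L ix(1) p(1) j, folded p(2)]
      have jx: "cmap M j (a p) \<in> cimg j" using j by blast
      have "Bf (L (Dd (F i) x u)) (L (Dd (F i) x v)) = Bf (Dd (F i) x u) (Dd (F i) x v)" for u v
      proof -
        have "Bf (L (Dd (F i) x u)) (L (Dd (F i) x v)) =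
            Bf (Dd (F j) (cmap M j (a p)) (Dd (local_rep M i M j a) x u))
               (Dd (F j) (cmap M j (a p)) (Dd (local_rep M i M j a) x v))"
          by (simp only: r)
        also have "\<dots> = om i x u v"
          unfolding Bf(2)[OF j(1) jx] by (rule om_maps[OF aa(3,4) ix(1) p(1) j, folded p(2)])
        finally show ?thesis by (simp only: Bf(2)[OF ix])
      qed
      from this[of "DFinv i x s" "DFinv i x t"] show ?thesis using ix by simp
    qed
    show ?thesis by (rule that[OF L(1) theta_eq[OF L] L(2) pres])
  qed
qed

section \<open>The group of affine holomorphic isometries\<close>

lemma iso_compose:
  assumes f: "isom f" and h: "isom h" and c: "\<And>p. p \<in> points M \<Longrightarrow> c p = f (h p)"
  shows "isom c"
proof -
  have bf: "bij_betw f (points M) (points M)" "smooth_map M M (inv_into (points M) f)"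
    and bh: "bij_betw h (points M) (points M)" "smooth_map M M (inv_into (points M) h)"
    using f h by (simp_all add: affine_holomorphic_isometry_def diffeomorphism_def)
  interpret c: smooth_map_comp M M M h f c
    by unfold_locales (use iso_smooth f h c in auto)
  have "bij_betw (f \<circ> h) (points M) (points M)" by (rule bij_betw_trans[OF bh(1) bf(1)])
  then have bc: "bij_betw c (points M) (points M)"
    by (subst bij_betw_cong[of _ _ "f \<circ> h"]) (simp_all add: c)
  have inv: "inv_into (points M) c q = inv_into (points M) h (inv_into (points M) f q)" if q: "q \<in> points M" for q
  proof (rule inv_into_f_eq)
    show "inj_on c (points M)" using bc by (rule bij_betw_imp_inj_on)
    have 1: "inv_into (points M) f q \<in> points M" using bij_betw_inv_into[OF bf(1)] q by (auto dest: bij_betwE)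
    then show 2: "inv_into (points M) h (inv_into (points M) f q) \<in> points M"
      using bij_betw_inv_into[OF bh(1)] by (auto dest: bij_betwE)
    show "c (inv_into (points M) h (inv_into (points M) f q)) = q"
      using c[OF 2] 1 q bij_betw_inv_into_right[OF bh(1)] bij_betw_inv_into_right[OF bf(1)] by simp
  qed
  interpret ci: smooth_map_comp M M M "inv_into (points M) f" "inv_into (points M) h" "inv_into (points M) c"
    by unfold_locales (use bf bh inv in auto)
  show ?thesis
    using bc c.smooth_map ci.smooth_map c.maps_connection c.maps_endo c.maps_form2 f h
    unfolding affine_holomorphic_isometry_def diffeomorphism_def by blast
qed

lemma iso_inverse:
  assumes f: "isom f" and c: "\<And>q. q \<in> points M \<Longrightarrow> c q = inv_into (points M) f q"
  shows "isom c"
proof -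
  have bf: "bij_betw f (points M) (points M)" "smooth_map M M (inv_into (points M) f)" "smooth_map M M f"
    "maps_connection M C M C f" "maps_endo M J M J f" "maps_form2 M g M g f"
    using f by (simp_all add: affine_holomorphic_isometry_def diffeomorphism_def)
  have bc: "bij_betw c (points M) (points M)"
    by (subst bij_betw_cong[of _ _ "inv_into (points M) f"]) (simp_all add: c bij_betw_inv_into[OF bf(1)])
  have sc: "smooth_map M M c" by (rule smooth_map_cong_points[OF smooth smooth bf(2)]) (simp add: c)
  interpret s: smooth_inverse_maps M M f c
    by unfold_locales
      (use bf(3) sc c bij_betw_inv_into_left[OF bf(1)] bij_betw_inv_into_right[OF bf(1)] smooth_map_points[OF bf(3)] in auto)
  have "smooth_map M M (inv_into (points M) c)"
  proof (rule smooth_map_cong_points[OF smooth smooth bf(3)])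
    fix p assume p: "p \<in> points M"
    show "inv_into (points M) c p = f p"
      by (rule inv_into_f_eq[OF bij_betw_imp_inj_on[OF bc] smooth_map_points[OF bf(3) p] s.inv[OF p]])
  qed
  then show ?thesis
    using bc sc s.maps_connection_inverse[OF bf(4)] s.maps_endo_inverse[OF bf(5)] s.maps_form2_inverse[OF bf(6)]
    unfolding affine_holomorphic_isometry_def diffeomorphism_def by blast
qed

lemma iso_ident:
  assumes c: "\<And>p. p \<in> points M \<Longrightarrow> c p = p"
  shows "isom c"
proof -
  interpret c: smooth_map_comp M M M id id c
    by unfold_locales (use smooth_map_id c in auto)
  have bc: "bij_betw c (points M) (points M)"
    by (subst bij_betw_cong[of _ _ id]) (simp_all add: c)
  have "smooth_map M M (inv_into (points M) c)"
  proof (rule smooth_map_cong_points[OF smooth smooth smooth_map_id])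
    fix p assume p: "p \<in> points M"
    show "inv_into (points M) c p = id p"
      using inv_into_f_eq[OF bij_betw_imp_inj_on[OF bc] p c[OF p]] by simp
  qed
  then show ?thesis
    using bc c.smooth_map c.maps_connection c.maps_endo c.maps_form2 maps_endo_id maps_form2_id maps_connection_id
    unfolding affine_holomorphic_isometry_def diffeomorphism_def by blast
qed

definition isoG :: "('a \<Rightarrow> 'a) monoid" where "isoG = isometry_group M J g C"

lemma carrier_isoG: "carrier isoG = {\<phi> \<in> Bij (points M). isom \<phi>}"
  by (simp add: isoG_def isometry_group_def)

lemma group_isoG: "group isoG"
proof -
  interpret B: group "BijGroup (points M)" by (rule group_BijGroup)
  have "subgroup {\<phi> \<in> Bij (points M). isom \<phi>} (BijGroup (points M))"
  proof (rule B.subgroupI)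
    show "{\<phi> \<in> Bij (points M). isom \<phi>} \<subseteq> carrier (BijGroup (points M))" by (auto simp: BijGroup_def)
    have "(\<lambda>x\<in>points M. x) \<in> {\<phi> \<in> Bij (points M). isom \<phi>}" by (simp add: id_Bij iso_ident)
    then show "{\<phi> \<in> Bij (points M). isom \<phi>} \<noteq> {}" by blast
    fix a assume a: "a \<in> {\<phi> \<in> Bij (points M). isom \<phi>}"
    then show "m_inv (BijGroup (points M)) a \<in> {\<phi> \<in> Bij (points M). isom \<phi>}"
      by (auto simp: inv_BijGroup restrict_inv_into_Bij intro: iso_inverse[of a])
    fix b assume b: "b \<in> {\<phi> \<in> Bij (points M). isom \<phi>}"
    show "a \<otimes>\<^bsub>BijGroup (points M)\<^esub> b \<in> {\<phi> \<in> Bij (points M). isom \<phi>}"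
    proof -
      have "compose (points M) a b \<in> Bij (points M)" using a b by (simp add: compose_Bij)
      moreover have "isom (compose (points M) a b)"
        by (rule iso_compose[of a b]) (use a b in \<open>auto simp: compose_def\<close>)
      ultimately show ?thesis using a b by (simp add: BijGroup_def)
    qed
  qed
  from B.subgroup_imp_group[OF this] show ?thesis by (simp add: isoG_def isometry_group_def)
qed

lemma isoG_mult: "a \<in> carrier isoG \<Longrightarrow> b \<in> carrier isoG \<Longrightarrow> a \<otimes>\<^bsub>isoG\<^esub> b = compose (points M) a b"
  by (simp add: isoG_def isometry_group_def BijGroup_def)

lemma isoG_one: "\<one>\<^bsub>isoG\<^esub> = (\<lambda>x\<in>points M. x)"
  by (simp add: isoG_def isometry_group_def BijGroup_def)

section \<open>The cotangent bundle\<close>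

definition Ncot :: "('i, 'a \<times> ('i \<Rightarrow> 'e dual), 'e \<times> 'e dual) atlas" where "Ncot = cotangent_bundle M"

text \<open>The constant form \<open>Bf\<close> turns the trivialization \<open>M \<times> 'e dual\<close> into \<open>M \<times> 'e\<close>: \<open>pt (m, w)\<close> is the
  covector \<open>Bf w \<circ> d dev\<close> at \<open>m\<close>. \<open>Phi i\<close> is its expression in the bundle chart \<open>i\<close>, with inverse \<open>Phi_inv i\<close>.\<close>

definition pt :: "'a \<times> 'e \<Rightarrow> 'a \<times> ('i \<Rightarrow> 'e dual)" where
  "pt z = cot_point M dev (fst z, flat_map Bf (snd z))"

definition Phi :: "'i \<Rightarrow> 'e \<times> 'e \<Rightarrow> 'e \<times> 'e dual" where
  "Phi i z = (fst z, Blinfun (\<lambda>v. Bf (snd z) (Dd (F i) (fst z) v)))"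

definition Phi_inv :: "'i \<Rightarrow> 'e \<times> 'e dual \<Rightarrow> 'e \<times> 'e" where
  "Phi_inv i z = (fst z, sharp_map Bf (Blinfun (\<lambda>t. blinfun_apply (snd z) (DFinv i (fst z) t))))"

lemma linear_Bf_DF: "i \<in> charts M \<Longrightarrow> x \<in> cimg i \<Longrightarrow> linear (\<lambda>v. Bf w (Dd (F i) x v))"
  using linear_compose[OF linear_DF bilinear_linear_right[OF Bf(1)]] by (simp add: o_def)

lemma linear_p_DFinv: "i \<in> charts M \<Longrightarrow> x \<in> cimg i \<Longrightarrow> linear (\<lambda>t. blinfun_apply p (DFinv i x t))"
  using linear_compose[OF linear_DFinv linear_blinfun_apply] by (simp add: o_def)

lemma fst_Phi [simp]: "fst (Phi i z) = fst z" and fst_Phi_inv [simp]: "fst (Phi_inv i z') = fst z'"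
  by (simp_all add: Phi_def Phi_inv_def)

lemma Phi_apply: "i \<in> charts M \<Longrightarrow> fst z \<in> cimg i \<Longrightarrow> blinfun_apply (snd (Phi i z)) v = Bf (snd z) (Dd (F i) (fst z) v)"
  by (simp add: Phi_def Blinfun_linear_apply linear_Bf_DF)

lemma Phi_inv_apply: "i \<in> charts M \<Longrightarrow> fst z \<in> cimg i \<Longrightarrow> Bf (snd (Phi_inv i z)) t = blinfun_apply (snd z) (DFinv i (fst z) t)"
  by (simp add: Phi_inv_def Blinfun_linear_apply linear_p_DFinv)

lemma Phi_inv_Phi: "i \<in> charts M \<Longrightarrow> fst z \<in> cimg i \<Longrightarrow> Phi_inv i (Phi i z) = z"
  by (rule prod_eqI) (simp_all add: Phi_inv_def, rule Bf.sharp_eqI,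
      simp add: Blinfun_linear_apply linear_p_DFinv Phi_apply bilinear_linear_right[OF Bf(1)])

lemma Phi_Phi_inv: "i \<in> charts M \<Longrightarrow> fst z \<in> cimg i \<Longrightarrow> Phi i (Phi_inv i z) = z"
  by (rule prod_eqI) (simp, rule blinfun_eqI, simp add: Phi_apply Phi_inv_apply)

lemma open_cimg_prod: "i \<in> charts M \<Longrightarrow> open (cimg i \<times> (UNIV :: 'f::topological_space set))"
  by (simp add: open_Times open_cimg)

lemma smooth_fst_comp:
  fixes f :: "'e \<Rightarrow> 'z::real_normed_vector"
  assumes i: "i \<in> charts M" and f: "smooth_on f (cimg i)"
  shows "smooth_on (\<lambda>z. f (fst z)) (cimg i \<times> (UNIV :: 'f::real_normed_vector set))"
  by (rule smooth_on_compose[OF open_cimg_prod[OF i] open_cimg[OF i] f smooth_on_fst[OF open_cimg_prod[OF i] smooth_on_ident]]) auto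

lemma smooth_Phi: assumes i: "i \<in> charts M" shows "smooth_on (Phi i) (cimg i \<times> UNIV)"
proof -
  note o = open_cimg_prod[OF i]
  have "smooth_on (\<lambda>z :: 'e \<times> 'e. Blinfun (\<lambda>v. Bf (snd z) (Dd (F i) (fst z) v))) (cimg i \<times> UNIV)"
  proof (rule smooth_on_Blinfun[OF o])
    fix v
    show "smooth_on (\<lambda>z :: 'e \<times> 'e. Bf (snd z) (Dd (F i) (fst z) v)) (cimg i \<times> UNIV)"
      using bilinear_conv_bounded_bilinear Bf(1)
      by (intro smooth_on_bilinear[OF _ o smooth_on_snd[OF o smooth_on_ident] smooth_fst_comp[OF i smooth_on_Dd[OF smooth_F[OF i]]]]) blast
  qed (auto intro: linear_Bf_DF[OF i])
  then show ?thesis unfolding Phi_def[abs_def]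
    by (rule smooth_on_Pair[OF o smooth_on_fst[OF o smooth_on_ident]])
qed

lemma smooth_Phi_inv: assumes i: "i \<in> charts M" shows "smooth_on (Phi_inv i) (cimg i \<times> UNIV)"
proof -
  note o = open_cimg_prod[OF i]
  have "smooth_on (\<lambda>z :: 'e \<times> 'e dual. Blinfun (\<lambda>t. blinfun_apply (snd z) (DFinv i (fst z) t))) (cimg i \<times> UNIV)"
  proof (rule smooth_on_Blinfun[OF o])
    fix t
    show "smooth_on (\<lambda>z :: 'e \<times> 'e dual. blinfun_apply (snd z) (DFinv i (fst z) t)) (cimg i \<times> UNIV)"
      by (rule smooth_on_bilinear[OF bounded_bilinear_blinfun_apply o smooth_on_snd[OF o smooth_on_ident]
            smooth_fst_comp[OF i smooth_DFinv[OF i]]])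
  qed (auto intro: linear_p_DFinv[OF i])
  from smooth_on_linear_image[OF linear_imp_bounded_linear[OF Bf.sharp_linear] o this]
  show ?thesis unfolding Phi_inv_def[abs_def]
    by (rule smooth_on_Pair[OF o smooth_on_fst[OF o smooth_on_ident]])
qed

section \<open>The trivialization and the bundle charts\<close>

lemma pt_eq: "pt (m, w) = (m, \<lambda>i. if i \<in> charts M \<and> m \<in> cdom M i
    then Blinfun (\<lambda>v. Bf w (Dd (F i) (cmap M i m) v)) else 0)"
  by (simp add: pt_def cot_point_def F_def cong: if_cong)

lemma fst_pt [simp]: "fst (pt z) = fst z"
  by (simp add: pt_def cot_point_def)

lemma transition_DF:
  assumes "i \<in> charts M" "j \<in> charts M" "m \<in> cdom M i" "m \<in> cdom M j"
  shows "Dd (F j) (cmap M j m) (Dd (cmap M j \<circ> cinv M i) (cmap M i m) u) = Dd (F i) (cmap M i m) u"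
  using dev_related[OF smooth_map_id linear_ident, of 0 i m j u] assms by (simp add: local_rep_def)

lemma covector_pt: "covector M m (snd (pt (m, w)))"
  unfolding covector_def
proof (intro conjI ballI impI allI)
  fix i j u assume ij: "i \<in> charts M" "j \<in> charts M" "m \<in> cdom M i \<inter> cdom M j"
  then have "cmap M i m \<in> cimg i" "cmap M j m \<in> cimg j" by blast+
  with ij show "blinfun_apply (snd (pt (m, w)) i) u =
      blinfun_apply (snd (pt (m, w)) j) (Dd (cmap M j \<circ> cinv M i) (cmap M i m) u)"
    using transition_DF[of i j m u] by (simp add: pt_eq Blinfun_linear_apply linear_Bf_DF)
qed (auto simp: pt_eq)

lemma covector_pt_surj:
  assumes m: "m \<in> points M" and c: "covector M m \<alpha>"
  obtains w where "(m, \<alpha>) = pt (m, w)"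
proof -
  obtain i0 where i0: "i0 \<in> charts M" "m \<in> cdom M i0" by (rule obtain_chart[OF m])
  have x0: "cmap M i0 m \<in> cimg i0" using i0 by blast
  \<comment> \<open>Read off from one chart around \<open>m\<close>; the transformation law of
    covectors shows that it fits the components in every other chart.\<close>
  define w where "w = sharp_map Bf (Blinfun (\<lambda>t. blinfun_apply (\<alpha> i0) (DFinv i0 (cmap M i0 m) t)))"
  have w: "Bf w t = blinfun_apply (\<alpha> i0) (DFinv i0 (cmap M i0 m) t)" for t
    by (simp add: w_def Blinfun_linear_apply linear_p_DFinv[OF i0(1) x0])
  have "\<alpha> i = (if i \<in> charts M \<and> m \<in> cdom M i then Blinfun (\<lambda>v. Bf w (Dd (F i) (cmap M i m) v)) else 0)" for i
  proof (cases "i \<in> charts M \<and> m \<in> cdom M i")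
    case True
    then have x: "cmap M i m \<in> cimg i" by blast
    have "blinfun_apply (\<alpha> i) u = Bf w (Dd (F i) (cmap M i m) u)" for u
    proof -
      have "blinfun_apply (\<alpha> i) u = blinfun_apply (\<alpha> i0) (Dd (cmap M i0 \<circ> cinv M i) (cmap M i m) u)"
        using c True i0 unfolding covector_def by blast
      also have "Dd (cmap M i0 \<circ> cinv M i) (cmap M i m) u = DFinv i0 (cmap M i0 m) (Dd (F i) (cmap M i m) u)"
        using transition_DF[of i i0 m u] True i0 DFinv_DF[OF i0(1) x0] by metis
      finally show ?thesis by (simp add: w)
    qed
    then show ?thesis using True
      by (auto intro!: blinfun_eqI simp: Blinfun_linear_apply linear_Bf_DF[OF _ x])
  next
    case False
    then show ?thesis using c unfolding covector_def by auto
  qed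
  then have "(m, \<alpha>) = pt (m, w)" unfolding pt_eq by auto
  then show ?thesis by (rule that)
qed

lemma Ncot_simps: "charts Ncot = charts M" "points Ncot = {(p, \<alpha>). p \<in> points M \<and> covector M p \<alpha>}"
  "cdom Ncot i = {(p, \<alpha>). p \<in> cdom M i \<and> covector M p \<alpha>}" "cmap Ncot i (p, \<alpha>) = (cmap M i p, \<alpha> i)"
  by (simp_all add: Ncot_def cotangent_bundle_def)

lemma points_Ncot: "points Ncot = pt ` (points M \<times> UNIV)"
proof (intro subset_antisym subsetI)
  fix \<xi> assume "\<xi> \<in> points Ncot"
  then obtain m \<alpha> where ma: "\<xi> = (m, \<alpha>)" "m \<in> points M" "covector M m \<alpha>" by (auto simp: Ncot_simps)
  obtain w where "(m, \<alpha>) = pt (m, w)" by (rule covector_pt_surj[OF ma(2,3)])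
  then show "\<xi> \<in> pt ` (points M \<times> UNIV)" using ma by blast
next
  fix \<xi> assume "\<xi> \<in> pt ` (points M \<times> UNIV)"
  then obtain m w where "m \<in> points M" "\<xi> = pt (m, w)" by auto
  then show "\<xi> \<in> points Ncot" using covector_pt[of m w] fst_pt[of "(m, w)"]
    by (cases "pt (m, w)") (simp add: Ncot_simps)
qed

lemma pt_in_cdom_iff: "pt z \<in> cdom Ncot i \<longleftrightarrow> fst z \<in> cdom M i"
  using covector_pt[of "fst z" "snd z"] fst_pt[of z] by (cases "pt z") (auto simp: Ncot_simps)

lemma cdom_Ncot:
  assumes i: "i \<in> charts M"
  shows "cdom Ncot i = pt ` (cdom M i \<times> UNIV)"
proof (intro subset_antisym subsetI)
  fix \<xi> assume \<xi>: "\<xi> \<in> cdom Ncot i"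
  then have "\<xi> \<in> points Ncot" using cdom_points[OF i] by (auto simp: Ncot_simps)
  then obtain z where "z \<in> points M \<times> UNIV" "\<xi> = pt z" unfolding points_Ncot by blast
  then show "\<xi> \<in> pt ` (cdom M i \<times> UNIV)" using \<xi> pt_in_cdom_iff by (auto simp: mem_Times_iff)
next
  fix \<xi> assume "\<xi> \<in> pt ` (cdom M i \<times> UNIV)"
  then show "\<xi> \<in> cdom Ncot i" using pt_in_cdom_iff by auto
qed

lemma cmap_pt: "i \<in> charts M \<Longrightarrow> m \<in> cdom M i \<Longrightarrow> cmap Ncot i (pt (m, w)) = Phi i (cmap M i m, w)"
  by (simp add: pt_eq Ncot_simps Phi_def)

lemma inj_cmap_Ncot:
  assumes i: "i \<in> charts M"
  shows "inj_on (cmap Ncot i) (cdom Ncot i)"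
proof (rule inj_onI)
  fix \<xi> \<xi>' assume "\<xi> \<in> cdom Ncot i" "\<xi>' \<in> cdom Ncot i" and eq: "cmap Ncot i \<xi> = cmap Ncot i \<xi>'"
  then obtain m w m' w' where m: "\<xi> = pt (m, w)" "m \<in> cdom M i" and m': "\<xi>' = pt (m', w')" "m' \<in> cdom M i"
    unfolding cdom_Ncot[OF i] by auto
  have "Phi i (cmap M i m, w) = Phi i (cmap M i m', w')" using eq m m' i by (simp add: cmap_pt)
  then have "Phi_inv i (Phi i (cmap M i m, w)) = Phi_inv i (Phi i (cmap M i m', w'))" by simp
  then have "(cmap M i m, w) = (cmap M i m', w')"
    using m(2) m'(2) by (simp add: Phi_inv_Phi[OF i])
  then show "\<xi> = \<xi>'" using m m' inj_cmap[OF i] by (auto dest: inj_onD)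
qed

lemma pt_inj: "inj_on pt (points M \<times> UNIV)"
proof (rule inj_onI)
  fix z z' assume z: "z \<in> points M \<times> UNIV" and eq: "pt z = pt z'"
  have f: "fst z = fst z'" using eq fst_pt by metis
  obtain i where i: "i \<in> charts M" "fst z \<in> cdom M i" using obtain_chart[of "fst z"] z by (auto simp: mem_Times_iff)
  have "cmap Ncot i (pt (fst z, snd z)) = cmap Ncot i (pt (fst z', snd z'))" using eq by simp
  then have "Phi i (cmap M i (fst z), snd z) = Phi i (cmap M i (fst z), snd z')"
    using cmap_pt[OF i] f by metis
  then have "Phi_inv i (Phi i (cmap M i (fst z), snd z)) = Phi_inv i (Phi i (cmap M i (fst z), snd z'))" by simp
  then show "z = z'" using i f by (simp add: Phi_inv_Phi prod_eq_iff)
qed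

lemma cinv_Ncot: "i \<in> charts M \<Longrightarrow> m \<in> cdom M i \<Longrightarrow> cinv Ncot i (Phi i (cmap M i m, w)) = pt (m, w)"
  unfolding cinv_def
  by (rule inv_into_f_eq[OF inj_cmap_Ncot]) (simp_all add: pt_in_cdom_iff cmap_pt)

section \<open>The topology of the cotangent bundle\<close>

lemma Phi_image:
  assumes i: "i \<in> charts M" and A: "A \<subseteq> cimg i \<times> UNIV"
  shows "Phi i ` A = (cimg i \<times> UNIV) \<inter> Phi_inv i -` A"
proof (intro subset_antisym subsetI)
  fix z assume "z \<in> Phi i ` A"
  then obtain y where y: "y \<in> A" "z = Phi i y" by blast
  then have "fst y \<in> cimg i" using A by auto
  then show "z \<in> (cimg i \<times> UNIV) \<inter> Phi_inv i -` A"
    using y Phi_inv_Phi[OF i, of y] by (simp add: mem_Times_iff)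
next
  fix z assume z: "z \<in> (cimg i \<times> UNIV) \<inter> Phi_inv i -` A"
  then have "z = Phi i (Phi_inv i z)" using Phi_Phi_inv[OF i, of z] by (simp add: mem_Times_iff)
  then show "z \<in> Phi i ` A" using z by blast
qed

lemma Phi_preimage:
  assumes i: "i \<in> charts M" and A: "A \<subseteq> cimg i \<times> UNIV"
  shows "A = (cimg i \<times> UNIV) \<inter> Phi i -` (Phi i ` A)"
proof (intro subset_antisym subsetI)
  fix z assume z: "z \<in> (cimg i \<times> UNIV) \<inter> Phi i -` (Phi i ` A)"
  then obtain y where y: "y \<in> A" "Phi i z = Phi i y" by auto
  then have "Phi_inv i (Phi i z) = Phi_inv i (Phi i y)" by simp
  moreover have "fst y \<in> cimg i" "fst z \<in> cimg i" using y z A by auto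
  ultimately show "z \<in> A" using y Phi_inv_Phi[OF i] by metis
qed (use A in auto)

lemma open_Phi_image_iff:
  assumes i: "i \<in> charts M" and A: "A \<subseteq> cimg i \<times> UNIV"
  shows "open (Phi i ` A) \<longleftrightarrow> open A"
proof
  assume "open A"
  then show "open (Phi i ` A)"
    unfolding Phi_image[OF assms]
    by (rule continuous_open_preimage[OF smooth_on_continuous_on[OF smooth_Phi_inv[OF i]] open_cimg_prod[OF i]])
next
  assume "open (Phi i ` A)"
  from continuous_open_preimage[OF smooth_on_continuous_on[OF smooth_Phi[OF i]] open_cimg_prod[OF i] this]
  show "open A" using Phi_preimage[OF assms] by simp
qed

lemma cmap_Ncot_image:
  assumes i: "i \<in> charts M" and W: "W \<subseteq> points M \<times> UNIV"
  shows "cmap Ncot i ` (pt ` W \<inter> cdom Ncot i) = Phi i ` {z. fst z \<in> cimg i \<and> (cinv M i (fst z), snd z) \<in> W}"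
proof (intro subset_antisym subsetI)
  fix y assume "y \<in> cmap Ncot i ` (pt ` W \<inter> cdom Ncot i)"
  then obtain m w where mw: "(m, w) \<in> W" "m \<in> cdom M i" "y = Phi i (cmap M i m, w)"
    using pt_in_cdom_iff cmap_pt[OF i] by fastforce
  then have "(cmap M i m, w) \<in> {z. fst z \<in> cimg i \<and> (cinv M i (fst z), snd z) \<in> W}" using i by simp
  then show "y \<in> Phi i ` {z. fst z \<in> cimg i \<and> (cinv M i (fst z), snd z) \<in> W}" using mw(3) by blast
next
  fix y assume "y \<in> Phi i ` {z. fst z \<in> cimg i \<and> (cinv M i (fst z), snd z) \<in> W}"
  then obtain z where z: "fst z \<in> cimg i" "(cinv M i (fst z), snd z) \<in> W" "y = Phi i z" by blast
  then have "y = cmap Ncot i (pt (cinv M i (fst z), snd z))"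
    using cmap_pt[OF i cinv_in_cdom[OF z(1)]] cmap_cinv[OF z(1)] by simp
  moreover have "pt (cinv M i (fst z), snd z) \<in> pt ` W \<inter> cdom Ncot i"
    using z cinv_in_cdom[OF z(1)] by (simp add: pt_in_cdom_iff)
  ultimately show "y \<in> cmap Ncot i ` (pt ` W \<inter> cdom Ncot i)" by blast
qed

text \<open>Chart by chart both sides describe the same sets up to \<open>Phi i\<close>, which
  preserves openness in both directions.\<close>

lemma openin_Ncot_pt:
  assumes W: "W \<subseteq> points M \<times> UNIV"
  shows "openin (manifold_topology Ncot) (pt ` W) \<longleftrightarrow> openin (prod_topology (manifold_topology M) euclidean) W"
proof -
  have "openin (manifold_topology Ncot) (pt ` W) \<longleftrightarrow>
      (\<forall>i\<in>charts M. open (Phi i ` {z. fst z \<in> cimg i \<and> (cinv M i (fst z), snd z) \<in> W}))"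
    by (subst openin_manifold_topology)
      (use W in \<open>auto simp: inj_cmap_Ncot Ncot_simps(1) cmap_Ncot_image points_Ncot\<close>)
  also have "\<dots> \<longleftrightarrow> (\<forall>i\<in>charts M. open {z. fst z \<in> cimg i \<and> (cinv M i (fst z), snd z) \<in> W})"
    by (intro ball_cong refl open_Phi_image_iff) auto
  finally show ?thesis using W by (simp add: openin_prod_iff)
qed

lemma topspace_Ncot: "topspace (manifold_topology Ncot) = points Ncot"
proof -
  have "openin (prod_topology (manifold_topology M) euclidean) (points M \<times> (UNIV :: 'e set))"
    using openin_topspace[of "prod_topology (manifold_topology M) (euclidean :: 'e topology)"] by (simp add: topspace_eq)
  then have "openin (manifold_topology Ncot) (points Ncot)"
    using openin_Ncot_pt[of "points M \<times> UNIV"] by (simp add: points_Ncot)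
  moreover have "topspace (manifold_topology Ncot) \<subseteq> points Ncot"
  proof -
    have "openin (manifold_topology Ncot) (topspace (manifold_topology Ncot))" by simp
    then show ?thesis by (subst (asm) openin_manifold_topology) (auto simp: inj_cmap_Ncot Ncot_simps(1))
  qed
  ultimately show ?thesis using openin_subset by blast
qed

text \<open>The bundle inherits the Hausdorff property and second countability from the product
  along this homeomorphism.\<close>

lemma homeomorphic_Ncot:
  "homeomorphic_map (prod_topology (manifold_topology M) (euclidean :: 'e topology)) (manifold_topology Ncot) pt"
  unfolding homeomorphic_map_def quotient_map_def
proof (intro conjI allI impI)
  let ?T = "prod_topology (manifold_topology M) (euclidean :: 'e topology)"
  have T: "topspace ?T = points M \<times> UNIV" by (simp add: topspace_eq)
  show "pt ` topspace ?T = topspace (manifold_topology Ncot)" unfolding T topspace_Ncot points_Ncot ..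
  show "inj_on pt (topspace ?T)" unfolding T by (rule pt_inj)
  fix U assume U: "U \<subseteq> topspace (manifold_topology Ncot)"
  then have "U = pt ` {z \<in> topspace ?T. pt z \<in> U}" unfolding T topspace_Ncot points_Ncot by blast
  moreover have "openin (manifold_topology Ncot) (pt ` {z \<in> topspace ?T. pt z \<in> U}) \<longleftrightarrow> openin ?T {z \<in> topspace ?T. pt z \<in> U}"
    by (rule openin_Ncot_pt) (auto simp: topspace_eq)
  ultimately show "openin ?T {z \<in> topspace ?T. pt z \<in> U} \<longleftrightarrow> openin (manifold_topology Ncot) U" by simp
qed

lemma Hausdorff_Ncot: "Hausdorff_space (manifold_topology Ncot)"
  and second_countable_Ncot: "second_countable (manifold_topology Ncot)"
proof -
  note h = homeomorphic_map_imp_homeomorphic_space[OF homeomorphic_Ncot]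
  have "Hausdorff_space (manifold_topology M)" "second_countable (manifold_topology M)"
    using smooth by (simp_all add: smooth_manifold_def)
  then show "Hausdorff_space (manifold_topology Ncot)" "second_countable (manifold_topology Ncot)"
    using homeomorphic_Hausdorff_space[OF h] homeomorphic_space_second_countability[OF h]
    by (simp_all add: Hausdorff_space_prod_topology second_countable_prod_topology second_countable_euclidean)
qed

text \<open>The tangent vector of the cotangent bundle with horizontal part \<open>u\<close> and vertical part \<open>\<omega>(w, \<cdot>)\<close>. In
  this frame the metric is \<open>g \<oplus> g\<close>, and the complex structures map \<open>(u, w)\<close> to \<open>(Ju, -Jw)\<close>, \<open>(-w, u)\<close> and
  \<open>(-Jw, -Ju)\<close>.\<close>

definition frame :: "'i \<Rightarrow> 'e \<times> 'e dual \<Rightarrow> 'e \<times> 'e \<Rightarrow> 'e \<times> 'e dual" where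
  "frame i \<xi> z = hv_join (C i) \<xi> (fst z, flat_map (om i (fst \<xi>)) (snd z))"

definition unframe :: "'i \<Rightarrow> 'e \<times> 'e dual \<Rightarrow> 'e \<times> 'e dual \<Rightarrow> 'e \<times> 'e" where
  "unframe i \<xi> \<eta> = (fst \<eta>, sharp_map (om i (fst \<xi>)) (snd (hv_split (C i) \<xi> \<eta>)))"

lemma hv_join_eq: "hv_join C' \<xi> z = (fst z, snd z + Blinfun (\<lambda>v. blinfun_apply (snd \<xi>) (C' (fst \<xi>) (fst z) v)))"
  by (simp add: hv_join_def split_beta)

lemma hv_split_eq: "hv_split C' \<xi> z = (fst z, snd z - Blinfun (\<lambda>v. blinfun_apply (snd \<xi>) (C' (fst \<xi>) (fst z) v)))"
  by (simp add: hv_split_def split_beta)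

lemma fst_frame [simp]: "fst (frame i \<xi> z) = fst z" and fst_unframe [simp]: "fst (unframe i \<xi> \<eta>) = fst \<eta>"
  by (simp_all add: frame_def unframe_def hv_join_eq)

lemma hv_split_frame: "hv_split (C i) \<xi> (frame i \<xi> z) = (fst z, flat_map (om i (fst \<xi>)) (snd z))"
  by (simp add: frame_def hv_join_eq hv_split_eq)

context
  fixes i and \<xi> :: "'e \<times> 'e dual" assumes i: "i \<in> charts M" and x: "fst \<xi> \<in> cimg i"
begin

private lemmas lJ = linear_J[OF i x]

interpretation n: nondegenerate_form "om i (fst \<xi>)" by (rule nondegenerate_om[OF i x])
interpretation ng: nondegenerate_form "g i (fst \<xi>)" by (rule nondegenerate_g[OF i x])

lemma linear_p_C: "linear (\<lambda>v. blinfun_apply p (C i (fst \<xi>) u v))"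
  using linear_compose[OF bilinear_linear_right[OF bilinear_C[OF i x]] linear_blinfun_apply] by (simp add: o_def)

lemma snd_frame: "blinfun_apply (snd (frame i \<xi> z)) v = om i (fst \<xi>) (snd z) v + blinfun_apply (snd \<xi>) (C i (fst \<xi>) (fst z) v)"
  by (simp add: frame_def hv_join_eq blinfun.add_left Blinfun_linear_apply linear_p_C)

lemma frame_unframe [simp]: "frame i \<xi> (unframe i \<xi> \<eta>) = \<eta>"
  by (simp add: frame_def unframe_def hv_join_eq hv_split_eq)

lemma unframe_frame [simp]: "unframe i \<xi> (frame i \<xi> z) = z"
  by (simp add: unframe_def hv_split_frame)

lemma linear_frame: "linear (frame i \<xi>)"
  by (rule linearI; rule prod_eqI)
    (auto intro!: blinfun_eqI simp: snd_frame blinfun.add_left blinfun.scaleR_left blinfun.add_right blinfun.scaleR_right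
      bilinear_ladd[OF bilinear_om[OF i x]] bilinear_lmul[OF bilinear_om[OF i x]]
      bilinear_ladd[OF bilinear_C[OF i x]] bilinear_lmul[OF bilinear_C[OF i x]] algebra_simps)

lemma linear_unframe: "linear (unframe i \<xi>)"
proof (rule linearI)
  fix \<eta> \<eta>' and r :: real
  have "unframe i \<xi> (\<eta> + \<eta>') = unframe i \<xi> (frame i \<xi> (unframe i \<xi> \<eta>) + frame i \<xi> (unframe i \<xi> \<eta>'))" by simp
  also have "\<dots> = unframe i \<xi> (frame i \<xi> (unframe i \<xi> \<eta> + unframe i \<xi> \<eta>'))" by (simp only: linear_add[OF linear_frame])
  finally show "unframe i \<xi> (\<eta> + \<eta>') = unframe i \<xi> \<eta> + unframe i \<xi> \<eta>'" by simp
  have "unframe i \<xi> (r *\<^sub>R \<eta>) = unframe i \<xi> (r *\<^sub>R frame i \<xi> (unframe i \<xi> \<eta>))" by simp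
  also have "\<dots> = unframe i \<xi> (frame i \<xi> (r *\<^sub>R unframe i \<xi> \<eta>))" by (simp only: linear_scale[OF linear_frame])
  finally show "unframe i \<xi> (r *\<^sub>R \<eta>) = r *\<^sub>R unframe i \<xi> \<eta>" by simp
qed

text \<open>The covector omega(w, .) equals g(Jw, .), so the inverse metric pairs the covectors of w
  and w' to omega(w', Jw) = g(w', w).\<close>

lemma cot_g_frame: "cot_g g C i \<xi> (frame i \<xi> z) (frame i \<xi> z') =
    g i (fst \<xi>) (fst z) (fst z') + g i (fst \<xi>) (snd z) (snd z')"
proof -
  have "sharp_map (g i (fst \<xi>)) (flat_map (om i (fst \<xi>)) (snd z)) = J i (fst \<xi>) (snd z)"
    by (rule ng.sharp_eqI) (simp add: om_eq)
  then show ?thesis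
    by (simp add: cot_g_def Let_def hv_split_frame om_J[OF i x] g_sym[OF i x, of "snd z'"])
qed

text \<open>The sign comes from the transpose: omega(w, J .) = - omega(Jw, .).\<close>

lemma cot_I1_frame: "cot_I1 J C i \<xi> (frame i \<xi> z) = frame i \<xi> (J i (fst \<xi>) (fst z), - J i (fst \<xi>) (snd z))"
proof -
  have l: "linear (\<lambda>v. om i (fst \<xi>) (snd z) (J i (fst \<xi>) v))"
    using linear_compose[OF lJ bilinear_linear_right[OF bilinear_om[OF i x]]] by (simp add: o_def)
  have "Blinfun (\<lambda>v. om i (fst \<xi>) (snd z) (J i (fst \<xi>) v)) = flat_map (om i (fst \<xi>)) (- J i (fst \<xi>) (snd z))"
  proof (rule blinfun_eqI)
    fix v
    have "blinfun_apply (flat_map (om i (fst \<xi>)) (- J i (fst \<xi>) (snd z))) v = g i (fst \<xi>) (snd z) v"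
      unfolding n.flat_apply om_eq by (simp add: linear_neg[OF lJ] JJ[OF i x])
    then show "blinfun_apply (Blinfun (\<lambda>v. om i (fst \<xi>) (snd z) (J i (fst \<xi>) v))) v =
        blinfun_apply (flat_map (om i (fst \<xi>)) (- J i (fst \<xi>) (snd z))) v"
      by (simp add: om_J[OF i x] Blinfun_linear_apply bilinear_linear_right[OF bilinear_g[OF i x]])
  qed
  then show ?thesis
    unfolding cot_I1_def Let_def hv_split_frame by (simp add: frame_def)
qed

lemma cot_I2_frame: "cot_I2 om C i \<xi> (frame i \<xi> z) = frame i \<xi> (- snd z, fst z)"
  unfolding cot_I2_def Let_def hv_split_frame by (simp add: frame_def)

lemma cot_I3_frame: "cot_I3 J om C i \<xi> (frame i \<xi> z) = frame i \<xi> (- J i (fst \<xi>) (snd z), - J i (fst \<xi>) (fst z))"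
  unfolding cot_I3_def cot_I2_frame cot_I1_frame by (simp add: linear_neg[OF lJ])

end

lemma smooth_on_p_C:
  assumes i: "i \<in> charts M"
  shows "smooth_on (\<lambda>\<xi> :: 'e \<times> 'e dual. Blinfun (\<lambda>v. blinfun_apply (snd \<xi>) (C i (fst \<xi>) u v))) (cimg i \<times> UNIV)"
proof (rule smooth_on_Blinfun[OF open_cimg_prod[OF i]])
  show "smooth_on (\<lambda>\<xi> :: 'e \<times> 'e dual. blinfun_apply (snd \<xi>) (C i (fst \<xi>) u v)) (cimg i \<times> UNIV)" for v
    by (rule smooth_on_bilinear[OF bounded_bilinear_blinfun_apply open_cimg_prod[OF i]
          smooth_on_snd[OF open_cimg_prod[OF i] smooth_on_ident] smooth_fst_comp[OF i smooth_C[OF i]]])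
qed (auto intro: linear_p_C[OF i])

lemma smooth_frame: assumes i: "i \<in> charts M" shows "smooth_on (\<lambda>\<xi>. frame i \<xi> z) (cimg i \<times> UNIV)"
proof -
  note o = open_cimg_prod[OF i]
  have "smooth_on (\<lambda>\<xi>. flat_map (om i (fst \<xi>)) (snd z)) (cimg i \<times> (UNIV :: 'e dual set))"
    unfolding flat_map_def
    by (rule smooth_on_Blinfun[OF o smooth_fst_comp[OF i smooth_om[OF i]]])
      (auto intro: bilinear_linear_right[OF bilinear_om[OF i]])
  from smooth_on_add[OF o this smooth_on_p_C[OF i, of "fst z"]]
  show ?thesis unfolding frame_def hv_join_eq fst_conv snd_conv by (rule smooth_on_Pair[OF o smooth_on_const])
qed

text \<open>Smoothness of \<open>\<omega>\<^sup>-\<^sup>1\<close> is read off from flat coordinates, where \<open>\<omega>\<close> is constant, so that no matrix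
  inverse has to be differentiated. The inverse of \<open>g\<close> is \<open>J \<circ> \<omega>\<^sup>-\<^sup>1\<close>.\<close>

lemma sharp_om_eq:
  assumes i: "i \<in> charts M" and x: "x \<in> cimg i"
  shows "sharp_map (om i x) \<beta> = DFinv i x (snd (Phi_inv i (x, \<beta>)))"
proof -
  interpret n: nondegenerate_form "om i x" by (rule nondegenerate_om[OF i x])
  show ?thesis
  proof (rule n.sharp_eqI)
    fix v
    have "om i x (DFinv i x (snd (Phi_inv i (x, \<beta>)))) v = Bf (snd (Phi_inv i (x, \<beta>))) (Dd (F i) x v)"
      using Bf(2)[OF i x, of "DFinv i x (snd (Phi_inv i (x, \<beta>)))" v] i x by simp
    then show "om i x (DFinv i x (snd (Phi_inv i (x, \<beta>)))) v = blinfun_apply \<beta> v"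
      using i x by (simp add: Phi_inv_apply)
  qed
qed

lemma smooth_unframe: assumes i: "i \<in> charts M" shows "smooth_on (\<lambda>\<xi>. unframe i \<xi> \<eta>) (cimg i \<times> UNIV)"
proof -
  note o = open_cimg_prod[OF i]
  let ?\<beta> = "\<lambda>\<xi>. snd (hv_split (C i) \<xi> \<eta>)"
  have b: "smooth_on ?\<beta> (cimg i \<times> UNIV)"
    unfolding hv_split_eq snd_conv by (rule smooth_on_diff[OF o smooth_on_const smooth_on_p_C[OF i]])
  have "smooth_on (\<lambda>\<xi>. Phi_inv i (fst \<xi>, ?\<beta> \<xi>)) (cimg i \<times> UNIV)"
    by (rule smooth_on_compose[OF o o smooth_Phi_inv[OF i] smooth_on_Pair[OF o smooth_on_fst[OF o smooth_on_ident] b]]) auto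
  from smooth_on_apply[where L = "\<lambda>\<xi>. DFinv i (fst \<xi>)", OF o smooth_fst_comp[OF i smooth_DFinv[OF i]] _ smooth_on_snd[OF o this]]
  have "smooth_on (\<lambda>\<xi>. DFinv i (fst \<xi>) (snd (Phi_inv i (fst \<xi>, ?\<beta> \<xi>)))) (cimg i \<times> UNIV)"
    using linear_DFinv[OF i] by auto
  from smooth_on_Pair[OF o smooth_on_const[of "fst \<eta>"] this]
  show ?thesis
    by (rule smooth_on_cong[OF o, rotated]) (auto simp: unframe_def sharp_om_eq[OF i])
qed

text \<open>Moving the base point along \<open>u\<close> changes the differential of
  \<open>dev\<close> by the Christoffel term, which is exactly the correction in
  \<open>hv_join\<close>. Hence a constant fibre coordinate describes a horizontal motion, and
  moving the fibre coordinate gives the vertical vector omega(w, .).\<close>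

lemma Dd_Phi:
  assumes i: "i \<in> charts M" and x: "fst z \<in> cimg i"
  shows "Dd (Phi i) z (u, Dd (F i) (fst z) w) = frame i (Phi i z) (u, w)"
proof -
  have zS: "z \<in> cimg i \<times> UNIV" using x by (simp add: mem_Times_iff)
  note D = smooth_on_has_derivative[OF smooth_Phi[OF i] zS]
  \<comment> \<open>The first component of \<open>Phi i\<close> is the projection; its derivative is
    computed in two ways.\<close>
  have A: "Dd fst z = (\<lambda>\<zeta>. fst (Dd (Phi i) z \<zeta>))"
    by (rule Dd_eqI) (use has_derivative_fst[OF D] in simp)
  have B: "Dd fst z = fst"
    by (rule Dd_eqI[OF bounded_linear_imp_has_derivative[OF bounded_linear_fst]])
  have 1: "fst (Dd (Phi i) z \<zeta>) = fst \<zeta>" for \<zeta>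
    by (rule fun_cong[OF trans[OF A[symmetric] B]])
  have 2: "blinfun_apply (snd (Dd (Phi i) z (u, t))) v = Bf t (Dd (F i) (fst z) v) + Bf (snd z) (Dd (F i) (fst z) (C i (fst z) u v))" for t v
  proof -
    have "((\<lambda>z. blinfun_apply (snd (Phi i z)) v) has_derivative (\<lambda>\<zeta>. blinfun_apply (snd (Dd (Phi i) z \<zeta>)) v)) (at z)"
      by (rule bounded_linear.has_derivative[OF blinfun.bounded_linear_left has_derivative_snd[OF D]])
    then have d1: "Dd (\<lambda>z. blinfun_apply (snd (Phi i z)) v) z = (\<lambda>\<zeta>. blinfun_apply (snd (Dd (Phi i) z \<zeta>)) v)"
      by (rule Dd_eqI)
    have d2: "Dd (\<lambda>z. blinfun_apply (snd (Phi i z)) v) z = Dd (\<lambda>z. Bf (snd z) (Dd (F i) (fst z) v)) z"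
      by (rule Dd_cong_open[OF open_cimg_prod[OF i] zS]) (auto simp: Phi_apply[OF i])
    have "((\<lambda>z. Dd (F i) (fst z) v) has_derivative (\<lambda>\<zeta>. Dd (\<lambda>x. Dd (F i) x v) (fst z) (fst \<zeta>))) (at z)"
      by (rule has_derivative_compose[OF bounded_linear_imp_has_derivative[OF bounded_linear_fst]
            smooth_on_has_derivative[OF smooth_on_Dd[OF smooth_F[OF i]] x]])
    then have "((\<lambda>z. Bf (snd z) (Dd (F i) (fst z) v)) has_derivative
        (\<lambda>\<zeta>. Bf (snd z) (Dd (\<lambda>x. Dd (F i) x v) (fst z) (fst \<zeta>)) + Bf (snd \<zeta>) (Dd (F i) (fst z) v))) (at z)"
      using bilinear_conv_bounded_bilinear Bf(1)
      by (intro bounded_bilinear.FDERIV[of Bf] bounded_linear_imp_has_derivative[OF bounded_linear_snd]) blast+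
    from fun_cong[OF Dd_eqI[OF this], of "(u, t)"] fun_cong[OF d1, of "(u, t)"] d2 D2_F[OF i x, of u v]
    show ?thesis by (simp add: D2_def)
  qed
  show ?thesis
  proof (rule prod_eqI)
    show "snd (Dd (Phi i) z (u, Dd (F i) (fst z) w)) = snd (frame i (Phi i z) (u, w))"
      by (rule blinfun_eqI) (simp add: 2 snd_frame i x Bf(2) Phi_apply)
  qed (simp add: 1)
qed

text \<open>A map \<open>a\<close> of \<open>M\<close> that is affine in the developing map lifts to \<open>(m, w) \<mapsto> (a m, L w + c)\<close>. In the frames
  its differential is \<open>da \<oplus> da\<close>. For \<open>a = id\<close> this gives the transition maps of the bundle atlas and
  the tensoriality of the structure, for isometries \<open>a\<close> the invariance.\<close>

context
  fixes a L b c \<psi>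
  assumes a: "smooth_map M M a" and L: "linear L" "\<And>m. m \<in> points M \<Longrightarrow> dev (a m) = L (dev m) + b"
    and \<psi>: "\<And>m w. m \<in> points M \<Longrightarrow> \<psi> (pt (m, w)) = pt (a m, L w + c)"
begin

lemma lift_domain:
  assumes i: "i \<in> charts M"
  shows "cmap Ncot i ` {\<xi> \<in> cdom Ncot i. \<psi> \<xi> \<in> cdom Ncot j} = cmap M i ` {p \<in> cdom M i. a p \<in> cdom M j} \<times> UNIV"
proof (intro subset_antisym subsetI)
  fix z assume "z \<in> cmap Ncot i ` {\<xi> \<in> cdom Ncot i. \<psi> \<xi> \<in> cdom Ncot j}"
  then obtain m w where m: "m \<in> cdom M i" "\<psi> (pt (m, w)) \<in> cdom Ncot j" "z = cmap Ncot i (pt (m, w))"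
    unfolding cdom_Ncot[OF i] by auto
  have "a m \<in> cdom M j" using m(2) \<psi>[OF cdom_points[OF i m(1)]] pt_in_cdom_iff by simp
  then show "z \<in> cmap M i ` {p \<in> cdom M i. a p \<in> cdom M j} \<times> UNIV"
    using m cmap_pt[OF i m(1)] by (simp add: mem_Times_iff)
next
  fix z assume "z \<in> cmap M i ` {p \<in> cdom M i. a p \<in> cdom M j} \<times> (UNIV :: 'e dual set)"
  then obtain m where m: "m \<in> cdom M i" "a m \<in> cdom M j" "fst z = cmap M i m" by (auto simp: mem_Times_iff)
  then have "fst z \<in> cimg i" by blast
  then have "z = Phi i (Phi_inv i z)" using Phi_Phi_inv[OF i] by simp
  also have "\<dots> = cmap Ncot i (pt (m, snd (Phi_inv i z)))" using cmap_pt[OF i m(1)] m(3) by (metis fst_Phi_inv prod.collapse)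
  finally have "z = cmap Ncot i (pt (m, snd (Phi_inv i z)))" .
  moreover have "pt (m, snd (Phi_inv i z)) \<in> {\<xi> \<in> cdom Ncot i. \<psi> \<xi> \<in> cdom Ncot j}"
    using m \<psi>[OF cdom_points[OF i m(1)]] by (simp add: pt_in_cdom_iff)
  ultimately show "z \<in> cmap Ncot i ` {\<xi> \<in> cdom Ncot i. \<psi> \<xi> \<in> cdom Ncot j}" by blast
qed

context
  fixes i j assumes i: "i \<in> charts M" and j: "j \<in> charts M"
begin

abbreviation (input) "S \<equiv> cmap M i ` {p \<in> cdom M i. a p \<in> cdom M j}"

lemma open_S: "open S" and smooth_R: "smooth_on (local_rep M i M j a) S"
  using a i j unfolding smooth_map_def by blast+

lemma S_cimg: "x \<in> S \<Longrightarrow> x \<in> cimg i" and R_cimg: "x \<in> S \<Longrightarrow> local_rep M i M j a x \<in> cimg j"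
  using i by (auto simp: local_rep_def)

lemma lift_local_rep:
  assumes x: "fst z \<in> S"
  shows "local_rep Ncot i Ncot j \<psi> (Phi i z) = Phi j (local_rep M i M j a (fst z), L (snd z) + c)"
proof -
  obtain m where m: "m \<in> cdom M i" "a m \<in> cdom M j" "fst z = cmap M i m" using x by blast
  have "local_rep Ncot i Ncot j \<psi> (Phi i z) = cmap Ncot j (\<psi> (pt (m, snd z)))"
    using cinv_Ncot[OF i m(1), of "snd z"] m(3) by (metis comp_apply local_rep_def prod.collapse)
  also have "\<dots> = Phi j (cmap M j (a m), L (snd z) + c)"
    using cmap_pt[OF j m(2)] \<psi>[OF cdom_points[OF i m(1)]] by simp
  finally show ?thesis using m i by (simp add: local_rep_def)
qed

lemma open_S_prod: "open (S \<times> (UNIV :: 'f::topological_space set))"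
  by (simp add: open_Times open_S)

lemma smooth_lift: "smooth_on (local_rep Ncot i Ncot j \<psi>) (S \<times> UNIV)"
proof -
  have s: "smooth_on (\<lambda>\<xi>. local_rep M i M j a (fst \<xi>)) (S \<times> (UNIV :: 'e dual set))"
    by (rule smooth_on_compose[OF open_S_prod open_S smooth_R smooth_on_fst[OF open_S_prod smooth_on_ident]]) auto
  have p: "smooth_on (Phi_inv i) (S \<times> UNIV)"
    by (rule smooth_on_mono[OF smooth_Phi_inv[OF i]]) (use S_cimg in auto)
  have "smooth_on (\<lambda>\<xi>. L (snd (Phi_inv i \<xi>)) + c) (S \<times> UNIV)"
    by (rule smooth_on_add[OF open_S_prod smooth_on_linear_image[OF linear_imp_bounded_linear[OF L(1)] open_S_prod
          smooth_on_snd[OF open_S_prod p]] smooth_on_const])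
  from smooth_on_compose[OF open_S_prod open_cimg_prod[OF j] smooth_Phi[OF j] smooth_on_Pair[OF open_S_prod s this]]
  have "smooth_on (\<lambda>\<xi>. Phi j (local_rep M i M j a (fst \<xi>), L (snd (Phi_inv i \<xi>)) + c)) (S \<times> UNIV)"
    using R_cimg by (auto simp: image_subset_iff)
  then show ?thesis
  proof (rule smooth_on_cong[OF open_S_prod, rotated])
    fix \<xi> assume "\<xi> \<in> S \<times> (UNIV :: 'e dual set)"
    then have x: "fst \<xi> \<in> S" by (simp add: mem_Times_iff)
    then show "Phi j (local_rep M i M j a (fst \<xi>), L (snd (Phi_inv i \<xi>)) + c) = local_rep Ncot i Ncot j \<psi> \<xi>"
      using lift_local_rep[of "Phi_inv i \<xi>"] Phi_Phi_inv[OF i S_cimg[OF x]] by simp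
  qed
qed

lemma lift_derivative:
  assumes m: "m \<in> cdom M i" "a m \<in> cdom M j"
  shows "Dd (local_rep Ncot i Ncot j \<psi>) (Phi i (cmap M i m, w)) (frame i (Phi i (cmap M i m, w)) z) =
    frame j (Phi j (cmap M j (a m), L w + c))
      (Dd (local_rep M i M j a) (cmap M i m) (fst z), Dd (local_rep M i M j a) (cmap M i m) (snd z))"
proof -
  let ?x = "cmap M i m" and ?R = "local_rep M i M j a" and ?l = "local_rep Ncot i Ncot j \<psi>"
  have xS: "?x \<in> S" using m by blast
  have xi: "?x \<in> cimg i" using m by blast
  have Rx: "?R ?x = cmap M j (a m)" using m i by (simp add: local_rep_def)
  have jx: "cmap M j (a m) \<in> cimg j" using m by blast
  have PS: "Phi i (?x, w) \<in> S \<times> UNIV" using xS by (simp add: mem_Times_iff)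
  have xwS: "(?x, w) \<in> S \<times> UNIV" using xS by simp
  have dPhi: "Phi i differentiable at (?x, w)"
    by (rule smooth_on_differentiable[OF smooth_Phi[OF i]]) (use xi in simp)
  \<comment> \<open>\<open>Dd_Phi\<close> is used at both ends: a frame vector at the source is a
    derivative of \<open>Phi i\<close>, and the result is recognized as a derivative of
    \<open>Phi j\<close>. In between, the lift is a product map.\<close>
  have "Dd ?l (Phi i (?x, w)) (frame i (Phi i (?x, w)) z) =
      Dd ?l (Phi i (?x, w)) (Dd (Phi i) (?x, w) (fst z, Dd (F i) ?x (snd z)))"
    using Dd_Phi[OF i, of "(?x, w)" "fst z" "snd z"] xi by simp
  also have "\<dots> = Dd (\<lambda>y. ?l (Phi i y)) (?x, w) (fst z, Dd (F i) ?x (snd z))"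
    by (rule Dd_compose[OF dPhi smooth_on_differentiable[OF smooth_lift PS], symmetric])
  also have "Dd (\<lambda>y. ?l (Phi i y)) (?x, w) = Dd (\<lambda>y. Phi j (?R (fst y), L (snd y) + c)) (?x, w)"
    by (rule Dd_cong_open[OF open_S_prod xwS]) (auto intro!: lift_local_rep simp: mem_Times_iff)
  also have "\<dots> (fst z, Dd (F i) ?x (snd z)) = Dd (Phi j) (?R ?x, L w + c) (Dd ?R ?x (fst z), L (Dd (F i) ?x (snd z)))"
  proof -
    have r: "((\<lambda>y. ?R (fst y)) has_derivative (\<lambda>\<zeta>. Dd ?R ?x (fst \<zeta>))) (at (?x, w))"
      using has_derivative_compose[OF bounded_linear_imp_has_derivative[OF bounded_linear_fst]
          , of ?R "Dd ?R ?x" "(?x, w)" UNIV] smooth_on_has_derivative[OF smooth_R xS] by simp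
    have l: "((\<lambda>y. L (snd y) + c) has_derivative (\<lambda>\<zeta>. L (snd \<zeta>))) (at (?x, w))"
      by (intro has_derivative_add_const bounded_linear.has_derivative[OF linear_imp_bounded_linear[OF L(1)]]
          bounded_linear_imp_has_derivative[OF bounded_linear_snd])
    have q: "((\<lambda>y. (?R (fst y), L (snd y) + c)) has_derivative (\<lambda>\<zeta>. (Dd ?R ?x (fst \<zeta>), L (snd \<zeta>)))) (at (?x, w))"
      by (rule has_derivative_Pair[OF r l])
    have P: "(Phi j has_derivative Dd (Phi j) (?R ?x, L w + c)) (at (?R ?x, L w + c))"
      by (rule smooth_on_has_derivative[OF smooth_Phi[OF j]]) (use jx Rx in simp)
    show ?thesis
      using Dd_eqI[OF has_derivative_compose[OF q, of "Phi j" "Dd (Phi j) (?R ?x, L w + c)"]] P by simp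
  qed
  also have "L (Dd (F i) ?x (snd z)) = Dd (F j) (cmap M j (a m)) (Dd ?R ?x (snd z))"
    by (rule dev_related[OF a L i m(1) j m(2), symmetric])
  finally show ?thesis
    using Dd_Phi[OF j, of "(cmap M j (a m), L w + c)"] jx by (simp add: Rx)
qed

end

lemma lift_smooth_map: "smooth_map Ncot Ncot \<psi>"
  unfolding smooth_map_def Ncot_simps(1)
proof (intro conjI ballI)
  show "\<psi> ` points Ncot \<subseteq> points Ncot"
    unfolding points_Ncot using \<psi> smooth_map_points[OF a] by auto
  fix i j assume ij: "i \<in> charts M" "j \<in> charts M"
  show "open (cmap Ncot i ` {p \<in> cdom Ncot i. \<psi> p \<in> cdom Ncot j})"
    unfolding lift_domain[OF ij(1)] by (rule open_S_prod[OF ij])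
  show "smooth_on (local_rep Ncot i Ncot j \<psi>) (cmap Ncot i ` {p \<in> cdom Ncot i. \<psi> p \<in> cdom Ncot j})"
    unfolding lift_domain[OF ij(1)] by (rule smooth_lift[OF ij])
qed

end

lemma smooth_manifold_Ncot: "smooth_manifold Ncot"
proof -
  have id: "\<And>m w. m \<in> points M \<Longrightarrow> id (pt (m, w)) = pt (id m, w + 0)" by simp
  have "smooth_map Ncot Ncot id"
    by (rule lift_smooth_map[OF smooth_map_id linear_ident _ id, of 0]) simp
  then have t: "open (cmap Ncot i ` (cdom Ncot i \<inter> cdom Ncot j)) \<and>
      smooth_on (cmap Ncot j \<circ> cinv Ncot i) (cmap Ncot i ` (cdom Ncot i \<inter> cdom Ncot j))"
    if "i \<in> charts M" "j \<in> charts M" for i j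
    using that by (auto simp: smooth_map_def local_rep_def Ncot_simps(1) Int_def)
  have "points Ncot = (\<Union>i\<in>charts M. cdom Ncot i)" using points_eq by (auto simp: Ncot_simps)
  then show ?thesis
    unfolding smooth_manifold_def Ncot_simps(1)
    using t inj_cmap_Ncot Hausdorff_Ncot second_countable_Ncot by blast
qed

section \<open>The hyper-Kaehler structure\<close>

abbreviation "gc \<equiv> cot_g g C"

text \<open>What the three complex structures have in common: in the frame of each chart they act by
  a block built from \<open>J\<close>.\<close>

definition block_field :: "('i, 'e \<times> 'e dual) endo \<Rightarrow> (('e \<Rightarrow> 'e) \<Rightarrow> 'e \<times> 'e \<Rightarrow> 'e \<times> 'e) \<Rightarrow> bool" where
  "block_field I blk \<longleftrightarrow> blk \<in> {block1, block2, block3} \<and>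
     (\<forall>i\<in>charts M. \<forall>\<xi> z. fst \<xi> \<in> cimg i \<longrightarrow> I i \<xi> (frame i \<xi> z) = frame i \<xi> (blk (J i (fst \<xi>)) z))"

lemma block_cot_I1: "block_field (cot_I1 J C) block1"
  and block_cot_I2: "block_field (cot_I2 om C) block2"
  and block_cot_I3: "block_field (cot_I3 J om C) block3"
  by (auto simp: block_field_def blk_defs cot_I1_frame cot_I2_frame cot_I3_frame)

lemma Ncot_cimg: "i \<in> charts M \<Longrightarrow> cmap Ncot i ` cdom Ncot i = cimg i \<times> UNIV"
proof -
  assume i: "i \<in> charts M"
  have "cmap Ncot i ` cdom Ncot i = Phi i ` (cimg i \<times> UNIV)"
  proof (intro subset_antisym subsetI)
    fix y assume "y \<in> cmap Ncot i ` cdom Ncot i"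
    then obtain m w where "m \<in> cdom M i" "y = Phi i (cmap M i m, w)"
      unfolding cdom_Ncot[OF i] using cmap_pt[OF i] by auto
    then show "y \<in> Phi i ` (cimg i \<times> UNIV)" by blast
  next
    fix y assume "y \<in> Phi i ` (cimg i \<times> UNIV)"
    then obtain m w where m: "m \<in> cdom M i" "y = Phi i (cmap M i m, w)" by blast
    then have "y = cmap Ncot i (pt (m, w))" using cmap_pt[OF i] by simp
    moreover have "pt (m, w) \<in> cdom Ncot i" using m by (simp add: pt_in_cdom_iff)
    ultimately show "y \<in> cmap Ncot i ` cdom Ncot i" by blast
  qed
  also have "\<dots> = cimg i \<times> UNIV"
    unfolding Phi_image[OF i subset_refl] by (auto simp: mem_Times_iff)
  finally show ?thesis .
qed

section \<open>Pointwise algebra and smoothness of the metric and of block fields\<close>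

lemma bilinear_frame_form:
  assumes i: "i \<in> charts M" and x: "x \<in> cimg i"
  shows "bilinear (\<lambda>z z'. g i x (fst z) (fst z') + g i x (snd z) (snd z'))"
  unfolding bilinear_def linear_iff
  by (simp add: bilinear_ladd[OF bilinear_g[OF i x]] bilinear_radd[OF bilinear_g[OF i x]]
      bilinear_lmul[OF bilinear_g[OF i x]] bilinear_rmul[OF bilinear_g[OF i x]] algebra_simps)

lemma gc_eq:
  assumes i: "i \<in> charts M" and x: "fst \<xi> \<in> cimg i"
  shows "gc i \<xi> \<eta> \<eta>' = g i (fst \<xi>) (fst \<eta>) (fst \<eta>') + g i (fst \<xi>) (snd (unframe i \<xi> \<eta>)) (snd (unframe i \<xi> \<eta>'))"
  using cot_g_frame[OF i x, of "unframe i \<xi> \<eta>" "unframe i \<xi> \<eta>'"] i x by simp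

lemma bilinear_gc:
  assumes i: "i \<in> charts M" and x: "fst \<xi> \<in> cimg i"
  shows "bilinear (gc i \<xi>)"
proof -
  let ?b = "\<lambda>z z'. g i (fst \<xi>) (fst z) (fst z') + g i (fst \<xi>) (snd z) (snd z')"
  have "gc i \<xi> = (\<lambda>\<eta> \<eta>'. ?b (unframe i \<xi> \<eta>) (unframe i \<xi> \<eta>'))" using gc_eq[OF i x] by (simp add: fun_eq_iff)
  moreover have "bilinear (\<lambda>\<eta> \<eta>'. ?b (unframe i \<xi> \<eta>) (unframe i \<xi> \<eta>'))"
    using linear_compose[OF linear_unframe[OF i x] bilinear_linear_left[OF bilinear_frame_form[OF i x]]]
      linear_compose[OF linear_unframe[OF i x] bilinear_linear_right[OF bilinear_frame_form[OF i x]]]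
    unfolding bilinear_def o_def by blast
  ultimately show ?thesis by simp
qed

lemma smooth_gc:
  assumes i: "i \<in> charts M"
  shows "smooth_on (\<lambda>\<xi>. gc i \<xi> \<eta> \<eta>') (cimg i \<times> UNIV)"
proof -
  note o = open_cimg_prod[OF i]
  have s: "smooth_on (\<lambda>\<xi>. g i (fst \<xi>) (p \<xi>) (q \<xi>)) (cimg i \<times> UNIV)"
    if p: "smooth_on p (cimg i \<times> UNIV)" and q: "smooth_on q (cimg i \<times> UNIV)" for p q :: "'e \<times> 'e dual \<Rightarrow> 'e"
  proof (rule smooth_on_apply[where L = "\<lambda>\<xi>. g i (fst \<xi>) (p \<xi>)", OF o _ _ q])
    show "smooth_on (\<lambda>\<xi>. g i (fst \<xi>) (p \<xi>) v) (cimg i \<times> UNIV)" for v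
      by (rule smooth_on_apply[where L = "\<lambda>\<xi> s. g i (fst \<xi>) s v", OF o smooth_fst_comp[OF i smooth_g[OF i]] _ p])
        (auto intro: bilinear_linear_left[OF bilinear_g[OF i]])
  qed (auto intro: bilinear_linear_right[OF bilinear_g[OF i]])
  note f = smooth_on_snd[OF o smooth_unframe[OF i]]
  from smooth_on_add[OF o s[OF smooth_on_const smooth_on_const] s[OF f f]]
  show ?thesis by (rule smooth_on_cong[OF o, rotated]) (auto simp: gc_eq[OF i])
qed

lemma block_field_eq:
  assumes I: "block_field I blk" and i: "i \<in> charts M" and x: "fst \<xi> \<in> cimg i"
  shows "I i \<xi> \<eta> = frame i \<xi> (blk (J i (fst \<xi>)) (unframe i \<xi> \<eta>))"
proof -
  have "I i \<xi> (frame i \<xi> (unframe i \<xi> \<eta>)) = frame i \<xi> (blk (J i (fst \<xi>)) (unframe i \<xi> \<eta>))"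
    using I i x unfolding block_field_def by blast
  then show ?thesis using i x by simp
qed

lemma linear_block_field:
  assumes I: "block_field I blk" and i: "i \<in> charts M" and x: "fst \<xi> \<in> cimg i"
  shows "linear (I i \<xi>)"
proof -
  have "blk \<in> {block1, block2, block3}" using I by (simp add: block_field_def)
  note linear_compose[OF linear_compose[OF linear_unframe[OF i x] linear_blk[OF linear_J[OF i x] this]] linear_frame[OF i x]]
  moreover have "I i \<xi> = frame i \<xi> \<circ> (blk (J i (fst \<xi>)) \<circ> unframe i \<xi>)"
    by (rule ext) (simp add: block_field_eq[OF I i x])
  ultimately show ?thesis by simp
qed

lemma smooth_block_field:
  assumes I: "block_field I blk" and i: "i \<in> charts M"
  shows "smooth_on (\<lambda>\<xi>. I i \<xi> \<eta>) (cimg i \<times> UNIV)"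
proof -
  note o = open_cimg_prod[OF i]
  have b: "blk \<in> {block1, block2, block3}" using I by (simp add: block_field_def)
  have "smooth_on (\<lambda>\<xi>. blk (J i (fst \<xi>)) z) (cimg i \<times> (UNIV :: 'e dual set))" for z
    by (rule smooth_on_blk[OF o smooth_fst_comp[OF i smooth_J[OF i]] b])
  moreover have "linear (blk (J i (fst \<xi>)))" if "\<xi> \<in> cimg i \<times> (UNIV :: 'e dual set)" for \<xi>
    using linear_blk[OF linear_J[OF i] b] that by auto
  ultimately have "smooth_on (\<lambda>\<xi>. blk (J i (fst \<xi>)) (unframe i \<xi> \<eta>)) (cimg i \<times> UNIV)"
    by (rule smooth_on_apply[where L = "\<lambda>\<xi>. blk (J i (fst \<xi>))", OF o _ _ smooth_unframe[OF i]])
  moreover have "linear (frame i \<xi>)" if "\<xi> \<in> cimg i \<times> (UNIV :: 'e dual set)" for \<xi>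
    using linear_frame[OF i] that by auto
  ultimately have "smooth_on (\<lambda>\<xi>. frame i \<xi> (blk (J i (fst \<xi>)) (unframe i \<xi> \<eta>))) (cimg i \<times> UNIV)"
    by - (rule smooth_on_apply[where L = "frame i", OF o smooth_frame[OF i]])
  then show ?thesis by (rule smooth_on_cong[OF o, rotated]) (auto simp: block_field_eq[OF I i])
qed

lemma block_field_square:
  assumes I: "block_field I blk" and i: "i \<in> charts M" and x: "fst \<xi> \<in> cimg i"
  shows "I i \<xi> (I i \<xi> \<eta>) = - \<eta>"
proof -
  have b: "blk \<in> {block1, block2, block3}" using I by (simp add: block_field_def)
  show ?thesis
    using blk_blk[OF linear_J[OF i x] JJ[OF i x] b, of "unframe i \<xi> \<eta>"] i x
    by (simp add: block_field_eq[OF I i x] linear_neg[OF linear_frame[OF i x]])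
qed

lemma gc_frame_hermitian:
  assumes b: "blk \<in> {block1, block2, block3}" and i: "i \<in> charts M" and x: "fst \<xi> \<in> cimg i"
  shows "gc i \<xi> (frame i \<xi> (blk (J i (fst \<xi>)) z)) (frame i \<xi> (blk (J i (fst \<xi>)) z')) = gc i \<xi> (frame i \<xi> z) (frame i \<xi> z')"
  using b
  by (auto simp: cot_g_frame[OF i x] blk_defs g_JJ[OF i x] bilinear_lneg[OF bilinear_g[OF i x]] bilinear_rneg[OF bilinear_g[OF i x]])

lemma block_field_hermitian:
  assumes I: "block_field I blk" and i: "i \<in> charts M" and x: "fst \<xi> \<in> cimg i"
  shows "gc i \<xi> (I i \<xi> \<eta>) (I i \<xi> \<eta>') = gc i \<xi> \<eta> \<eta>'"
proof -
  have b: "blk \<in> {block1, block2, block3}" using I by (simp add: block_field_def)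
  show ?thesis
    using gc_frame_hermitian[OF b i x, of "unframe i \<xi> \<eta>" "unframe i \<xi> \<eta>'"] i x by (simp add: block_field_eq[OF I i x])
qed

lemma gc_sym:
  assumes i: "i \<in> charts M" and x: "fst \<xi> \<in> cimg i"
  shows "gc i \<xi> \<eta> \<eta>' = gc i \<xi> \<eta>' \<eta>"
  by (simp add: gc_eq[OF i x] g_sym[OF i x, of "fst \<eta>"] g_sym[OF i x, of "snd (unframe i \<xi> \<eta>)"])

lemma gc_pos:
  assumes i: "i \<in> charts M" and x: "fst \<xi> \<in> cimg i" and ne: "\<eta> \<noteq> 0"
  shows "gc i \<xi> \<eta> \<eta> > 0"
proof -
  have "unframe i \<xi> \<eta> \<noteq> 0"
    using ne frame_unframe[OF i x, of \<eta>] linear_0[OF linear_frame[OF i x]] by metis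
  then have "fst \<eta> \<noteq> 0 \<or> snd (unframe i \<xi> \<eta>) \<noteq> 0" by (metis fst_unframe prod.collapse zero_prod_def)
  moreover have "g i (fst \<xi>) u u \<ge> 0" for u
    using g_pos[OF i x, of u] bilinear_lzero[OF bilinear_g[OF i x], of u] by (cases "u = 0") auto
  ultimately show ?thesis
    using g_pos[OF i x] unfolding gc_eq[OF i x] by (metis add_nonneg_pos add_pos_nonneg)
qed

section \<open>Invariance of the block tensors under lifts\<close>

context
  fixes a L b c \<psi>
  assumes a: "smooth_map M M a" and L: "linear L" "\<And>m. m \<in> points M \<Longrightarrow> dev (a m) = L (dev m) + b"
    and \<psi>: "\<And>m w. m \<in> points M \<Longrightarrow> \<psi> (pt (m, w)) = pt (a m, L w + c)"
begin

text \<open>Starting from a bundle point instead of its coordinates \<open>(m, w)\<close>, with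
  \<open>Phi\<close> hidden, this brings \<open>lift_derivative\<close> into the shape of the
  \<open>maps_\<close> predicates.\<close>

lemma lift_frame:
  assumes i: "i \<in> charts M" and j: "j \<in> charts M" and \<xi>: "\<xi> \<in> cdom Ncot i" "\<psi> \<xi> \<in> cdom Ncot j"
  obtains m \<zeta> \<zeta>' where "m \<in> cdom M i" "a m \<in> cdom M j" "cmap Ncot i \<xi> = \<zeta>" "cmap Ncot j (\<psi> \<xi>) = \<zeta>'"
    "fst \<zeta> = cmap M i m" "fst \<zeta>' = cmap M j (a m)"
    "linear (Dd (local_rep M i M j a) (cmap M i m))"
    "\<forall>z. Dd (local_rep Ncot i Ncot j \<psi>) \<zeta> (frame i \<zeta> z) =
      frame j \<zeta>' (map_prod (Dd (local_rep M i M j a) (cmap M i m)) (Dd (local_rep M i M j a) (cmap M i m)) z)"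
proof -
  obtain m w where m: "m \<in> cdom M i" "\<xi> = pt (m, w)" using \<xi>(1) unfolding cdom_Ncot[OF i] by auto
  have p: "\<psi> \<xi> = pt (a m, L w + c)" using \<psi>[OF cdom_points[OF i m(1)]] m by simp
  have am: "a m \<in> cdom M j" using \<xi>(2) p pt_in_cdom_iff by simp
  have l: "linear (Dd (local_rep M i M j a) (cmap M i m))"
  proof (rule smooth_on_linear_Dd)
    show "smooth_on (local_rep M i M j a) (cmap M i ` {p \<in> cdom M i. a p \<in> cdom M j})"
      using a i j unfolding smooth_map_def by blast
    show "cmap M i m \<in> cmap M i ` {p \<in> cdom M i. a p \<in> cdom M j}"
      using m(1) am by blast
  qed
  show ?thesis
    by (rule that[OF m(1) am _ _ _ _ l, of "Phi i (cmap M i m, w)" "Phi j (cmap M j (a m), L w + c)"])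
      (simp_all add: m(2) p[unfolded m(2)] cmap_pt i j m(1) am lift_derivative[OF a L \<psi> i j m(1) am] map_prod_def split_beta)
qed

lemma lift_maps_endo:
  assumes I: "block_field I blk" and Ja: "maps_endo M J M J a"
  shows "maps_endo Ncot I Ncot I \<psi>"
  unfolding maps_endo_def Let_def Ncot_simps(1)
proof (intro ballI impI allI)
  fix i j \<xi> \<eta> assume i: "i \<in> charts M" and j: "j \<in> charts M" and \<xi>: "\<xi> \<in> cdom Ncot i" "\<psi> \<xi> \<in> cdom Ncot j"
  obtain m \<zeta> \<zeta>' where m: "m \<in> cdom M i" "a m \<in> cdom M j" "cmap Ncot i \<xi> = \<zeta>" "cmap Ncot j (\<psi> \<xi>) = \<zeta>'"
    "fst \<zeta> = cmap M i m" "fst \<zeta>' = cmap M j (a m)" and l: "linear (Dd (local_rep M i M j a) (cmap M i m))"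
    and D: "\<forall>z. Dd (local_rep Ncot i Ncot j \<psi>) \<zeta> (frame i \<zeta> z) =
      frame j \<zeta>' (map_prod (Dd (local_rep M i M j a) (cmap M i m)) (Dd (local_rep M i M j a) (cmap M i m)) z)"
    by (rule lift_frame[OF i j \<xi>])
  have b: "blk \<in> {block1, block2, block3}" using I by (simp add: block_field_def)
  have x: "fst \<zeta> \<in> cimg i" "fst \<zeta>' \<in> cimg j" using m by auto
  let ?D = "Dd (local_rep M i M j a) (cmap M i m)"
  have JD: "J j (fst \<zeta>') (?D u) = ?D (J i (fst \<zeta>) u)" for u
    using Ja i j m unfolding maps_endo_def Let_def by simp
  have "I j \<zeta>' (Dd (local_rep Ncot i Ncot j \<psi>) \<zeta> (frame i \<zeta> (unframe i \<zeta> \<eta>))) =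
      Dd (local_rep Ncot i Ncot j \<psi>) \<zeta> (I i \<zeta> (frame i \<zeta> (unframe i \<zeta> \<eta>)))"
    using blk_natural[where A' = "J j (fst \<zeta>')" and A = "J i (fst \<zeta>)", OF l JD b]
    by (simp add: D[rule_format] block_field_eq[OF I i x(1)] block_field_eq[OF I j x(2)] unframe_frame[OF i x(1)] unframe_frame[OF j x(2)])
  then show "I j (cmap Ncot j (\<psi> \<xi>)) (Dd (local_rep Ncot i Ncot j \<psi>) (cmap Ncot i \<xi>) \<eta>) =
      Dd (local_rep Ncot i Ncot j \<psi>) (cmap Ncot i \<xi>) (I i (cmap Ncot i \<xi>) \<eta>)"
    by (simp add: m(3,4) frame_unframe[OF i x(1)])
qed

lemma lift_maps_form2:
  assumes ga: "maps_form2 M g M g a"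
  shows "maps_form2 Ncot gc Ncot gc \<psi>"
  unfolding maps_form2_def Let_def Ncot_simps(1)
proof (intro ballI impI allI)
  fix i j \<xi> \<eta> \<eta>' assume i: "i \<in> charts M" and j: "j \<in> charts M" and \<xi>: "\<xi> \<in> cdom Ncot i" "\<psi> \<xi> \<in> cdom Ncot j"
  obtain m \<zeta> \<zeta>' where m: "m \<in> cdom M i" "a m \<in> cdom M j" "cmap Ncot i \<xi> = \<zeta>" "cmap Ncot j (\<psi> \<xi>) = \<zeta>'"
    "fst \<zeta> = cmap M i m" "fst \<zeta>' = cmap M j (a m)" and l: "linear (Dd (local_rep M i M j a) (cmap M i m))"
    and D: "\<forall>z. Dd (local_rep Ncot i Ncot j \<psi>) \<zeta> (frame i \<zeta> z) =
      frame j \<zeta>' (map_prod (Dd (local_rep M i M j a) (cmap M i m)) (Dd (local_rep M i M j a) (cmap M i m)) z)"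
    by (rule lift_frame[OF i j \<xi>])
  have x: "fst \<zeta> \<in> cimg i" "fst \<zeta>' \<in> cimg j" using m by auto
  let ?D = "Dd (local_rep M i M j a) (cmap M i m)"
  have gD: "g j (fst \<zeta>') (?D u) (?D v) = g i (fst \<zeta>) u v" for u v
    using ga i j m unfolding maps_form2_def Let_def by simp
  have "gc j \<zeta>' (Dd (local_rep Ncot i Ncot j \<psi>) \<zeta> (frame i \<zeta> (unframe i \<zeta> \<eta>))) (Dd (local_rep Ncot i Ncot j \<psi>) \<zeta> (frame i \<zeta> (unframe i \<zeta> \<eta>'))) =
      gc i \<zeta> (frame i \<zeta> (unframe i \<zeta> \<eta>)) (frame i \<zeta> (unframe i \<zeta> \<eta>'))"
    unfolding D[rule_format] cot_g_frame[OF i x(1)] cot_g_frame[OF j x(2)] by (simp add: gD)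
  then show "gc j (cmap Ncot j (\<psi> \<xi>)) (Dd (local_rep Ncot i Ncot j \<psi>) (cmap Ncot i \<xi>) \<eta>)
      (Dd (local_rep Ncot i Ncot j \<psi>) (cmap Ncot i \<xi>) \<eta>') = gc i (cmap Ncot i \<xi>) \<eta> \<eta>'"
    by (simp add: m(3,4) frame_unframe[OF i x(1)])
qed

end

lemma riemannian_gc: "riemannian_metric Ncot gc"
  unfolding riemannian_metric_def form2_field_def Ncot_simps(1)
proof (intro conjI ballI allI impI)
  have id: "\<And>m w. m \<in> points M \<Longrightarrow> id (pt (m, w)) = pt (id m, w + 0)" by simp
  show "maps_form2 Ncot gc Ncot gc id"
    by (rule lift_maps_form2[OF smooth_map_id linear_ident _ id maps_form2_id, of 0]) simp
  fix i assume i: "i \<in> charts M"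
  show "smooth_on (\<lambda>x. gc i x u v) (cmap Ncot i ` cdom Ncot i)" for u v
    unfolding Ncot_cimg[OF i] by (rule smooth_gc[OF i])
  fix \<xi> assume "\<xi> \<in> cmap Ncot i ` cdom Ncot i"
  then have x: "fst \<xi> \<in> cimg i" unfolding Ncot_cimg[OF i] by (simp add: mem_Times_iff)
  show "bilinear (gc i \<xi>)" by (rule bilinear_gc[OF i x])
  show "gc i \<xi> u v = gc i \<xi> v u" for u v by (rule gc_sym[OF i x])
  show "0 < gc i \<xi> u u" if "u \<noteq> 0" for u by (rule gc_pos[OF i x that])
qed

lemma endo_block_field:
  assumes I: "block_field I blk"
  shows "endo_field Ncot I"
  unfolding endo_field_def Ncot_simps(1)
proof (intro conjI ballI allI)
  have id: "\<And>m w. m \<in> points M \<Longrightarrow> id (pt (m, w)) = pt (id m, w + 0)" by simp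
  show "maps_endo Ncot I Ncot I id"
    by (rule lift_maps_endo[OF smooth_map_id linear_ident _ id I maps_endo_id, of 0]) simp
  fix i assume i: "i \<in> charts M"
  show "smooth_on (\<lambda>x. I i x u) (cmap Ncot i ` cdom Ncot i)" for u
    unfolding Ncot_cimg[OF i] by (rule smooth_block_field[OF I i])
  fix \<xi> assume "\<xi> \<in> cmap Ncot i ` cdom Ncot i"
  then have x: "fst \<xi> \<in> cimg i" unfolding Ncot_cimg[OF i] by (simp add: mem_Times_iff)
  show "linear (I i \<xi>)" by (rule linear_block_field[OF I i x])
qed

context
  fixes i X Y G assumes fc: "flat_chart i X Y G"
begin

private lemmas ci = fc_simps(1)[OF fc] and oY = fc_simps(4)[OF fc] and sG = fc_simps(10)[OF fc]
  and cGy = fc_simps(15)[OF fc] and clDG = fc_linear_DG[OF fc]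

text \<open>Flat coordinates on the cotangent bundle. The tensors pull back to the block tensors \<open>model_I\<close> and
  \<open>model_form\<close> with coefficients \<open>Bf\<close> and \<open>Jf\<close>, for which closedness and vanishing of the Nijenhuis
  tensor are computed.\<close>

definition Theta :: "'e \<times> 'e \<Rightarrow> 'e \<times> 'e dual" where
  "Theta z = Phi i (G (fst z), snd z)"

lemma fst_Theta [simp]: "fst (Theta z) = G (fst z)"
  by (simp add: Theta_def)

lemma open_Y_prod: "open (Y \<times> (UNIV :: 'f::topological_space set))"
  by (simp add: open_Times oY)

lemma smooth_G_fst: "smooth_on (\<lambda>z. G (fst z)) (Y \<times> (UNIV :: 'f::real_normed_vector set))"
  by (rule smooth_on_compose[OF open_Y_prod oY sG smooth_on_fst[OF open_Y_prod smooth_on_ident]]) auto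

lemma smooth_Theta: "smooth_on Theta (Y \<times> UNIV)"
  unfolding Theta_def[abs_def]
  by (rule smooth_on_compose[OF open_Y_prod open_cimg_prod[OF ci] smooth_Phi[OF ci]
        smooth_on_Pair[OF open_Y_prod smooth_G_fst smooth_on_snd[OF open_Y_prod smooth_on_ident]]])
    (use cGy in auto)

lemma Theta_image: "Theta ` (Y \<times> UNIV) \<subseteq> cimg i \<times> UNIV"
proof
  fix \<xi> assume "\<xi> \<in> Theta ` (Y \<times> UNIV)"
  then obtain z where "z \<in> Y \<times> UNIV" "\<xi> = Theta z" by blast
  then show "\<xi> \<in> cimg i \<times> UNIV" using cGy by (simp add: mem_Times_iff)
qed

text \<open>The fibre coordinate lives in the model space, and \<open>Dd_Phi\<close> expects it as
  the image of a tangent vector under the differential of \<open>F i\<close>; that tangent vector is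
  its image under \<open>Dd G\<close>. So both slots carry the same map.\<close>

lemma Dd_Theta:
  assumes z: "fst z \<in> Y"
  shows "Dd Theta z \<zeta> = frame i (Theta z) (map_prod (Dd G (fst z)) (Dd G (fst z)) \<zeta>)"
proof -
  have G': "((\<lambda>z. G (fst z)) has_derivative (\<lambda>\<zeta>. Dd G (fst z) (fst \<zeta>))) (at z)"
    using has_derivative_compose[OF bounded_linear_imp_has_derivative[OF bounded_linear_fst], of G "Dd G (fst z)" z UNIV]
      smooth_on_has_derivative[OF sG z] by simp
  have q: "((\<lambda>z. (G (fst z), snd z)) has_derivative (\<lambda>\<zeta>. (Dd G (fst z) (fst \<zeta>), snd \<zeta>))) (at z)"
    by (rule has_derivative_Pair[OF G' bounded_linear_imp_has_derivative[OF bounded_linear_snd]])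
  have P: "(Phi i has_derivative Dd (Phi i) (G (fst z), snd z)) (at (G (fst z), snd z))"
    by (rule smooth_on_has_derivative[OF smooth_Phi[OF ci]]) (use cGy z in simp)
  have "Dd Theta z = (\<lambda>\<zeta>. Dd (Phi i) (G (fst z), snd z) (Dd G (fst z) (fst \<zeta>), snd \<zeta>))"
    unfolding Theta_def[abs_def]
    by (rule Dd_eqI) (use has_derivative_compose[OF q, of "Phi i" "Dd (Phi i) (G (fst z), snd z)"] P in simp)
  then show ?thesis
    using Dd_Phi[OF ci, of "(G (fst z), snd z)" "Dd G (fst z) (fst \<zeta>)" "Dd G (fst z) (snd \<zeta>)"] cGy[OF z]
    by (simp add: fc_DF_DG[OF fc z] Theta_def map_prod_def split_beta)
qed

text \<open>Naturality yields tensor identities only for vectors in the image of the differential;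
  surjectivity extends them to all tangent vectors.\<close>

lemma Dd_Theta_surj:
  assumes x: "fst \<xi> \<in> X"
  obtains z where "fst z \<in> Y" "Theta z = \<xi>" "\<And>\<eta>. \<exists>\<zeta>. Dd Theta z \<zeta> = \<eta>"
proof -
  let ?z = "(F i (fst \<xi>), snd (Phi_inv i \<xi>))"
  have xi: "fst \<xi> \<in> cimg i" by (rule fc_simps(14)[OF fc x])
  have y: "fst ?z \<in> Y" using fc_simps(12)[OF fc x] by simp
  have T: "Theta ?z = \<xi>"
    using Phi_Phi_inv[OF ci xi] fc_simps(7)[OF fc x] by (simp add: Theta_def) (metis fst_Phi_inv prod.collapse)
  have "\<exists>\<zeta>. Dd Theta ?z \<zeta> = \<eta>" for \<eta>
  proof -
    let ?w = "unframe i \<xi> \<eta>" and ?D = "Dd (F i) (fst \<xi>)"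
    have "map_prod (Dd G (fst ?z)) (Dd G (fst ?z)) (?D (fst ?w), ?D (snd ?w)) = ?w"
      using fc_DG_DF[OF fc x] by (simp add: prod_eq_iff)
    then have "Dd Theta ?z (?D (fst ?w), ?D (snd ?w)) = frame i \<xi> ?w"
      unfolding Dd_Theta[OF y] T by (simp only:)
    then show ?thesis using frame_unframe[OF ci xi] by metis
  qed
  with y T show ?thesis by (rule that)
qed

section \<open>Integrability and closedness of the block tensors in flat coordinates\<close>

definition model_I :: "(('e \<Rightarrow> 'e) \<Rightarrow> 'e \<times> 'e \<Rightarrow> 'e \<times> 'e) \<Rightarrow> 'e \<times> 'e \<Rightarrow> 'e \<times> 'e \<Rightarrow> 'e \<times> 'e" where
  "model_I blk z = blk (Jf i G (fst z))"

definition DJ :: "'e \<Rightarrow> 'e \<Rightarrow> 'e \<Rightarrow> 'e" where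
  "DJ y r t = Dd (\<lambda>y. Jf i G y t) y r"

lemma smooth_Jf_fst: "smooth_on (\<lambda>z. Jf i G (fst z) t) (Y \<times> (UNIV :: 'f::real_normed_vector set))"
  by (rule smooth_on_compose[OF open_Y_prod oY smooth_Jf[OF fc] smooth_on_fst[OF open_Y_prod smooth_on_ident]]) auto

lemma smooth_model_I: "blk \<in> {block1, block2, block3} \<Longrightarrow> smooth_on (\<lambda>z. model_I blk z \<zeta>) (Y \<times> UNIV)"
  unfolding model_I_def by (rule smooth_on_blk[OF open_Y_prod smooth_Jf_fst])

lemma linear_model_I: "blk \<in> {block1, block2, block3} \<Longrightarrow> fst z \<in> Y \<Longrightarrow> linear (model_I blk z)"
  unfolding model_I_def by (rule linear_blk[OF linear_Jf[OF fc]])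

lemma Theta_model_I:
  assumes I: "block_field I blk" and z: "fst z \<in> Y"
  shows "I i (Theta z) (Dd Theta z \<zeta>) = Dd Theta z (model_I blk z \<zeta>)"
proof -
  have b: "blk \<in> {block1, block2, block3}" using I by (simp add: block_field_def)
  have JD: "J i (fst (Theta z)) (Dd G (fst z) u) = Dd G (fst z) (Jf i G (fst z) u)" for u
    by (simp add: DG_Jf[OF fc z])
  have x: "fst (Theta z) \<in> cimg i" using cGy[OF z] by simp
  have "I i (Theta z) (Dd Theta z \<zeta>) = frame i (Theta z) (blk (J i (fst (Theta z))) (map_prod (Dd G (fst z)) (Dd G (fst z)) \<zeta>))"
    unfolding Dd_Theta[OF z] using I ci x unfolding block_field_def by blast
  also have "blk (J i (fst (Theta z))) (map_prod (Dd G (fst z)) (Dd G (fst z)) \<zeta>) =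
      map_prod (Dd G (fst z)) (Dd G (fst z)) (model_I blk z \<zeta>)"
    unfolding model_I_def
    by (rule blk_natural[where A' = "J i (fst (Theta z))" and A = "Jf i G (fst z)", OF clDG[OF z] JD b])
  finally show ?thesis unfolding Dd_Theta[OF z] .
qed

lemma DJ_sym: "y \<in> Y \<Longrightarrow> DJ y r t = DJ y t r"
  unfolding DJ_def by (rule DJf_codazzi[OF fc])

text \<open>Differentiate J J = -1.\<close>

lemma DJ_Jf:
  assumes y: "y \<in> Y"
  shows "DJ y r (Jf i G y t) = - Jf i G y (DJ y r t)"
proof -
  have "((\<lambda>y. Jf i G y (Jf i G y t)) has_derivative (\<lambda>r. Dd (\<lambda>z. Jf i G z (Jf i G y t)) y r + Jf i G y (Dd (\<lambda>y. Jf i G y t) y r))) (at y)"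
    by (rule has_derivative_apply[where L = "Jf i G", OF oY y smooth_on_differentiable[OF smooth_Jf[OF fc] y]
          linear_Jf[OF fc] smooth_on_has_derivative[OF smooth_Jf[OF fc] y]])
  moreover have "Dd (\<lambda>y. Jf i G y (Jf i G y t)) y = Dd (\<lambda>y. - t) y"
    by (rule Dd_cong_open[OF oY y Jf_Jf[OF fc]])
  ultimately have "Dd (\<lambda>z. Jf i G z (Jf i G y t)) y r + Jf i G y (Dd (\<lambda>y. Jf i G y t) y r) = 0"
    by (simp add: Dd_eqI frechet_derivative_const fun_eq_iff)
  then show ?thesis unfolding DJ_def by (simp add: eq_neg_iff_add_eq_0)
qed

lemma DJ_Jf_left: "y \<in> Y \<Longrightarrow> DJ y (Jf i G y r) t = - Jf i G y (DJ y r t)"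
  using DJ_Jf DJ_sym by metis

lemma has_derivative_Jf_fst:
  assumes z: "fst z \<in> Y"
  shows "((\<lambda>z. Jf i G (fst z) t) has_derivative (\<lambda>\<zeta>. DJ (fst z) (fst \<zeta>) t)) (at (z :: 'e \<times> 'e))"
  unfolding DJ_def
  using has_derivative_compose[OF bounded_linear_imp_has_derivative[OF bounded_linear_fst], of "\<lambda>y. Jf i G y t" _ z UNIV]
    smooth_on_has_derivative[OF smooth_Jf[OF fc] z] by blast

lemma Dd_model_I:
  assumes z: "fst z \<in> Y"
  shows "Dd (\<lambda>z. model_I block1 z \<zeta>) z \<delta> = (DJ (fst z) (fst \<delta>) (fst \<zeta>), - DJ (fst z) (fst \<delta>) (snd \<zeta>))"
    "Dd (\<lambda>z. model_I block2 z \<zeta>) z \<delta> = 0"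
    "Dd (\<lambda>z. model_I block3 z \<zeta>) z \<delta> = (- DJ (fst z) (fst \<delta>) (snd \<zeta>), - DJ (fst z) (fst \<delta>) (fst \<zeta>))"
proof -
  note d = has_derivative_Jf_fst[OF z]
  show "Dd (\<lambda>z. model_I block1 z \<zeta>) z \<delta> = (DJ (fst z) (fst \<delta>) (fst \<zeta>), - DJ (fst z) (fst \<delta>) (snd \<zeta>))"
    using Dd_eqI[OF has_derivative_Pair[OF d[of "fst \<zeta>"] has_derivative_minus[OF d[of "snd \<zeta>"]]]]
    by (simp add: model_I_def blk_defs)
  show "Dd (\<lambda>z. model_I block2 z \<zeta>) z \<delta> = 0"
    by (simp add: model_I_def blk_defs frechet_derivative_const)
  show "Dd (\<lambda>z. model_I block3 z \<zeta>) z \<delta> = (- DJ (fst z) (fst \<delta>) (snd \<zeta>), - DJ (fst z) (fst \<delta>) (fst \<zeta>))"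
    using Dd_eqI[OF has_derivative_Pair[OF has_derivative_minus[OF d[of "snd \<zeta>"]] has_derivative_minus[OF d[of "fst \<zeta>"]]]]
    by (simp add: model_I_def blk_defs)
qed

text \<open>\<open>DJ_Jf_left\<close> brings every J out in front of a derivative of J, after which
  the terms cancel, partly by the symmetry \<open>DJ_sym\<close>. The second block has constant
  coefficients.\<close>

lemma nijenhuis_model_I:
  assumes b: "blk \<in> {block1, block2, block3}" and z: "fst z \<in> Y"
  shows "nijenhuis (model_I blk) (\<lambda>_. u) (\<lambda>_. v) z = 0"
proof -
  note lJ = linear_Jf[OF fc z]
  have lD: "DJ (fst z) (- r) t = - DJ (fst z) r t" for r t
    unfolding DJ_def by (rule linear_neg[OF smooth_on_linear_Dd[OF smooth_Jf[OF fc] z]])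
  note s = DJ_sym[OF z, of "fst v" "fst u"] DJ_sym[OF z, of "snd v" "snd u"]
    DJ_sym[OF z, of "snd v" "fst u"] DJ_sym[OF z, of "snd u" "fst v"]
  show ?thesis
    unfolding nijenhuis_const[where J = "model_I blk" and x = z, OF linear_model_I[OF b z]]
    using b s
    by (auto simp: Dd_model_I[OF z] linear_0[OF linear_model_I[OF b z]] prod_eq_iff)
      (auto simp: model_I_def blk_defs DJ_Jf_left[OF z] linear_neg[OF lJ] lD)
qed

lemma gc_Theta:
  assumes z: "fst z \<in> Y"
  shows "gc i (Theta z) (Dd Theta z \<zeta>) (Dd Theta z \<zeta>') =
    Bf (fst \<zeta>) (Jf i G (fst z) (fst \<zeta>')) + Bf (snd \<zeta>) (Jf i G (fst z) (snd \<zeta>'))"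
  unfolding Dd_Theta[OF z] using cGy[OF z] by (simp add: cot_g_frame ci Bf_Jf[OF fc z])

definition model_form :: "(('e \<Rightarrow> 'e) \<Rightarrow> 'e \<times> 'e \<Rightarrow> 'e \<times> 'e) \<Rightarrow> 'e \<times> 'e \<Rightarrow> 'e \<times> 'e \<Rightarrow> 'e \<times> 'e \<Rightarrow> real" where
  "model_form blk z \<zeta> \<zeta>' = Bf (fst (model_I blk z \<zeta>)) (Jf i G (fst z) (fst \<zeta>')) + Bf (snd (model_I blk z \<zeta>)) (Jf i G (fst z) (snd \<zeta>'))"

lemma Bf_JJ: "y \<in> Y \<Longrightarrow> Bf (Jf i G y s) (Jf i G y t) = Bf s t"
  using Bf_Jf_sym[OF fc, of y "Jf i G y s" t] Bf_alt[of s t]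
  by (simp add: Jf_Jf[OF fc] bilinear_rneg[OF Bf(1)])

text \<open>For the first and third blocks \<open>Bf_JJ\<close> removes J from both arguments and
  leaves constant coefficients. For the second block J stays in one argument.\<close>

lemma model_form_closed:
  assumes b: "blk \<in> {block1, block2, block3}" and z: "fst z \<in> Y"
  shows "Dd (\<lambda>y. model_form blk y v w) z u + Dd (\<lambda>y. model_form blk y w u) z v + Dd (\<lambda>y. model_form blk y u v) z w = 0"
proof -
  have zS: "z \<in> Y \<times> UNIV" using z by (simp add: mem_Times_iff)
  have d1: "Dd (\<lambda>y. model_form block1 y v w) z u = 0" for u v w
  proof -
    have "Dd (\<lambda>y. model_form block1 y v w) z = Dd (\<lambda>y. Bf (fst v) (fst w) - Bf (snd v) (snd w)) z"
      by (rule Dd_cong_open[OF open_Y_prod zS])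
        (auto simp: model_form_def model_I_def blk_defs Bf_JJ bilinear_lneg[OF Bf(1)])
    then show ?thesis by (simp add: frechet_derivative_const)
  qed
  have d3: "Dd (\<lambda>y. model_form block3 y v w) z u = 0" for u v w
  proof -
    have "Dd (\<lambda>y. model_form block3 y v w) z = Dd (\<lambda>y. - Bf (snd v) (fst w) - Bf (fst v) (snd w)) z"
      by (rule Dd_cong_open[OF open_Y_prod zS])
        (auto simp: model_form_def model_I_def blk_defs Bf_JJ bilinear_lneg[OF Bf(1)])
    then show ?thesis by (simp add: frechet_derivative_const)
  qed
  have d2: "Dd (\<lambda>y. model_form block2 y v w) z u =
      - Bf (snd v) (DJ (fst z) (fst u) (fst w)) + Bf (fst v) (DJ (fst z) (fst u) (snd w))" for u v w
  proof -
    have "((\<lambda>y. model_form block2 y v w) has_derivative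
        (\<lambda>u. Bf (- snd v) (DJ (fst z) (fst u) (fst w)) + Bf (fst v) (DJ (fst z) (fst u) (snd w)))) (at z)"
      unfolding model_form_def model_I_def blk_defs fst_conv snd_conv
      by (intro has_derivative_add bounded_linear.has_derivative[OF linear_imp_bounded_linear[OF bilinear_linear_right[OF Bf(1)]]]
          has_derivative_Jf_fst[OF z])
    then show ?thesis by (simp add: Dd_eqI bilinear_lneg[OF Bf(1)])
  qed
  have c12: "Bf s (DJ (fst z) r t) = Bf r (DJ (fst z) s t)" for s r t
    unfolding DJ_def by (rule Bf_DJf_sym12[OF fc z])
  \<comment> \<open>The trilinear form Bf(s, DJ r t) is totally symmetric, so each negative term of
    one cyclic position equals a positive term of another.\<close>
  have sum2: "Dd (\<lambda>y. model_form block2 y v w) z u + Dd (\<lambda>y. model_form block2 y w u) z v + Dd (\<lambda>y. model_form block2 y u v) z w = 0"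
    unfolding d2
    using c12[of "snd v" "fst u" "fst w"] c12[of "snd w" "fst v" "fst u"] c12[of "snd u" "fst w" "fst v"]
      DJ_sym[OF z, of "snd v" "fst w"] DJ_sym[OF z, of "snd w" "fst u"] DJ_sym[OF z, of "snd u" "fst v"]
    by simp
  consider "blk = block1" | "blk = block2" | "blk = block3" using b by blast
  then show ?thesis by cases (simp_all only: d1 d3 sum2 add_0)
qed

lemma model_form_Theta:
  assumes I: "block_field I blk" and z: "fst z \<in> Y"
  shows "kaehler_form gc I i (Theta z) (Dd Theta z \<zeta>) (Dd Theta z \<zeta>') = model_form blk z \<zeta> \<zeta>'"
  unfolding kaehler_form_def Theta_model_I[OF I z] gc_Theta[OF z] model_form_def ..

end

text \<open>At a given bundle point all tangent vectors are written as images under the differential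
  of \<open>Theta\<close>; the Nijenhuis tensor and the exterior derivative are then those of the
  model.\<close>

lemma kaehler_block_field:
  assumes I: "block_field I blk"
  shows "kaehler_manifold Ncot I gc"
proof -
  have b: "blk \<in> {block1, block2, block3}" using I by (simp add: block_field_def)
  have bil: "bilinear (kaehler_form gc I i \<xi>)" if i: "i \<in> charts M" and x: "fst \<xi> \<in> cimg i" for i \<xi>
    using linear_compose[OF linear_block_field[OF I i x] bilinear_linear_left[OF bilinear_gc[OF i x]]]
      bilinear_linear_right[OF bilinear_gc[OF i x]]
    unfolding bilinear_def kaehler_form_def o_def by blast
  have sm: "smooth_on (\<lambda>\<xi>. kaehler_form gc I i \<xi> s t) (cimg i \<times> UNIV)" if i: "i \<in> charts M" for i s t
    unfolding kaehler_form_def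
  proof (rule smooth_on_apply[where L = "\<lambda>\<xi> s. gc i \<xi> s t", OF open_cimg_prod[OF i] smooth_gc[OF i] _ smooth_block_field[OF I i]])
    show "linear (\<lambda>s. gc i \<xi> s t)" if "\<xi> \<in> cimg i \<times> UNIV" for \<xi>
      using bilinear_linear_left[OF bilinear_gc[OF i, of \<xi>]] that by (auto simp: mem_Times_iff)
  qed
  \<comment> \<open>Apply the hermitian property to \<open>I s\<close> and \<open>t\<close>, and use
    that \<open>I\<close> squares to -1.\<close>
  have alt: "kaehler_form gc I i \<xi> s t = - kaehler_form gc I i \<xi> t s" if i: "i \<in> charts M" and x: "fst \<xi> \<in> cimg i" for i \<xi> s t
  proof -
    have "gc i \<xi> (I i \<xi> s) t = gc i \<xi> (I i \<xi> (I i \<xi> s)) (I i \<xi> t)" by (rule block_field_hermitian[OF I i x, symmetric])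
    also have "\<dots> = - gc i \<xi> (I i \<xi> t) s"
      unfolding block_field_square[OF I i x] bilinear_lneg[OF bilinear_gc[OF i x]] by (simp add: gc_sym[OF i x])
    finally show ?thesis unfolding kaehler_form_def .
  qed
  have nij: "nijenhuis (I i) (\<lambda>_. u) (\<lambda>_. v) \<xi> = 0"
    and cl: "Dd (\<lambda>y. kaehler_form gc I i y v w) \<xi> u + Dd (\<lambda>y. kaehler_form gc I i y w u) \<xi> v
        + Dd (\<lambda>y. kaehler_form gc I i y u v) \<xi> w = 0"
    if i: "i \<in> charts M" and x: "fst \<xi> \<in> cimg i" for i \<xi> u v w
  proof -
    obtain X Y G where fc: "flat_chart i X Y G" "fst \<xi> \<in> X" by (rule ex_flat_chart[OF i x])
    show "nijenhuis (I i) (\<lambda>_. u) (\<lambda>_. v) \<xi> = 0"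
    proof (rule Dd_Theta_surj[OF fc])
      fix z assume z: "fst z \<in> Y" "Theta i G z = \<xi>" "\<And>\<eta>. \<exists>\<zeta>. Dd (Theta i G) z \<zeta> = \<eta>"
      obtain u' v' where uv: "u = Dd (Theta i G) z u'" "v = Dd (Theta i G) z v'" using z(3) by metis
      have zS: "z \<in> Y \<times> UNIV" using z(1) by (simp add: mem_Times_iff)
      have "nijenhuis (I i) (\<lambda>_. Dd (Theta i G) z u') (\<lambda>_. Dd (Theta i G) z v') (Theta i G z) =
          Dd (Theta i G) z (nijenhuis (model_I i G blk) (\<lambda>_. u') (\<lambda>_. v') z)"
      proof (rule nijenhuis_natural[OF open_Y_prod[OF fc(1)] open_cimg_prod[OF i] smooth_Theta[OF fc(1)] Theta_image[OF fc(1)] zS])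
        show "linear (I i y)" if "y \<in> cimg i \<times> UNIV" for y
          using linear_block_field[OF I i, of y] that by (simp add: mem_Times_iff)
        show "smooth_on (\<lambda>y. I i y t) (cimg i \<times> UNIV)" for t by (rule smooth_block_field[OF I i])
        show "linear (model_I i G blk y)" if "y \<in> Y \<times> UNIV" for y
          using linear_model_I[OF fc(1) b, of y] that by (simp add: mem_Times_iff)
        show "smooth_on (\<lambda>y. model_I i G blk y t) (Y \<times> UNIV)" for t by (rule smooth_model_I[OF fc(1) b])
        show "I i (Theta i G y) (Dd (Theta i G) y u) = Dd (Theta i G) y (model_I i G blk y u)" if "y \<in> Y \<times> UNIV" for y u
          using Theta_model_I[OF fc(1) I, of y] that by (simp add: mem_Times_iff)
      qed
      then show ?thesis
        unfolding uv[symmetric] z(2) nijenhuis_model_I[OF fc(1) b z(1)]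
        by (simp add: linear_0[OF smooth_on_linear_Dd[OF smooth_Theta[OF fc(1)] zS]])
    qed
    show "Dd (\<lambda>y. kaehler_form gc I i y v w) \<xi> u + Dd (\<lambda>y. kaehler_form gc I i y w u) \<xi> v
        + Dd (\<lambda>y. kaehler_form gc I i y u v) \<xi> w = 0"
    proof (rule Dd_Theta_surj[OF fc])
      fix z assume z: "fst z \<in> Y" "Theta i G z = \<xi>" "\<And>\<eta>. \<exists>\<zeta>. Dd (Theta i G) z \<zeta> = \<eta>"
      obtain u' v' w' where uv: "u = Dd (Theta i G) z u'" "v = Dd (Theta i G) z v'" "w = Dd (Theta i G) z w'"
        using z(3) by metis
      have zS: "z \<in> Y \<times> UNIV" using z(1) by (simp add: mem_Times_iff)
      show ?thesis unfolding uv z(2)[symmetric]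
      proof (rule closed_natural[OF open_Y_prod[OF fc(1)] open_cimg_prod[OF i] smooth_Theta[OF fc(1)] Theta_image[OF fc(1)] zS])
        show "bilinear (kaehler_form gc I i y)" if "y \<in> cimg i \<times> UNIV" for y
          using bil[OF i, of y] that by (simp add: mem_Times_iff)
        show "smooth_on (\<lambda>y. kaehler_form gc I i y s t) (cimg i \<times> UNIV)" for s t by (rule sm[OF i])
        show "kaehler_form gc I i (Theta i G z) s t = - kaehler_form gc I i (Theta i G z) t s" for s t
          unfolding z(2) by (rule alt[OF i x])
        show "kaehler_form gc I i (Theta i G y) (Dd (Theta i G) y u) (Dd (Theta i G) y v) = model_form i G blk y u v"
          if "y \<in> Y \<times> UNIV" for y u v
          using model_form_Theta[OF fc(1) I, of y] that by (simp add: mem_Times_iff)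
        show "Dd (\<lambda>y. model_form i G blk y v' w') z u' + Dd (\<lambda>y. model_form i G blk y w' u') z v' + Dd (\<lambda>y. model_form i G blk y u' v') z w' = 0"
          by (rule model_form_closed[OF fc(1) b z(1)])
      qed
    qed
  qed
  show ?thesis
    unfolding kaehler_manifold_def complex_structure_def closed_form2_def Ncot_simps(1)
  proof (intro conjI ballI allI smooth_manifold_Ncot riemannian_gc endo_block_field[OF I])
    fix i \<xi> assume i: "i \<in> charts M" and xi: "\<xi> \<in> cmap Ncot i ` cdom Ncot i"
    then have x: "fst \<xi> \<in> cimg i" unfolding Ncot_cimg[OF i] by (simp add: mem_Times_iff)
    show "I i \<xi> (I i \<xi> u) = - u" for u by (rule block_field_square[OF I i x])
    show "nijenhuis (I i) (\<lambda>_. u) (\<lambda>_. v) \<xi> = 0" for u v by (rule nij[OF i x])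
    show "gc i \<xi> (I i \<xi> u) (I i \<xi> v) = gc i \<xi> u v" for u v by (rule block_field_hermitian[OF I i x])
    show "Dd (\<lambda>y. kaehler_form gc I i y v w) \<xi> u + Dd (\<lambda>y. kaehler_form gc I i y w u) \<xi> v
        + Dd (\<lambda>y. kaehler_form gc I i y u v) \<xi> w = 0" for u v w by (rule cl[OF i x])
  qed
qed

lemma hyperkaehler_Ncot: "hyperkaehler Ncot (cot_I1 J C) (cot_I2 om C) (cot_I3 J om C) gc"
  unfolding hyperkaehler_def Ncot_simps(1)
proof (intro conjI ballI allI)
  show "kaehler_manifold Ncot (cot_I1 J C) gc" by (rule kaehler_block_field[OF block_cot_I1])
  show "kaehler_manifold Ncot (cot_I2 om C) gc" by (rule kaehler_block_field[OF block_cot_I2])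
  show "kaehler_manifold Ncot (cot_I3 J om C) gc" by (rule kaehler_block_field[OF block_cot_I3])
  fix i \<xi> w assume i: "i \<in> charts M" and xi: "\<xi> \<in> cmap Ncot i ` cdom Ncot i"
  then have x: "fst \<xi> \<in> cimg i" unfolding Ncot_cimg[OF i] by (simp add: mem_Times_iff)
  show "cot_I1 J C i \<xi> (cot_I2 om C i \<xi> w) = cot_I3 J om C i \<xi> w" by (simp add: cot_I3_def)
  have "cot_I2 om C i \<xi> (cot_I1 J C i \<xi> (frame i \<xi> (unframe i \<xi> w))) = - cot_I3 J om C i \<xi> (frame i \<xi> (unframe i \<xi> w))"
    unfolding cot_I1_frame[OF i x] cot_I2_frame[OF i x] cot_I3_frame[OF i x] linear_neg[OF linear_frame[OF i x], symmetric] by simp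
  then show "cot_I2 om C i \<xi> (cot_I1 J C i \<xi> w) = - cot_I3 J om C i \<xi> w" unfolding frame_unframe[OF i x] .
qed

section \<open>The action of the affine group\<close>

abbreviation "psi \<equiv> psi_hat M dev om"
abbreviation "th \<equiv> theta_hat M dev om"
abbreviation "Hcot \<equiv> affine_semidirect isoG th"

lemma theta_hat_eq: "th a v = flat_map Bf (theta M dev a (sharp_map Bf v))"
  by (simp add: theta_hat_def Bf_def)

lemma cot_point_pt: "cot_point M dev (m, v) = pt (m, sharp_map Bf v)"
  by (simp add: pt_def)

text \<open>The conjugation by \<open>flat_map Bf\<close> in \<open>theta_hat\<close> is undone by
  the fibre coordinate w, so base and fibre transform by the same affine action up to a
  translation.\<close>

lemma psi_pt:
  assumes m: "m \<in> points M"
  shows "psi (a, u) (pt (m, w)) = pt (a m, theta M dev a w + sharp_map Bf u)"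
proof -
  have inj: "inj_on (cot_point M dev) (points M \<times> UNIV)"
  proof (rule inj_onI)
    fix z z' assume z: "z \<in> points M \<times> UNIV" "z' \<in> points M \<times> UNIV" and eq: "cot_point M dev z = cot_point M dev z'"
    have "pt (fst z, sharp_map Bf (snd z)) = pt (fst z', sharp_map Bf (snd z'))"
      using eq cot_point_pt by (metis prod.collapse)
    then have "(fst z, sharp_map Bf (snd z)) = (fst z', sharp_map Bf (snd z'))"
      using z by (intro inj_onD[OF pt_inj]) (auto simp: mem_Times_iff)
    then have "fst z = fst z'" "sharp_map Bf (snd z) = sharp_map Bf (snd z')" by auto
    then show "z = z'" using Bf.flat_sharp by (metis prod_eqI)
  qed
  have "pt (m, w) = cot_point M dev (m, flat_map Bf w)" by (simp add: cot_point_pt)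
  then have inv: "inv_into (points M \<times> UNIV) (cot_point M dev) (pt (m, w)) = (m, flat_map Bf w)"
    using inv_into_f_f[OF inj, of "(m, flat_map Bf w)"] m by simp
  have "pt (m, w) \<in> points Ncot" using m by (simp add: points_Ncot)
  then show ?thesis
    by (simp add: psi_hat_def Ncot_def[symmetric] inv cot_point_pt theta_hat_eq linear_add[OF Bf.sharp_linear])
qed

lemma psi_extensional: "psi h \<in> extensional (points Ncot)"
  by (cases h) (simp add: psi_hat_def Ncot_def)

lemma carrier_isom: "a \<in> carrier isoG \<Longrightarrow> isom a" and carrier_Bij: "a \<in> carrier isoG \<Longrightarrow> a \<in> Bij (points M)"
  by (simp_all add: carrier_isoG)

lemma isoG_points: "a \<in> carrier isoG \<Longrightarrow> m \<in> points M \<Longrightarrow> a m \<in> points M"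
  using Bij_imp_funcset[OF carrier_Bij] by blast

lemma linear_part_theta_hat:
  assumes "linear L" "theta M dev a = (\<lambda>x. L x + b)"
  shows "linear_part (th a) v = flat_map Bf (L (sharp_map Bf v))"
  by (simp add: linear_part_def theta_hat_eq assms linear_0[OF Bf.sharp_linear] linear_0[OF assms(1)] linear_add[OF Bf.flat_linear])

lemma linear_linear_part_theta_hat:
  assumes a: "a \<in> carrier isoG"
  shows "linear (linear_part (th a))"
proof -
  obtain L b where L: "linear L" "theta M dev a = (\<lambda>x. L x + b)" by (rule iso_theta[OF carrier_isom[OF a]], rule that; (assumption | blast))
  have "linear_part (th a) = flat_map Bf \<circ> (L \<circ> sharp_map Bf)" by (rule ext) (simp add: linear_part_theta_hat[OF L])
  then show ?thesis using linear_compose[OF linear_compose[OF Bf.sharp_linear L(1)] Bf.flat_linear] by simp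
qed

lemma theta_add:
  assumes a: "a \<in> carrier isoG"
  shows "theta M dev a (w + sharp_map Bf u) = theta M dev a w + sharp_map Bf (linear_part (th a) u)"
proof -
  obtain L b where L: "linear L" "theta M dev a = (\<lambda>x. L x + b)" by (rule iso_theta[OF carrier_isom[OF a]], rule that; (assumption | blast))
  show ?thesis by (simp add: linear_part_theta_hat[OF L]) (simp add: L(2) linear_add[OF L(1)])
qed

text \<open>The composite of the two affine maps satisfies the equation that defines
  \<open>theta\<close> of the product, and \<open>theta_eq\<close> gives uniqueness.\<close>

lemma theta_mult:
  assumes a: "a \<in> carrier isoG" and b: "b \<in> carrier isoG"
  shows "theta M dev (a \<otimes>\<^bsub>isoG\<^esub> b) x = theta M dev a (theta M dev b x)"
    "linear_part (th (a \<otimes>\<^bsub>isoG\<^esub> b)) v = linear_part (th a) (linear_part (th b) v)"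
proof -
  obtain La ba where La: "linear La" "theta M dev a = (\<lambda>x. La x + ba)"
    "\<And>m. m \<in> points M \<Longrightarrow> dev (a m) = La (dev m) + ba" by (rule iso_theta[OF carrier_isom[OF a]], rule that; (assumption | blast))
  obtain Lb bb where Lb: "linear Lb" "theta M dev b = (\<lambda>x. Lb x + bb)"
    "\<And>m. m \<in> points M \<Longrightarrow> dev (b m) = Lb (dev m) + bb" by (rule iso_theta[OF carrier_isom[OF b]], rule that; (assumption | blast))
  have l: "linear (\<lambda>x. La (Lb x))" using linear_compose[OF Lb(1) La(1)] by (simp add: o_def)
  have "theta M dev (a \<otimes>\<^bsub>isoG\<^esub> b) = (\<lambda>x. La (Lb x) + (La bb + ba))"
    by (rule theta_eq[OF l])
      (simp add: isoG_mult[OF a b] compose_def La(3) Lb(3) isoG_points[OF b] linear_add[OF La(1)])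
  note ab = l this
  show "theta M dev (a \<otimes>\<^bsub>isoG\<^esub> b) x = theta M dev a (theta M dev b x)"
    by (simp add: ab(2) La(2) Lb(2) linear_add[OF La(1)])
  show "linear_part (th (a \<otimes>\<^bsub>isoG\<^esub> b)) v = linear_part (th a) (linear_part (th b) v)"
    by (simp add: linear_part_theta_hat[OF ab] linear_part_theta_hat[OF La(1,2)] linear_part_theta_hat[OF Lb(1,2)])
qed

lemma theta_one: "theta M dev \<one>\<^bsub>isoG\<^esub> x = x" "linear_part (th \<one>\<^bsub>isoG\<^esub>) v = v"
proof -
  have "theta M dev \<one>\<^bsub>isoG\<^esub> = (\<lambda>x. x + 0)"
    by (rule theta_eq[OF linear_ident]) (simp add: isoG_one)
  note o = this
  show "theta M dev \<one>\<^bsub>isoG\<^esub> x = x" by (simp add: o)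
  show "linear_part (th \<one>\<^bsub>isoG\<^esub>) v = v" by (simp add: linear_part_theta_hat[OF linear_ident o])
qed

section \<open>The semidirect product and its action on the bundle\<close>

interpretation isoG: group isoG by (rule group_isoG)

lemma Hcot_simps: "carrier Hcot = carrier isoG \<times> UNIV" "\<one>\<^bsub>Hcot\<^esub> = (\<one>\<^bsub>isoG\<^esub>, 0)"
  "(a, u) \<otimes>\<^bsub>Hcot\<^esub> (b, w) = (a \<otimes>\<^bsub>isoG\<^esub> b, u + linear_part (th a) w)"
  by (simp_all add: affine_semidirect_def)

lemma group_Hcot: "group Hcot"
proof (rule groupI)
  show "\<one>\<^bsub>Hcot\<^esub> \<in> carrier Hcot" by (simp add: Hcot_simps)
  fix x assume x: "x \<in> carrier Hcot"
  obtain a u where au: "x = (a, u)" "a \<in> carrier isoG" using x by (auto simp: Hcot_simps)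
  show "\<one>\<^bsub>Hcot\<^esub> \<otimes>\<^bsub>Hcot\<^esub> x = x" using au by (simp add: Hcot_simps theta_one)
  \<comment> \<open>The left inverse has first entry the inverse of \<open>a\<close>; its second
    entry is the vector that cancels the image of \<open>u\<close> under the linear part of that
    inverse.\<close>
  show "\<exists>y\<in>carrier Hcot. y \<otimes>\<^bsub>Hcot\<^esub> x = \<one>\<^bsub>Hcot\<^esub>"
    using au by (intro bexI[of _ "(m_inv isoG a, - linear_part (th (m_inv isoG a)) u)"]) (simp_all add: Hcot_simps)
  fix y assume y: "y \<in> carrier Hcot"
  obtain b w where bw: "y = (b, w)" "b \<in> carrier isoG" using y by (auto simp: Hcot_simps)
  show "x \<otimes>\<^bsub>Hcot\<^esub> y \<in> carrier Hcot" using au bw by (simp add: Hcot_simps)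
  fix z assume z: "z \<in> carrier Hcot"
  obtain c v where cv: "z = (c, v)" "c \<in> carrier isoG" using z by (auto simp: Hcot_simps)
  show "x \<otimes>\<^bsub>Hcot\<^esub> y \<otimes>\<^bsub>Hcot\<^esub> z = x \<otimes>\<^bsub>Hcot\<^esub> (y \<otimes>\<^bsub>Hcot\<^esub> z)"
    using au bw cv by (simp add: Hcot_simps isoG.m_assoc theta_mult linear_add[OF linear_linear_part_theta_hat])
qed

interpretation H: group Hcot by (rule group_Hcot)

lemma psi_points: "h \<in> carrier Hcot \<Longrightarrow> \<xi> \<in> points Ncot \<Longrightarrow> psi h \<xi> \<in> points Ncot"
  using isoG_points by (auto simp: points_Ncot Hcot_simps psi_pt)

lemma psi_mult:
  assumes h: "h \<in> carrier Hcot" "k \<in> carrier Hcot" and \<xi>: "\<xi> \<in> points Ncot"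
  shows "psi (h \<otimes>\<^bsub>Hcot\<^esub> k) \<xi> = psi h (psi k \<xi>)"
proof -
  obtain a u b w where au: "h = (a, u)" "a \<in> carrier isoG" and bw: "k = (b, w)" "b \<in> carrier isoG"
    using h by (auto simp: Hcot_simps)
  obtain m s where m: "m \<in> points M" "\<xi> = pt (m, s)" using \<xi> by (auto simp: points_Ncot)
  have "(a \<otimes>\<^bsub>isoG\<^esub> b) m = a (b m)" using m(1) by (simp add: isoG_mult[OF au(2) bw(2)] compose_def)
  then show ?thesis
    using au bw m isoG_points[OF bw(2) m(1)]
    by (simp add: Hcot_simps psi_pt theta_mult theta_add linear_add[OF Bf.sharp_linear] add_ac)
qed

lemma psi_one: "\<xi> \<in> points Ncot \<Longrightarrow> psi \<one>\<^bsub>Hcot\<^esub> \<xi> = \<xi>"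
proof -
  assume "\<xi> \<in> points Ncot"
  then obtain m s where m: "m \<in> points M" "\<xi> = pt (m, s)" by (auto simp: points_Ncot)
  have "\<one>\<^bsub>isoG\<^esub> m = m" using m(1) by (simp add: isoG_one)
  then show ?thesis using m by (simp add: Hcot_simps psi_pt theta_one linear_0[OF Bf.sharp_linear])
qed

lemma psi_inverse:
  assumes h: "h \<in> carrier Hcot" and \<xi>: "\<xi> \<in> points Ncot"
  shows "psi (m_inv Hcot h) (psi h \<xi>) = \<xi>" "psi h (psi (m_inv Hcot h) \<xi>) = \<xi>"
  using psi_mult[OF H.inv_closed[OF h] h \<xi>] psi_mult[OF h H.inv_closed[OF h] \<xi>] psi_one[OF \<xi>] h by simp_all

lemma psi_bij: "h \<in> carrier Hcot \<Longrightarrow> bij_betw (psi h) (points Ncot) (points Ncot)"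
  by (rule bij_betw_byWitness[of _ "psi (m_inv Hcot h)"])
    (auto simp: psi_inverse psi_points)

text \<open>Permutations of a carrier are extensional functions. As \<open>psi_hat\<close> is
  restricted to the bundle, the homomorphism law need only be checked on bundle points.\<close>

lemma group_action_psi: "group_action Hcot (points Ncot) psi"
  unfolding group_action_def group_hom_def group_hom_axioms_def
proof (intro conjI group_Hcot group_BijGroup)
  have B: "psi h \<in> Bij (points Ncot)" if "h \<in> carrier Hcot" for h
    using psi_bij[OF that] psi_extensional by (simp add: Bij_def)
  show "psi \<in> hom Hcot (BijGroup (points Ncot))"
  proof (rule homI)
    fix h assume h: "h \<in> carrier Hcot"
    show "psi h \<in> carrier (BijGroup (points Ncot))" using B[OF h] by (simp add: BijGroup_def)
    fix k assume k: "k \<in> carrier Hcot"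
    have "psi (h \<otimes>\<^bsub>Hcot\<^esub> k) = compose (points Ncot) (psi h) (psi k)"
      by (rule extensionalityI[OF psi_extensional compose_extensional]) (simp add: psi_mult[OF h k] compose_def)
    then show "psi (h \<otimes>\<^bsub>Hcot\<^esub> k) = psi h \<otimes>\<^bsub>BijGroup (points Ncot)\<^esub> psi k"
      using B[OF h] B[OF k] by (simp add: BijGroup_def)
  qed
qed

lemma psi_smooth_maps:
  assumes h: "h \<in> carrier Hcot"
  shows "smooth_map Ncot Ncot (psi h)" "maps_form2 Ncot gc Ncot gc (psi h)"
    "\<And>I blk. block_field I blk \<Longrightarrow> maps_endo Ncot I Ncot I (psi h)"
proof -
  obtain a u where au: "h = (a, u)" "a \<in> carrier isoG" using h by (auto simp: Hcot_simps)
  have a: "isom a" by (rule carrier_isom[OF au(2)])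
  have aa: "maps_endo M J M J a" "maps_form2 M g M g a"
    using a by (simp_all add: affine_holomorphic_isometry_def)
  obtain L b where L: "linear L" "theta M dev a = (\<lambda>x. L x + b)"
    "\<And>m. m \<in> points M \<Longrightarrow> dev (a m) = L (dev m) + b" by (rule iso_theta[OF a], rule that; (assumption | blast))
  have psi: "psi h (pt (m, w)) = pt (a m, L w + (b + sharp_map Bf u))" if "m \<in> points M" for m w
    using psi_pt[OF that] by (simp add: au(1) L(2) add.assoc)
  show "smooth_map Ncot Ncot (psi h)" by (rule lift_smooth_map[OF iso_smooth[OF a] L(1,3) psi])
  show "maps_form2 Ncot gc Ncot gc (psi h)" by (rule lift_maps_form2[OF iso_smooth[OF a] L(1,3) psi aa(2)])
  show "maps_endo Ncot I Ncot I (psi h)" if "block_field I blk" for I blk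
    by (rule lift_maps_endo[OF iso_smooth[OF a] L(1,3) psi that aa(1)])
qed

lemma psi_preserves:
  assumes h: "h \<in> carrier Hcot"
  shows "preserves_hyperkaehler Ncot (cot_I1 J C) (cot_I2 om C) (cot_I3 J om C) gc (psi h)"
proof -
  have inv: "inv_into (points Ncot) (psi h) \<xi> = psi (m_inv Hcot h) \<xi>" if \<xi>: "\<xi> \<in> points Ncot" for \<xi>
  proof (rule inv_into_f_eq[where f = "psi h"])
    show "inj_on (psi h) (points Ncot)" by (rule bij_betw_imp_inj_on[OF psi_bij[OF h]])
    show "psi (m_inv Hcot h) \<xi> \<in> points Ncot" by (rule psi_points[OF H.inv_closed[OF h] \<xi>])
    show "psi h (psi (m_inv Hcot h) \<xi>) = \<xi>" by (rule psi_inverse(2)[OF h \<xi>])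
  qed
  \<comment> \<open>On bundle points the inverse map is the action of the inverse group element,
    which is smooth like any other.\<close>
  have s: "smooth_map Ncot Ncot (inv_into (points Ncot) (psi h))"
    by (rule smooth_map_cong_points[OF smooth_manifold_Ncot smooth_manifold_Ncot
          psi_smooth_maps(1)[OF H.inv_closed[OF h]] inv])
  show ?thesis
    unfolding preserves_hyperkaehler_def diffeomorphism_def
    by (intro conjI psi_bij[OF h] psi_smooth_maps(1,2)[OF h] s psi_smooth_maps(3)[OF h block_cot_I1]
      psi_smooth_maps(3)[OF h block_cot_I2] psi_smooth_maps(3)[OF h block_cot_I3])
qed

lemma transitive_psi:
  assumes "transitive_action isoG (points M) (\<lambda>a. a)"
  shows "transitive_action Hcot (points Ncot) psi"
proof -
  interpret t: transitive_action isoG "points M" "\<lambda>a. a" by (rule assms)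
  interpret A: group_action Hcot "points Ncot" psi by (rule group_action_psi)
  show ?thesis
  proof unfold_locales
    fix \<xi> \<xi>' assume "\<xi> \<in> points Ncot" "\<xi>' \<in> points Ncot"
    then obtain m w m' w' where m: "m \<in> points M" "\<xi> = pt (m, w)" "m' \<in> points M" "\<xi>' = pt (m', w')"
      by (auto simp: points_Ncot)
    obtain a where a: "a \<in> carrier isoG" "a m = m'" using t.unique_orbit[OF m(1,3)] by blast
    \<comment> \<open>Once \<open>a\<close> moves the base point, a translation in the fibre makes
      up the remaining difference; \<open>flat_map Bf\<close> turns that difference into a
      covector.\<close>
    have "psi (a, flat_map Bf (w' - theta M dev a w)) \<xi> = \<xi>'"
      using m a by (simp add: psi_pt)
    then show "\<exists>h\<in>carrier Hcot. psi h \<xi> = \<xi>'" using a(1) by (auto simp: Hcot_simps)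
  qed
qed

end

theorem theorem6p4:
  fixes M :: "('i, 'a, real ^ 'n) atlas"
    and J :: "('i, real ^ 'n) endo"
    and g :: "('i, real ^ 'n) form2"
    and C :: "('i, real ^ 'n) christoffel"
    and dev :: "'a \<Rightarrow> real ^ 'n"
  defines "\<omega> \<equiv> kaehler_form g J"
    and "G \<equiv> isometry_group M J g C"
  defines "H \<equiv> affine_semidirect G (theta_hat M dev \<omega>)"
    and "N \<equiv> cotangent_bundle M"
    and "I1 \<equiv> cot_I1 J C"
    and "I2 \<equiv> cot_I2 \<omega> C"
    and "I3 \<equiv> cot_I3 J \<omega> C"
    and "gc \<equiv> cot_g g C"
  assumes "special_kaehler M J g C"
    and "simply_connected_manifold M"
    and "developing_map M C dev"
  shows "hyperkaehler N I1 I2 I3 gc \<and>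
         group_action H (points N) (psi_hat M dev \<omega>) \<and>
         (\<forall>h\<in>carrier H. preserves_hyperkaehler N I1 I2 I3 gc (psi_hat M dev \<omega> h)) \<and>
         (homogeneous_special_kaehler M J g C G (\<lambda>a. a) \<longrightarrow>
            homogeneous_hyperkaehler N I1 I2 I3 gc H (psi_hat M dev \<omega>))"
proof -
  have "smooth_manifold M" using assms(9) by (simp add: special_kaehler_def kaehler_manifold_def)
  moreover have "connected_space (manifold_topology M)" "points M \<noteq> {}"
    using assms(10) path_connected_imp_connected_space by (auto simp: simply_connected_manifold_def)
  ultimately interpret S: developed_special_kaehler M J g C dev
    by (intro developed_special_kaehler.intro smooth_mfd.intro developed_special_kaehler_axioms.intro assms(9,11))
  have eqs: "\<omega> = S.om" "G = S.isoG" "N = S.Ncot"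
    by (simp_all add: \<omega>_def S.om_def G_def S.isoG_def N_def S.Ncot_def)
  show ?thesis
    unfolding H_def I1_def I2_def I3_def gc_def eqs homogeneous_hyperkaehler_def homogeneous_special_kaehler_def
    by (intro conjI impI ballI; (elim conjE)?;
        (rule S.hyperkaehler_Ncot S.group_action_psi | erule S.psi_preserves S.transitive_psi))
qed

end
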